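(* Let $X\subset\mathbb{R}^d$ be open and $H\in\mathcal{G}_{L^2\,ln}(X^2)$. Denote by $L_n$ the kernel of $\widehat H^n:\mathcal{G}_{L^2}(X)\to\mathcal{G}_{L^2}(X)$ (with $L_1=H$), and by $(L_{n,\varepsilon})_\varepsilon$ a representative of $L_n$. For all $\varepsilon\in(0,1]$, the series $\sum_{n\ge1}\frac{L_{n,\varepsilon}}{n!}$, where $(L_{n,\varepsilon})_\varepsilon\in\mathcal{H}_{L^2\,ln}(X^2)$ is a representative of $L_n$, converges in $L^2$-norm. Its sum, denoted by $S_\varepsilon$, defines an element $(S_\varepsilon)_\varepsilon$ of $\mathcal{E}_{L^2}(X^2)$. Setting $S=Cl(S_\varepsilon)_\varepsilon$ in $\mathcal{G}_{L^2}(X^2)$, the exponential of $\widehat H$ is defined as $e^{\widehat H}=\widehat S+Id$, where $Id$ is the identity operator.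
   Context: For $\Omega\subset\mathbb{R}^d$ open, $H^\infty(\Omega)=\bigcap_m H^m(\Omega)$ with the norms $\|f\|'_m=\sum_{|\alpha|\le m}\|\partial^\alpha f\|_{L^2(\Omega)}$, $m\ge0$. $\mathcal{E}_{L^2}(\Omega)$ is the set of nets $(u_\varepsilon)_{\varepsilon\in(0,1]}$ in $H^\infty(\Omega)$ such that for every $m$ there is $n\in\mathbb{N}$ with $\|u_\varepsilon\|'_m=O(\varepsilon^{-n})$ as $\varepsilon\to0$; $\mathcal{I}_{L^2}(\Omega)$ is the set of nets such that for all $m$ and all $n\in\mathbb{N}$, $\|u_\varepsilon\|'_m=O(\varepsilon^{n})$. $\mathcal{G}_{L^2}(\Omega)=\mathcal{E}_{L^2}(\Omega)/\mathcal{I}_{L^2}(\Omega)$, and $Cl$ denotes the class of a net. $\mathcal{H}_{L^2\,ln}(\Omega)$ is the set of nets $(u_\varepsilon)_\varepsilon$ in $H^\infty(\Omega)$ such that for all $m\ge0$, $\|u_\varepsilon\|'_m=O(|\ln\varepsilon|)$ as $\varepsilon\to0$, and $\mathcal{G}_{L^2\,ln}(\Omega)=\mathcal{H}_{L^2\,ln}(\Omega)/\mathcal{I}_{L^2}(\Omega)$. For $H=Cl(H_\varepsilon)_\varepsilon\in\mathcal{G}_{L^2}(X^2)$, the generalized integral operator with kernel $H$ is $\widehat H:\mathcal{G}_{L^2}(X)\to\mathcal{G}_{L^2}(X)$, $\widehat H(f)=Cl\big(x\mapsto\int_X H_\varepsilon(x,y)f_\varepsilon(y)\,\mathrm{d}y\big)_\varepsilon$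 (independent of the representatives $(H_\varepsilon)_\varepsilon$ of $H$ and $(f_\varepsilon)_\varepsilon$ of $f$), and $\widehat H^n$ is its $n$-fold composition with itself. For $n\ge2$, $\widehat H^n$ is a generalized integral operator with kernel $L_n\in\mathcal{G}_{L^2}(X^2)$, the class of the net $$(x,y)\mapsto\int_{X^{n-1}}H_\varepsilon(x,\xi_1)H_\varepsilon(\xi_1,\xi_2)\cdots H_\varepsilon(\xi_{n-1},y)\,\mathrm{d}\xi_1\cdots\mathrm{d}\xi_{n-1},$$ where $(H_\varepsilon)_\varepsilon$ is a representative of $H$.
   Formalization: L_{n,ε} is taken to be the iterated integral over X^{n-1} built from an arbitrary representative of H, not an arbitrary representative of L_n in H_{L² ln}, since for n≥2 none need exist there and for arbitrary representatives the series can diverge. *)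

theory Defs
  imports "HOL-Analysis.Analysis" "HOL-Library.Landau_Symbols"
begin

subsection \<open>The spaces \<open>L\<^sup>2(\<Omega>)\<close> and \<open>H\<^sup>\<infinity>(\<Omega>)\<close>\<close>

text \<open>
  Elements of \<open>L\<^sup>2(\<Omega>)\<close> are handled through functions on the whole space of which only the values on
  \<open>\<Omega>\<close> matter. They are required to be Borel (not merely Lebesgue) measurable: every \<open>L\<^sup>2\<close>-class has such
  a member, and integrands such as \<open>H(x,\<xi>\<^sub>1) H(\<xi>\<^sub>1,\<xi>\<^sub>2)\<close> are then measurable for product measures.
  Almost-everywhere equal functions are identified later, by the quotients modulo negligible nets.
\<close>

abbreviation lborel_on :: "'a::euclidean_space set \<Rightarrow> 'a measure"
  where "lborel_on \<Omega> \<equiv> restrict_space lborel \<Omega>"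

definition L2_space :: "'a::euclidean_space set \<Rightarrow> ('a \<Rightarrow> complex) set"
  where "L2_space \<Omega> = {f. f \<in> borel_measurable (lborel_on \<Omega>) \<and>
                          integrable (lborel_on \<Omega>) (\<lambda>x. (cmod (f x))\<^sup>2)}"

definition L2_norm_on :: "'a::euclidean_space set \<Rightarrow> ('a \<Rightarrow> complex) \<Rightarrow> real"
  where "L2_norm_on \<Omega> f = sqrt (LINT x|lborel_on \<Omega>. (cmod (f x))\<^sup>2)"

definition L2_sums :: "'a::euclidean_space set \<Rightarrow> (nat \<Rightarrow> 'a \<Rightarrow> complex) \<Rightarrow> ('a \<Rightarrow> complex) \<Rightarrow> bool"
  where "L2_sums \<Omega> f s \<longleftrightarrow> (\<forall>n\<ge>1. f n \<in> L2_space \<Omega>) \<and> s \<in> L2_space \<Omega> \<and>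
           (\<lambda>N. L2_norm_on \<Omega> (\<lambda>x. (\<Sum>n=1..N. f n x) - s x)) \<longlonglongrightarrow> 0"

definition partial_deriv :: "'a::euclidean_space \<Rightarrow> ('a \<Rightarrow> complex) \<Rightarrow> 'a \<Rightarrow> complex"
  where "partial_deriv b \<phi> = (\<lambda>x. frechet_derivative \<phi> (at x) b)"

definition iter_partial :: "'a::euclidean_space list \<Rightarrow> ('a \<Rightarrow> complex) \<Rightarrow> 'a \<Rightarrow> complex"
  where "iter_partial bs \<phi> = foldr partial_deriv bs \<phi>"

definition test_functions :: "'a::euclidean_space set \<Rightarrow> ('a \<Rightarrow> complex) set"
  where "test_functions \<Omega> = {\<phi>. (\<forall>bs. set bs \<subseteq> Basis \<longrightarrow> iter_partial bs \<phi> differentiable_on UNIV) \<and>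
           compact (closure {x. \<phi> x \<noteq> 0}) \<and> closure {x. \<phi> x \<noteq> 0} \<subseteq> \<Omega>}"

definition multi_index_order :: "('a::euclidean_space \<Rightarrow> nat) \<Rightarrow> nat"
  where "multi_index_order \<alpha> = (\<Sum>b\<in>Basis. \<alpha> b)"

definition multi_indices :: "nat \<Rightarrow> ('a::euclidean_space \<Rightarrow> nat) set"
  where "multi_indices m = {\<alpha>. (\<forall>b. b \<notin> Basis \<longrightarrow> \<alpha> b = 0) \<and> multi_index_order \<alpha> \<le> m}"

text \<open>
  For a test function \<open>\<phi>\<close>, the derivative \<open>\<partial>\<^sup>\<alpha>\<phi>\<close> is \<open>iter_partial bs \<phi>\<close> for any list \<open>bs\<close> in which each
  basis vector \<open>b\<close> occurs \<open>\<alpha> b\<close> times; the order of differentiation is immaterial.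
\<close>

definition has_weak_partial ::
    "'a::euclidean_space set \<Rightarrow> ('a \<Rightarrow> nat) \<Rightarrow> ('a \<Rightarrow> complex) \<Rightarrow> ('a \<Rightarrow> complex) \<Rightarrow> bool"
  where "has_weak_partial \<Omega> \<alpha> f g \<longleftrightarrow>
     (\<forall>\<phi>\<in>test_functions \<Omega>. \<forall>bs. (\<forall>b. count_list bs b = \<alpha> b) \<longrightarrow>
        (LINT x|lborel_on \<Omega>. f x * iter_partial bs \<phi> x) =
          (-1) ^ multi_index_order \<alpha> * (LINT x|lborel_on \<Omega>. g x * \<phi> x))"

definition Sobolev :: "'a::euclidean_space set \<Rightarrow> nat \<Rightarrow> ('a \<Rightarrow> complex) set"
  where "Sobolev \<Omega> m = {f \<in> L2_space \<Omega>.
           \<forall>\<alpha>\<in>multi_indices m. \<exists>g\<in>L2_space \<Omega>. has_weak_partial \<Omega> \<alpha> f g}"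

definition Sobolev_inf :: "'a::euclidean_space set \<Rightarrow> ('a \<Rightarrow> complex) set"
  where "Sobolev_inf \<Omega> = (\<Inter>m. Sobolev \<Omega> m)"

definition weak_partial ::
    "'a::euclidean_space set \<Rightarrow> ('a \<Rightarrow> nat) \<Rightarrow> ('a \<Rightarrow> complex) \<Rightarrow> 'a \<Rightarrow> complex"
  where "weak_partial \<Omega> \<alpha> f = (SOME g. g \<in> L2_space \<Omega> \<and> has_weak_partial \<Omega> \<alpha> f g)"

definition Sobolev_norm :: "'a::euclidean_space set \<Rightarrow> nat \<Rightarrow> ('a \<Rightarrow> complex) \<Rightarrow> real"
  where "Sobolev_norm \<Omega> m f = (\<Sum>\<alpha>\<in>multi_indices m. L2_norm_on \<Omega> (weak_partial \<Omega> \<alpha> f))"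

subsection \<open>Generalized functions\<close>

text \<open>A net is a function of \<open>\<epsilon>\<close> of which only the values for \<open>\<epsilon> \<in> (0,1]\<close> matter.\<close>

type_synonym 'a net = "real \<Rightarrow> 'a \<Rightarrow> complex"

definition Sobolev_nets :: "'a::euclidean_space set \<Rightarrow> 'a net set"
  where "Sobolev_nets \<Omega> = {u. \<forall>\<epsilon>\<in>{0<..1}. u \<epsilon> \<in> Sobolev_inf \<Omega>}"

definition moderate_nets :: "'a::euclidean_space set \<Rightarrow> 'a net set"
  where "moderate_nets \<Omega> = {u \<in> Sobolev_nets \<Omega>. \<forall>m. \<exists>n::nat.
           (\<lambda>\<epsilon>. Sobolev_norm \<Omega> m (u \<epsilon>)) \<in> O[at_right 0](\<lambda>\<epsilon>. 1 / \<epsilon> ^ n)}"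

definition negligible_nets :: "'a::euclidean_space set \<Rightarrow> 'a net set"
  where "negligible_nets \<Omega> = {u \<in> Sobolev_nets \<Omega>. \<forall>m. \<forall>n::nat.
           (\<lambda>\<epsilon>. Sobolev_norm \<Omega> m (u \<epsilon>)) \<in> O[at_right 0](\<lambda>\<epsilon>. \<epsilon> ^ n)}"

definition log_nets :: "'a::euclidean_space set \<Rightarrow> 'a net set"
  where "log_nets \<Omega> = {u \<in> Sobolev_nets \<Omega>. \<forall>m.
           (\<lambda>\<epsilon>. Sobolev_norm \<Omega> m (u \<epsilon>)) \<in> O[at_right 0](\<lambda>\<epsilon>. \<bar>ln \<epsilon>\<bar>)}"

definition net_rel :: "'a::euclidean_space set \<Rightarrow> 'a net set \<Rightarrow> ('a net \<times> 'a net) set"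
  where "net_rel \<Omega> A = {(u, v). u \<in> A \<and> v \<in> A \<and> (\<lambda>\<epsilon> x. u \<epsilon> x - v \<epsilon> x) \<in> negligible_nets \<Omega>}"

definition G_L2 :: "'a::euclidean_space set \<Rightarrow> 'a net set set"
  where "G_L2 \<Omega> = moderate_nets \<Omega> // net_rel \<Omega> (moderate_nets \<Omega>)"

text \<open>
  As negligible nets are logarithmic and logarithmic nets are moderate, every element of \<open>G_L2_ln \<Omega>\<close>
  is, as a set of nets, also an element of \<open>G_L2 \<Omega>\<close>.
\<close>

definition G_L2_ln :: "'a::euclidean_space set \<Rightarrow> 'a net set set"
  where "G_L2_ln \<Omega> = log_nets \<Omega> // net_rel \<Omega> (log_nets \<Omega>)"

definition Cl :: "'a::euclidean_space set \<Rightarrow> 'a net \<Rightarrow> 'a net set"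
  where "Cl \<Omega> u = net_rel \<Omega> (moderate_nets \<Omega>) `` {u}"

definition G_add :: "'a::euclidean_space set \<Rightarrow> 'a net set \<Rightarrow> 'a net set \<Rightarrow> 'a net set"
  where "G_add \<Omega> F G = (THE C. \<forall>f\<in>F. \<forall>g\<in>G. C = Cl \<Omega> (\<lambda>\<epsilon> x. f \<epsilon> x + g \<epsilon> x))"

subsection \<open>Generalized integral operators\<close>

definition gen_int_op ::
    "'a::euclidean_space set \<Rightarrow> ('a \<times> 'a) net set \<Rightarrow> 'a net set \<Rightarrow> 'a net set"
  where "gen_int_op X H F =
    (THE C. \<forall>h\<in>H. \<forall>f\<in>F. C = Cl X (\<lambda>\<epsilon> x. LINT y|lborel_on X. h \<epsilon> (x, y) * f \<epsilon> y))"

definition is_kernel_of ::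
    "'a::euclidean_space set \<Rightarrow> ('a \<times> 'a) net set \<Rightarrow> ('a net set \<Rightarrow> 'a net set) \<Rightarrow> bool"
  where "is_kernel_of X L T \<longleftrightarrow> L \<in> G_L2 (X \<times> X) \<and> (\<forall>F\<in>G_L2 X. T F = gen_int_op X L F)"

text \<open>
  The integral of \<open>k(x,\<xi>\<^sub>1) k(\<xi>\<^sub>1,\<xi>\<^sub>2) \<dots> k(\<xi>\<^sub>n\<^sub>-\<^sub>1,y)\<close> over \<open>X\<^bsup>n-1\<^esup>\<close>. For \<open>n = 1\<close> the product measure is a
  point mass and the value is \<open>k (x, y)\<close>; only \<open>n \<ge> 1\<close> is meaningful.
\<close>

definition iter_kernel ::
    "'a::euclidean_space set \<Rightarrow> nat \<Rightarrow> ('a \<times> 'a \<Rightarrow> complex) \<Rightarrow> 'a \<times> 'a \<Rightarrow> complex"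
  where "iter_kernel X n k = (\<lambda>(x, y).
    LINT \<xi>|Pi\<^sub>M {1..<n} (\<lambda>_. lborel_on X).
      (let p = (\<lambda>i. if i = 0 then x else if i = n then y else \<xi> i)
       in \<Prod>i<n. k (p i, p (Suc i))))"

text \<open>\<open>S \<epsilon>\<close> is determined by \<open>h\<close> up to a null set of \<open>X \<times> X\<close>.\<close>

definition exp_series_sum ::
    "'a::euclidean_space set \<Rightarrow> ('a \<times> 'a) net \<Rightarrow> ('a \<times> 'a) net \<Rightarrow> bool"
  where "exp_series_sum X h S \<longleftrightarrow>
    (\<forall>\<epsilon>\<in>{0<..1}. L2_sums (X \<times> X) (\<lambda>n z. iter_kernel X n (h \<epsilon>) z / fact n) (S \<epsilon>))"

definition exp_kernel ::
    "'a::euclidean_space set \<Rightarrow> ('a \<times> 'a) net set \<Rightarrow> ('a \<times> 'a) net set"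
  where "exp_kernel X H = (THE C. \<forall>h\<in>H. \<forall>S. exp_series_sum X h S \<longrightarrow> C = Cl (X \<times> X) S)"

definition gen_exp ::
    "'a::euclidean_space set \<Rightarrow> ('a \<times> 'a) net set \<Rightarrow> 'a net set \<Rightarrow> 'a net set"
  where "gen_exp X H F = G_add X (gen_int_op X (exp_kernel X H) F) F"

end

theory Submission
  imports Defs "HOL-Computational_Algebra.Polynomial"
begin

text \<open>
  Cauchy--Schwarz bounds the norm of a composed kernel by the product of the norms, and a weak derivative
  \<open>\<partial>\<^sub>x\<^sup>\<alpha>\<partial>\<^sub>y\<^sup>\<beta>\<close> of \<open>\<integral> k(x,\<xi>) h(\<xi>,y) d\<xi>\<close> falls on \<open>k\<close> in \<open>x\<close> and on \<open>h\<close> in \<open>y\<close>. Hence every weak derivative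
  of order at most \<open>m\<close> of the \<open>n\<close>-th iterated kernel has norm at most \<open>B\<^sup>n\<close>, where \<open>B\<close> is the \<open>m\<close>-th Sobolev norm
  of \<open>H\<^sub>\<epsilon>\<close>, and the exponential series converges together with all its derivatives, with norms at most \<open>e\<^sup>B\<close>.
  As \<open>B = O(|ln \<epsilon>|)\<close>, this is a power of \<open>1/\<epsilon>\<close>. For two representatives whose norms are at most \<open>B\<close> and whose
  difference has norm at most \<open>\<delta>\<close>, telescoping gives the bound \<open>n B\<^bsup>n-1\<^esup> \<delta>\<close> for the iterated kernels, so that the
  sums differ by at most \<open>e\<^sup>B \<delta>\<close>, which is negligible.

  Weak derivatives are moved under the integral by testing against products \<open>\<phi>(x) \<psi>(y)\<close> and applying the
  fundamental lemma of the calculus of variations in one variable. Only first-order derivatives are ever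
  moved, so that the symmetry of mixed partial derivatives of test functions is not needed.
\<close>

subsection \<open>Square-integrable functions on a measure space\<close>

text \<open>Derivatives of all orders are carried at once by a family \<open>wfam\<close>, indexed
  by multi-indices and linked by first-order steps alone. Such families are stable under application
  and composition of kernels and under L2 limits. Uniqueness of weak derivatives lets any of them
  compute the Sobolev norms, whatever \<open>weak_partial\<close> has chosen. A derivative of a
  composed kernel is a single term, with no Leibniz sum, which is why no factor depending on m and n
  enters the powers of B.

  The second obstacle is null sets. A Bochner integral has the value 0 where the integrand is not
  integrable, so linearity, Fubini and the recursion for iterated kernels hold only almost
  everywhere. Finiteness is therefore established with nonnegative integrals first, and null-set
  discrepancies disappear in the quotients because nets that vanish almost everywhere are
  negligible. The operators and the exponential are defined by \<open>THE\<close> over all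
  representatives, so independence of representatives comes before any value can be
  computed.\<close>

definition sqint :: "'a measure \<Rightarrow> ('a \<Rightarrow> complex) \<Rightarrow> bool"
  where "sqint M f \<longleftrightarrow> f \<in> borel_measurable M \<and> integrable M (\<lambda>x. (cmod (f x))\<^sup>2)"

definition l2norm :: "'a measure \<Rightarrow> ('a \<Rightarrow> complex) \<Rightarrow> real"
  where "l2norm M f = sqrt (LINT x|M. (cmod (f x))\<^sup>2)"

lemma sqint_measurable: "sqint M f \<Longrightarrow> f \<in> borel_measurable M"
  by (simp add: sqint_def)

lemma l2norm_nonneg [simp]: "0 \<le> l2norm M f"
  by (simp add: l2norm_def)

abbreviation (input) nn2 :: "'a measure \<Rightarrow> ('a \<Rightarrow> complex) \<Rightarrow> ennreal"
  where "nn2 M f \<equiv> \<integral>\<^sup>+x. ennreal ((cmod (f x))\<^sup>2) \<partial>M"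

lemma sqint_iff_nn:
  "sqint M f \<longleftrightarrow> f \<in> borel_measurable M \<and> nn2 M f < \<infinity>"
  unfolding sqint_def integrable_iff_bounded by auto

lemma nn_eq_l2norm:
  assumes "sqint M f"
  shows "nn2 M f = ennreal ((l2norm M f)\<^sup>2)"
  using assms unfolding sqint_def l2norm_def
  by (subst nn_integral_eq_integral) auto

lemma sqintI_nn:
  assumes "f \<in> borel_measurable M" "nn2 M f \<le> ennreal (c\<^sup>2)" "0 \<le> c"
  shows "sqint M f" "l2norm M f \<le> c"
proof -
  show sq: "sqint M f"
    unfolding sqint_iff_nn using assms by (auto intro: le_less_trans)
  have "ennreal ((l2norm M f)\<^sup>2) \<le> ennreal (c\<^sup>2)"
    using assms(2) nn_eq_l2norm[OF sq] by simp
  then show "l2norm M f \<le> c"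
    using assms(3)
    by (simp add: abs_le_square_iff[symmetric])
qed

lemma ennreal_finiteE:
  assumes "x \<noteq> \<infinity>"
  obtains r where "r \<ge> 0" "x = ennreal r"
  using assms by (cases x) auto

text \<open>Integrates 2 u v \<le> c u^2 + v^2 / c and chooses the best c. With values in
  \<open>ennreal\<close> no integrability is required; iterated kernels depend on this, since their
  finiteness is still to be proved when the inequality is applied.\<close>

lemma nn_integral_Cauchy_Schwarz:
  fixes f g :: "'a \<Rightarrow> ennreal"
  assumes [measurable]: "f \<in> borel_measurable M" "g \<in> borel_measurable M"
  shows "(\<integral>\<^sup>+x. f x * g x \<partial>M)\<^sup>2 \<le> (\<integral>\<^sup>+x. (f x)\<^sup>2 \<partial>M) * (\<integral>\<^sup>+x. (g x)\<^sup>2 \<partial>M)"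
proof -
  let ?A = "\<integral>\<^sup>+x. (f x)\<^sup>2 \<partial>M" and ?B = "\<integral>\<^sup>+x. (g x)\<^sup>2 \<partial>M" and ?C = "\<integral>\<^sup>+x. f x * g x \<partial>M"
  have amgm: "2 * (u * v) \<le> ennreal c * u\<^sup>2 + ennreal (1 / c) * v\<^sup>2" if "c > 0" for u v :: ennreal and c
  proof (cases "u = \<infinity> \<or> v = \<infinity>")
    case True
    then show ?thesis
      using that by (auto simp: ennreal_mult_top power2_eq_square)
  next
    case False
    then obtain a b where ab: "a \<ge> 0" "b \<ge> 0" "u = ennreal a" "v = ennreal b"
      by (meson ennreal_finiteE)
    have "0 \<le> (sqrt c * a - b / sqrt c)\<^sup>2" by simp
    also have "\<dots> = c * a\<^sup>2 + 1 / c * b\<^sup>2 - 2 * (a * b)"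
      using that by (simp add: power2_diff power_mult_distrib power_divide)
    finally have "2 * (a * b) \<le> c * a\<^sup>2 + 1 / c * b\<^sup>2" by simp
    then have "ennreal (2 * (a * b)) \<le> ennreal (c * a\<^sup>2 + 1 / c * b\<^sup>2)"
      by (rule ennreal_leI)
    moreover have "ennreal (2 * (a * b)) = 2 * (u * v)"
      using ab by (simp add: ennreal_mult ennreal_mult')
    moreover have "ennreal (c * a\<^sup>2 + 1 / c * b\<^sup>2) = ennreal c * u\<^sup>2 + ennreal (1 / c) * v\<^sup>2"
      using ab that by (simp add: ennreal_power flip: ennreal_plus ennreal_mult)
    ultimately show ?thesis by simp
  qed
  \<comment> \<open>A vanishing factor makes the product vanish almost everywhere; an infinite
    factor next to a nonzero one makes the right-hand side infinite. What remains are positive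
    reals.\<close>
  consider "?A = 0 \<or> ?B = 0" | "?A \<noteq> 0" "?B \<noteq> 0" "?A = \<infinity> \<or> ?B = \<infinity>"
    | "?A \<noteq> 0" "?B \<noteq> 0" "?A \<noteq> \<infinity>" "?B \<noteq> \<infinity>" by blast
  then show ?thesis
  proof cases
    case 1
    then have "AE x in M. f x * g x = 0"
    proof
      assume "?A = 0"
      then have "AE x in M. (f x)\<^sup>2 = 0" by (subst (asm) nn_integral_0_iff_AE) auto
      then show ?thesis by eventually_elim simp
    next
      assume "?B = 0"
      then have "AE x in M. (g x)\<^sup>2 = 0" by (subst (asm) nn_integral_0_iff_AE) auto
      then show ?thesis by eventually_elim simp
    qed
    then have "?C = 0" by (subst nn_integral_0_iff_AE) auto
    then show ?thesis by simp
  next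
    case 2
    then show ?thesis by (auto simp: ennreal_mult_top ennreal_top_mult)
  next
    case 3
    then obtain a b where ab: "a \<ge> 0" "b \<ge> 0" "?A = ennreal a" "?B = ennreal b"
      by (meson ennreal_finiteE)
    then have pos: "a > 0" "b > 0" using 3 by (auto simp: less_le)
    \<comment> \<open>The minimiser of c a + b / c: both summands become sqrt (a b).\<close>
    define c where "c = sqrt (b / a)"
    have c: "c > 0" using pos by (simp add: c_def)
    have "2 * ?C = (\<integral>\<^sup>+x. 2 * (f x * g x) \<partial>M)"
      by (simp add: nn_integral_cmult)
    also have "\<dots> \<le> (\<integral>\<^sup>+x. ennreal c * (f x)\<^sup>2 + ennreal (1 / c) * (g x)\<^sup>2 \<partial>M)"
      by (intro nn_integral_mono amgm c)
    also have "\<dots> = ennreal c * ?A + ennreal (1 / c) * ?B"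
      by (simp add: nn_integral_add nn_integral_cmult)
    also have "\<dots> = ennreal (c * a + 1 / c * b)"
      using ab c by (simp flip: ennreal_plus ennreal_mult)
    also have "c * a + 1 / c * b = 2 * sqrt (a * b)"
    proof -
      have "a = sqrt a * sqrt a" "b = sqrt b * sqrt b" using pos by simp_all
      then have "c * a = sqrt (a * b)" "1 / c * b = sqrt (a * b)"
        unfolding c_def real_sqrt_mult real_sqrt_divide using pos
        by (simp_all add: field_simps)
      then show ?thesis by simp
    qed
    finally have le: "2 * ?C \<le> ennreal (2 * sqrt (a * b))" .
    then have "?C \<noteq> \<infinity>"
      by (auto simp: ennreal_mult_top top_unique)
    then obtain r where r: "r \<ge> 0" "?C = ennreal r"
      by (meson ennreal_finiteE)
    have "ennreal (2 * r) \<le> ennreal (2 * sqrt (a * b))"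
      using le r by (simp add: ennreal_mult)
    then have "r \<le> sqrt (a * b)" using pos by simp
    then have "r\<^sup>2 \<le> (sqrt (a * b))\<^sup>2" using r by (intro power_mono) auto
    then have "r\<^sup>2 \<le> a * b" using pos by simp
    then show ?thesis
      using r ab by (simp add: ennreal_power ennreal_mult[symmetric] ennreal_leI)
  qed
qed

text \<open>Integrability comes first, from the nonnegative inequality; the estimates for Bochner
  integrals follow from it.\<close>

lemma
  assumes f: "sqint M f" and g: "sqint M g"
  shows sqint_mult_integrable: "integrable M (\<lambda>x. f x * g x)"
    and integral_norm_mult_le: "(LINT x|M. cmod (f x) * cmod (g x)) \<le> l2norm M f * l2norm M g"
    and norm_integral_mult_le: "cmod (LINT x|M. f x * g x) \<le> l2norm M f * l2norm M g"
proof -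
  let ?I = "\<integral>\<^sup>+x. ennreal (cmod (f x)) * ennreal (cmod (g x)) \<partial>M"
  have [measurable]: "f \<in> borel_measurable M" "g \<in> borel_measurable M"
    using f g by (auto simp: sqint_def)
  have "?I\<^sup>2
      \<le> (\<integral>\<^sup>+x. (ennreal (cmod (f x)))\<^sup>2 \<partial>M) * (\<integral>\<^sup>+x. (ennreal (cmod (g x)))\<^sup>2 \<partial>M)"
    by (rule nn_integral_Cauchy_Schwarz) auto
  also have "\<dots> = ennreal ((l2norm M f)\<^sup>2) * ennreal ((l2norm M g)\<^sup>2)"
    using nn_eq_l2norm[OF f] nn_eq_l2norm[OF g] by (simp add: ennreal_power)
  also have "\<dots> = ennreal (l2norm M f * l2norm M g) ^ 2"
    by (simp add: ennreal_mult[symmetric] ennreal_power power_mult_distrib)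
  finally have sq: "?I\<^sup>2 \<le> \<dots>" .
  have le: "?I \<le> ennreal (l2norm M f * l2norm M g)"
  proof (cases "?I = \<infinity>")
    case True
    then show ?thesis using sq by (simp add: ennreal_power top_unique)
  next
    case False
    then obtain r where r: "r \<ge> 0" "?I = ennreal r"
      by (meson ennreal_finiteE)
    then have "r\<^sup>2 \<le> (l2norm M f * l2norm M g)\<^sup>2" using sq by (simp add: ennreal_power)
    then have "r \<le> l2norm M f * l2norm M g" by (rule power2_le_imp_le) simp
    then show ?thesis using r by (simp add: ennreal_leI)
  qed
  then have le': "(\<integral>\<^sup>+x. ennreal (norm (f x * g x)) \<partial>M) \<le> ennreal (l2norm M f * l2norm M g)"
    by (simp add: norm_mult ennreal_mult)
  then show int: "integrable M (\<lambda>x. f x * g x)"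
    unfolding integrable_iff_bounded by (auto intro: le_less_trans)
  have "ennreal (LINT x|M. norm (f x * g x)) \<le> ennreal (l2norm M f * l2norm M g)"
    using le' int by (subst nn_integral_eq_integral[symmetric]) auto
  then show *: "(LINT x|M. cmod (f x) * cmod (g x)) \<le> l2norm M f * l2norm M g"
    by (simp add: norm_mult)
  show "cmod (LINT x|M. f x * g x) \<le> l2norm M f * l2norm M g"
    using integral_norm_bound[of M "\<lambda>x. f x * g x"] * by (simp add: norm_mult)
qed

lemma sqint_cmod_mult_integrable:
  assumes "sqint M f" "sqint M g"
  shows "integrable M (\<lambda>x. cmod (f x) * cmod (g x))"
  using integrable_norm[OF sqint_mult_integrable[OF assms]] by (simp add: norm_mult)

lemma
  assumes f: "sqint M f" and g: "sqint M g"
  shows sqint_add: "sqint M (\<lambda>x. f x + g x)"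
    and l2norm_triangle: "l2norm M (\<lambda>x. f x + g x) \<le> l2norm M f + l2norm M g"
proof -
  have [measurable]: "f \<in> borel_measurable M" "g \<in> borel_measurable M"
    using f g by (auto simp: sqint_def)
  have int: "integrable M (\<lambda>x. (cmod (f x))\<^sup>2 + (cmod (g x))\<^sup>2 + 2 * (cmod (f x) * cmod (g x)))"
    using f g sqint_cmod_mult_integrable[OF f g] by (auto simp: sqint_def)
  have le: "(cmod (f x + g x))\<^sup>2 \<le> (cmod (f x))\<^sup>2 + (cmod (g x))\<^sup>2 + 2 * (cmod (f x) * cmod (g x))" for x
  proof -
    have "(cmod (f x + g x))\<^sup>2 \<le> (cmod (f x) + cmod (g x))\<^sup>2"
      by (intro power_mono norm_triangle_ineq) simp
    then show ?thesis by (simp add: power2_sum)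
  qed
  have int2: "integrable M (\<lambda>x. (cmod (f x + g x))\<^sup>2)"
  proof (rule Bochner_Integration.integrable_bound[OF int])
    show "AE x in M. norm ((cmod (f x + g x))\<^sup>2)
       \<le> norm ((cmod (f x))\<^sup>2 + (cmod (g x))\<^sup>2 + 2 * (cmod (f x) * cmod (g x)))"
      by (rule AE_I2, subst (1 2) real_norm_def, subst (1 2) abs_of_nonneg) (auto intro!: le add_nonneg_nonneg)
  qed simp
  then show "sqint M (\<lambda>x. f x + g x)" by (simp add: sqint_def)
  have "(l2norm M (\<lambda>x. f x + g x))\<^sup>2 = (LINT x|M. (cmod (f x + g x))\<^sup>2)"
    by (simp add: l2norm_def)
  also have "\<dots> \<le> (LINT x|M. (cmod (f x))\<^sup>2 + (cmod (g x))\<^sup>2 + 2 * (cmod (f x) * cmod (g x)))"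
    by (intro integral_mono int int2 le)
  also have "\<dots> = (l2norm M f)\<^sup>2 + (l2norm M g)\<^sup>2 + 2 * (LINT x|M. cmod (f x) * cmod (g x))"
    using f g sqint_cmod_mult_integrable[OF f g] by (simp add: sqint_def l2norm_def)
  also have "\<dots> \<le> (l2norm M f + l2norm M g)\<^sup>2"
    using integral_norm_mult_le[OF f g] by (simp add: power2_sum)
  finally show "l2norm M (\<lambda>x. f x + g x) \<le> l2norm M f + l2norm M g"
    by (rule power2_le_imp_le) simp
qed

lemma sqint_cmult: "sqint M f \<Longrightarrow> sqint M (\<lambda>x. c * f x)"
  by (auto simp: sqint_def norm_mult power_mult_distrib)

lemma l2norm_cmult: "l2norm M (\<lambda>x. c * f x) = cmod c * l2norm M f"
  by (simp add: l2norm_def norm_mult power_mult_distrib real_sqrt_mult)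

lemma sqint_zero [simp]: "sqint M (\<lambda>x. 0)"
  by (simp add: sqint_def)

lemma l2norm_zero [simp]: "l2norm M (\<lambda>x. 0) = 0"
  by (simp add: l2norm_def)

lemma sqint_divide: "sqint M f \<Longrightarrow> sqint M (\<lambda>x. f x / c)"
  using sqint_cmult[of M f "1 / c"] by simp

lemma l2norm_divide: "l2norm M (\<lambda>x. f x / c) = l2norm M f / cmod c"
  using l2norm_cmult[of M "1 / c" f] by (simp add: norm_divide)

lemma sqint_diff:
  assumes "sqint M f" "sqint M g"
  shows "sqint M (\<lambda>x. f x - g x)"
  using sqint_add[OF assms(1) sqint_cmult[OF assms(2), of "-1"]] by simp

lemma l2norm_minus_commute: "l2norm M (\<lambda>x. f x - g x) = l2norm M (\<lambda>x. g x - f x)"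
  by (simp add: l2norm_def norm_minus_commute)

lemma l2norm_diff_triangle:
  assumes "sqint M f" "sqint M g" "sqint M h"
  shows "l2norm M (\<lambda>x. f x - h x) \<le> l2norm M (\<lambda>x. f x - g x) + l2norm M (\<lambda>x. g x - h x)"
  using l2norm_triangle[OF sqint_diff[OF assms(1,2)] sqint_diff[OF assms(2,3)]] by simp

lemma sqint_sum:
  assumes "\<And>i. i \<in> I \<Longrightarrow> sqint M (f i)"
  shows "sqint M (\<lambda>x. \<Sum>i\<in>I. f i x)"
  using assms by (induction I rule: infinite_finite_induct) (auto intro: sqint_add)

lemma l2norm_sum_le:
  assumes "\<And>i. i \<in> I \<Longrightarrow> sqint M (f i)"
  shows "l2norm M (\<lambda>x. \<Sum>i\<in>I. f i x) \<le> (\<Sum>i\<in>I. l2norm M (f i))"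
  using assms
proof (induction I rule: infinite_finite_induct)
  case (insert i I)
  have "l2norm M (\<lambda>x. f i x + (\<Sum>i\<in>I. f i x)) \<le> l2norm M (f i) + l2norm M (\<lambda>x. \<Sum>i\<in>I. f i x)"
    using insert.prems by (intro l2norm_triangle sqint_sum) auto
  then show ?case using insert by (auto intro: order_trans)
qed auto

lemma l2norm_cong_AE:
  assumes "AE x in M. f x = g x" "f \<in> borel_measurable M" "g \<in> borel_measurable M"
  shows "l2norm M f = l2norm M g"
proof -
  have "AE x in M. (cmod (f x))\<^sup>2 = (cmod (g x))\<^sup>2" using assms(1) by eventually_elim simp
  then show ?thesis unfolding l2norm_def using assms(2,3) by (subst integral_cong_AE) auto
qed

lemma sqint_cong_AE:
  assumes "AE x in M. f x = g x" "sqint M f" "g \<in> borel_measurable M"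
  shows "sqint M g"
proof -
  have "AE x in M. (cmod (f x))\<^sup>2 = (cmod (g x))\<^sup>2" using assms(1) by eventually_elim simp
  moreover have "f \<in> borel_measurable M" using assms(2) by (simp add: sqint_def)
  ultimately have "integrable M (\<lambda>x. (cmod (f x))\<^sup>2) \<longleftrightarrow> integrable M (\<lambda>x. (cmod (g x))\<^sup>2)"
    using assms(3) by (intro integrable_cong_AE) auto
  then show ?thesis using assms(2,3) by (simp add: sqint_def)
qed

lemma l2norm_eq_0_imp_AE:
  assumes "sqint M f" "l2norm M f = 0"
  shows "AE x in M. f x = 0"
proof -
  have "AE x in M. (cmod (f x))\<^sup>2 = 0"
    using assms by (subst integral_nonneg_eq_0_iff_AE[symmetric]) (auto simp: sqint_def l2norm_def)
  then show ?thesis by eventually_elim simp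
qed

lemma l2norm_diff_eq_0_imp_AE:
  assumes "sqint M f" "sqint M g" "l2norm M (\<lambda>x. f x - g x) \<le> 0"
  shows "AE x in M. f x = g x"
proof -
  have "l2norm M (\<lambda>x. f x - g x) = 0" using assms(3) l2norm_nonneg antisym by blast
  from l2norm_eq_0_imp_AE[OF sqint_diff[OF assms(1,2)] this] show ?thesis by simp
qed

section \<open>Limits and completeness in L2\<close>

lemma l2_limit_unique:
  assumes "\<And>n. sqint M (f n)" "sqint M s" "sqint M t"
    and "(\<lambda>n. l2norm M (\<lambda>x. f n x - s x)) \<longlonglongrightarrow> 0" "(\<lambda>n. l2norm M (\<lambda>x. f n x - t x)) \<longlonglongrightarrow> 0"
  shows "AE x in M. s x = t x"
proof (rule l2norm_diff_eq_0_imp_AE)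
  have "(\<lambda>n. l2norm M (\<lambda>x. f n x - s x) + l2norm M (\<lambda>x. f n x - t x)) \<longlonglongrightarrow> 0 + 0"
    by (intro tendsto_add assms)
  moreover have "l2norm M (\<lambda>x. s x - t x) \<le> l2norm M (\<lambda>x. f n x - s x) + l2norm M (\<lambda>x. f n x - t x)" for n
    using l2norm_diff_triangle[of M s "f n" t] assms(1-3) by (simp add: l2norm_minus_commute[of M s])
  ultimately show "l2norm M (\<lambda>x. s x - t x) \<le> 0"
    using LIMSEQ_le_const[of _ 0 "l2norm M (\<lambda>x. s x - t x)"] by auto
qed (use assms in auto)

lemma l2_limit_norm_le:
  assumes "\<And>n. sqint M (f n)" "sqint M s"
    and "(\<lambda>n. l2norm M (\<lambda>x. f n x - s x)) \<longlonglongrightarrow> 0" and "\<And>n. l2norm M (f n) \<le> C"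
  shows "l2norm M s \<le> C"
proof -
  have "(\<lambda>n. C + l2norm M (\<lambda>x. f n x - s x)) \<longlonglongrightarrow> C + 0"
    by (intro tendsto_add assms tendsto_const)
  moreover have "l2norm M s \<le> C + l2norm M (\<lambda>x. f n x - s x)" for n
    using l2norm_triangle[OF assms(1)[of n] sqint_diff[OF assms(2) assms(1)[of n]]] assms(4)[of n]
    by (simp add: l2norm_minus_commute[of M s])
  ultimately show ?thesis
    using LIMSEQ_le_const[of _ C "l2norm M s"] by auto
qed

text \<open>Serves the passage to the limit in the identity that defines a weak derivative, whose
  two sides are pairings with fixed test functions.\<close>

lemma l2_limit_integral_mult:
  assumes "\<And>n. sqint M (f n)" "sqint M s" "sqint M g"
    and "(\<lambda>n. l2norm M (\<lambda>x. f n x - s x)) \<longlonglongrightarrow> 0"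
  shows "(\<lambda>n. LINT x|M. f n x * g x) \<longlonglongrightarrow> (LINT x|M. s x * g x)"
proof (rule metric_tendsto_imp_tendsto)
  show "(\<lambda>n. l2norm M (\<lambda>x. f n x - s x) * l2norm M g) \<longlonglongrightarrow> 0"
    using tendsto_mult_left_zero[OF assms(4)] by simp
  have "dist (LINT x|M. f n x * g x) (LINT x|M. s x * g x) \<le> l2norm M (\<lambda>x. f n x - s x) * l2norm M g" for n
  proof -
    have "(LINT x|M. f n x * g x) - (LINT x|M. s x * g x) = (LINT x|M. (f n x - s x) * g x)"
      using assms by (simp add: sqint_mult_integrable left_diff_distrib)
    then show ?thesis
      using norm_integral_mult_le[OF sqint_diff[OF assms(1)[of n] assms(2)] assms(3)] by (simp add: dist_norm)
  qed
  then show "\<forall>\<^sub>F n in sequentially. dist (LINT x|M. f n x * g x) (LINT x|M. s x * g x)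
     \<le> dist (l2norm M (\<lambda>x. f n x - s x) * l2norm M g) 0"
    by (intro always_eventually allI) (simp add: dist_norm)
qed

text \<open>The partial sums \<open>F\<close> of the pointwise norms increase and have L2 norm at
  most \<open>C\<close>, so by monotone convergence their supremum is finite almost everywhere and
  the series converges absolutely there. Fatou's lemma, applied to the tails, turns this into
  convergence in norm.\<close>

theorem Riesz_Fischer_series:
  assumes f: "\<And>n. sqint M (f n)" and sum: "summable (\<lambda>n. l2norm M (f n))"
  shows "\<exists>s. sqint M s \<and> (\<lambda>N. l2norm M (\<lambda>x. (\<Sum>n<N. f n x) - s x)) \<longlonglongrightarrow> 0"
proof -
  have [measurable]: "f n \<in> borel_measurable M" for n using f by (simp add: sqint_def)
  define C where "C = (\<Sum>n. l2norm M (f n))"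
  have partial: "(\<Sum>n\<in>A. l2norm M (f n)) \<le> C" if "finite A" for A
    unfolding C_def by (rule sum_le_suminf) (use sum that in auto)
  have "C \<ge> 0" using partial[of "{}"] by simp
  define F where "F N x = (\<Sum>n<N. cmod (f n x))" for N x
  have [measurable]: "F N \<in> borel_measurable M" for N unfolding F_def by measurable
  have F_nonneg: "F N x \<ge> 0" for N x unfolding F_def by (simp add: sum_nonneg)
  have F_mono: "F N x \<le> F N' x" if "N \<le> N'" for N N' x
    unfolding F_def using that by (intro sum_mono2) auto
  have nnF: "(\<integral>\<^sup>+x. ennreal ((F N x)\<^sup>2) \<partial>M) \<le> ennreal (C\<^sup>2)" for N
  proof -
    \<comment> \<open>The norms are viewed as complex functions so that the triangle inequality for
      \<open>l2norm\<close> applies to \<open>F\<close>.\<close>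
    have s: "sqint M (\<lambda>x. of_real (cmod (f n x)))" for n
      using f[of n] by (simp add: sqint_def)
    have "sqint M (\<lambda>x. \<Sum>n<N. of_real (cmod (f n x)))"
      by (intro sqint_sum s)
    then have sF: "sqint M (\<lambda>x. of_real (F N x))" by (simp add: F_def)
    have "l2norm M (\<lambda>x. \<Sum>n<N. of_real (cmod (f n x))) \<le> (\<Sum>n<N. l2norm M (\<lambda>x. of_real (cmod (f n x))))"
      by (intro l2norm_sum_le s)
    also have "\<dots> = (\<Sum>n<N. l2norm M (f n))" by (simp add: l2norm_def)
    also have "\<dots> \<le> C" by (rule partial) simp
    finally have "l2norm M (\<lambda>x. of_real (F N x)) \<le> C" by (simp add: F_def)
    then have "(l2norm M (\<lambda>x. of_real (F N x)))\<^sup>2 \<le> C\<^sup>2" by (intro power_mono) auto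
    then show ?thesis using nn_eq_l2norm[OF sF] by (simp add: ennreal_leI)
  qed
  have "(\<integral>\<^sup>+x. (SUP N. ennreal ((F N x)\<^sup>2)) \<partial>M) = (SUP N. \<integral>\<^sup>+x. ennreal ((F N x)\<^sup>2) \<partial>M)"
    by (rule nn_integral_monotone_convergence_SUP)
       (auto simp: incseq_def le_fun_def intro!: ennreal_leI power_mono F_mono F_nonneg)
  also have "\<dots> \<le> ennreal (C\<^sup>2)" by (intro SUP_least nnF)
  finally have "(\<integral>\<^sup>+x. (SUP N. ennreal ((F N x)\<^sup>2)) \<partial>M) \<noteq> \<infinity>" by (auto simp: top_unique)
  then have "AE x in M. (SUP N. ennreal ((F N x)\<^sup>2)) \<noteq> \<infinity>"
    by (intro nn_integral_PInf_AE) auto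
  then have sumAE: "AE x in M. summable (\<lambda>n. f n x)"
  proof eventually_elim
    case (elim x)
    then obtain B where B: "B \<ge> 0" "(SUP N. ennreal ((F N x)\<^sup>2)) = ennreal B"
      by (meson ennreal_finiteE)
    have "F N x \<le> sqrt B" for N
    proof -
      have "ennreal ((F N x)\<^sup>2) \<le> ennreal B" unfolding B(2)[symmetric] by (rule SUP_upper) simp
      then show ?thesis using B(1) by (simp add: real_le_rsqrt)
    qed
    then have "summable (\<lambda>n. cmod (f n x))"
      unfolding F_def by (intro summableI_nonneg_bounded[of _ "sqrt B"]) auto
    then show ?case by (rule summable_norm_cancel)
  qed
  \<comment> \<open>On the null set where the series diverges the value of \<open>suminf\<close>
    does not matter.\<close>
  define s where "s x = (\<Sum>n. f n x)" for x
  have [measurable]: "s \<in> borel_measurable M" unfolding s_def by measurable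
  have tail: "(\<integral>\<^sup>+x. ennreal ((cmod ((\<Sum>n<N. f n x) - s x))\<^sup>2) \<partial>M) \<le> ennreal ((\<Sum>n. l2norm M (f (n + N)))\<^sup>2)" for N
  proof -
    \<comment> \<open>The limit is written as a \<open>liminf\<close> so that Fatou's lemma applies
      to the finite sections of the tail.\<close>
    have "AE x in M. ennreal ((cmod ((\<Sum>n<N. f n x) - s x))\<^sup>2)
        = liminf (\<lambda>K. ennreal ((cmod (\<Sum>n<K. f (n + N) x))\<^sup>2))"
      using sumAE
    proof eventually_elim
      case (elim x)
      have "(\<lambda>K. \<Sum>n<K. f (n + N) x) \<longlonglongrightarrow> (\<Sum>n. f (n + N) x)"
        by (intro summable_LIMSEQ summable_ignore_initial_segment elim)
      then have "(\<lambda>K. ennreal ((cmod (\<Sum>n<K. f (n + N) x))\<^sup>2)) \<longlonglongrightarrow> ennreal ((cmod (\<Sum>n. f (n + N) x))\<^sup>2)"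
        by (intro tendsto_intros tendsto_ennrealI)
      moreover have "cmod ((\<Sum>n<N. f n x) - s x) = cmod (\<Sum>n. f (n + N) x)"
        using suminf_split_initial_segment[OF elim, of N] unfolding s_def
        by (simp add: norm_minus_commute)
      ultimately show ?case
        by (metis lim_imp_Liminf trivial_limit_sequentially)
    qed
    then have "(\<integral>\<^sup>+x. ennreal ((cmod ((\<Sum>n<N. f n x) - s x))\<^sup>2) \<partial>M)
        = (\<integral>\<^sup>+x. liminf (\<lambda>K. ennreal ((cmod (\<Sum>n<K. f (n + N) x))\<^sup>2)) \<partial>M)"
      by (rule nn_integral_cong_AE)
    also have "\<dots> \<le> liminf (\<lambda>K. \<integral>\<^sup>+x. ennreal ((cmod (\<Sum>n<K. f (n + N) x))\<^sup>2) \<partial>M)"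
      by (rule nn_integral_liminf) simp
    also have "\<dots> \<le> liminf (\<lambda>K. ennreal ((\<Sum>n. l2norm M (f (n + N)))\<^sup>2))"
    proof (intro Liminf_mono always_eventually allI)
      fix K
      have sq: "sqint M (\<lambda>x. \<Sum>n<K. f (n + N) x)" by (intro sqint_sum f)
      have "l2norm M (\<lambda>x. \<Sum>n<K. f (n + N) x) \<le> (\<Sum>n<K. l2norm M (f (n + N)))"
        by (intro l2norm_sum_le f)
      also have "\<dots> \<le> (\<Sum>n. l2norm M (f (n + N)))"
        by (rule sum_le_suminf) (auto intro: summable_ignore_initial_segment sum)
      finally have "(l2norm M (\<lambda>x. \<Sum>n<K. f (n + N) x))\<^sup>2 \<le> (\<Sum>n. l2norm M (f (n + N)))\<^sup>2"
        by (intro power_mono) auto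
      then show "(\<integral>\<^sup>+x. ennreal ((cmod (\<Sum>n<K. f (n + N) x))\<^sup>2) \<partial>M) \<le> ennreal ((\<Sum>n. l2norm M (f (n + N)))\<^sup>2)"
        unfolding nn_eq_l2norm[OF sq] by (rule ennreal_leI)
    qed
    finally show ?thesis by (simp add: Liminf_const)
  qed
  have tail0: "0 \<le> (\<Sum>n. l2norm M (f (n + N)))" for N
    by (rule suminf_nonneg) (auto intro: summable_ignore_initial_segment sum)
  \<comment> \<open>For N = 0 the tail estimate concerns -s and yields its
    square-integrability.\<close>
  have "sqint M (\<lambda>x. (\<Sum>n<0. f n x) - s x)"
    by (rule sqintI_nn[OF _ tail tail0]) simp
  then have "sqint M (\<lambda>x. (-1) * (- s x))" by (intro sqint_cmult) simp
  then have "sqint M s" by simp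
  moreover have "(\<lambda>N. l2norm M (\<lambda>x. (\<Sum>n<N. f n x) - s x)) \<longlonglongrightarrow> 0"
  proof (rule tendsto_sandwich[OF _ _ tendsto_const])
    show "\<forall>\<^sub>F N in sequentially. l2norm M (\<lambda>x. (\<Sum>n<N. f n x) - s x) \<le> (\<Sum>n. l2norm M (f (n + N)))"
      by (intro always_eventually allI sqintI_nn(2)[OF _ tail tail0]) simp
    show "(\<lambda>N. \<Sum>n. l2norm M (f (n + N))) \<longlonglongrightarrow> 0"
      using suminf_exist_split2[OF sum] .
  qed simp
  ultimately show ?thesis by blast
qed

subsection \<open>Integral kernels\<close>

definition kapp :: "'b measure \<Rightarrow> ('a \<times> 'b \<Rightarrow> complex) \<Rightarrow> ('b \<Rightarrow> complex) \<Rightarrow> 'a \<Rightarrow> complex"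
  where "kapp M k f = (\<lambda>x. LINT y|M. k (x, y) * f y)"

definition kcomp :: "'b measure \<Rightarrow> ('a \<times> 'b \<Rightarrow> complex) \<Rightarrow> ('b \<times> 'c \<Rightarrow> complex) \<Rightarrow> 'a \<times> 'c \<Rightarrow> complex"
  where "kcomp M k h = (\<lambda>(x, y). LINT \<xi>|M. k (x, \<xi>) * h (\<xi>, y))"

text \<open>With the transpose, adjoints are again of the form \<open>kapp\<close>, and derivatives
  in the second variable reduce to derivatives in the first.\<close>

definition ktr :: "('a \<times> 'b \<Rightarrow> 'c) \<Rightarrow> 'b \<times> 'a \<Rightarrow> 'c"
  where "ktr k = (\<lambda>(y, x). k (x, y))"

lemma kcomp_eq_kapp: "kcomp M k h (x, y) = kapp M k (\<lambda>\<xi>. h (\<xi>, y)) x"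
  by (simp add: kcomp_def kapp_def)

lemma kcomp_eq_kapp_ktr: "kcomp M k h (x, y) = kapp M (ktr h) (\<lambda>\<xi>. k (x, \<xi>)) y"
  by (simp add: kcomp_def kapp_def ktr_def mult.commute)

lemma kcomp_ktr: "kcomp M (ktr h) (ktr k) = ktr (kcomp M k h)"
  by (simp add: kcomp_def ktr_def fun_eq_iff mult.commute)

lemma ktr_ktr [simp]: "ktr (ktr k) = k"
  by (simp add: ktr_def fun_eq_iff)

text \<open>Holds without integrability, because the Bochner integral of a non-integrable function
  is 0.\<close>

lemma norm_integral_le_nn:
  fixes f :: "'a \<Rightarrow> 'b::{banach, second_countable_topology}"
  shows "ennreal (norm (LINT x|M. f x)) \<le> (\<integral>\<^sup>+x. ennreal (norm (f x)) \<partial>M)"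
  by (cases "integrable M f") (auto intro: integral_norm_bound_ennreal simp: not_integrable_integral_eq)

section \<open>Hilbert-Schmidt operators given by a kernel in two variables\<close>

context pair_sigma_finite
begin

abbreviation (input) M12 where "M12 \<equiv> M1 \<Otimes>\<^sub>M M2"

abbreviation (input) M21 where "M21 \<equiv> M2 \<Otimes>\<^sub>M M1"

lemma sqint_section_fst:
  assumes "sqint M12 k"
  shows "AE x in M1. sqint M2 (\<lambda>y. k (x, y))"
proof -
  have [measurable]: "k \<in> borel_measurable M12" using assms by (simp add: sqint_def)
  have "AE x in M1. integrable M2 (\<lambda>y. (cmod (k (x, y)))\<^sup>2)"
    using assms by (intro AE_integrable_fst') (simp add: sqint_def)
  with AE_space show ?thesis by eventually_elim (simp add: sqint_def)
qed

lemma sqint_section_snd: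
  assumes "sqint M12 k"
  shows "AE y in M2. sqint M1 (\<lambda>x. k (x, y))"
proof -
  have [measurable]: "k \<in> borel_measurable M12" using assms by (simp add: sqint_def)
  have "AE y in M2. integrable M1 (\<lambda>x. (cmod (k (x, y)))\<^sup>2)"
    using assms by (intro AE_integrable_snd) (simp add: sqint_def case_prod_unfold)
  with AE_space show ?thesis by eventually_elim (simp add: sqint_def)
qed

lemma sqint_ktr:
  assumes "sqint M12 k"
  shows "sqint M21 (ktr k)"
proof -
  have [measurable]: "k \<in> borel_measurable M12" using assms by (simp add: sqint_def)
  have "integrable M21 (\<lambda>(x, y). (cmod (k (y, x)))\<^sup>2)"
    using assms by (intro integrable_product_swap) (simp add: sqint_def)
  then show ?thesis by (simp add: sqint_def ktr_def case_prod_unfold)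
qed

lemma sqint_tensor:
  assumes f: "sqint M1 f" and g: "sqint M2 g"
  shows "sqint M12 (\<lambda>(x, y). f x * g y)"
proof (rule sqintI_nn(1)[where c = "l2norm M1 f * l2norm M2 g"])
  have [measurable]: "f \<in> borel_measurable M1" "g \<in> borel_measurable M2"
    using f g by (auto simp: sqint_def)
  show "(\<lambda>(x, y). f x * g y) \<in> borel_measurable M12" by measurable
  have "(\<integral>\<^sup>+z. ennreal ((cmod (case z of (x, y) \<Rightarrow> f x * g y))\<^sup>2) \<partial>M12)
      = (\<integral>\<^sup>+x. \<integral>\<^sup>+y. ennreal ((cmod (f x))\<^sup>2) * ennreal ((cmod (g y))\<^sup>2) \<partial>M2 \<partial>M1)"
    by (subst M2.nn_integral_fst[symmetric]) (auto simp: norm_mult power_mult_distrib ennreal_mult)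
  also have "\<dots> = ennreal ((l2norm M1 f)\<^sup>2) * ennreal ((l2norm M2 g)\<^sup>2)"
    by (simp add: nn_integral_cmult nn_integral_multc nn_eq_l2norm[OF f] nn_eq_l2norm[OF g])
  finally show "(\<integral>\<^sup>+z. ennreal ((cmod (case z of (x, y) \<Rightarrow> f x * g y))\<^sup>2) \<partial>M12)
      \<le> ennreal ((l2norm M1 f * l2norm M2 g)\<^sup>2)"
    by (simp add: power_mult_distrib ennreal_mult)
qed simp

lemma kapp_measurable:
  assumes [measurable]: "k \<in> borel_measurable M12" "f \<in> borel_measurable M2"
  shows "kapp M2 k f \<in> borel_measurable M1"
  unfolding kapp_def by measurable

text \<open>The Hilbert-Schmidt bound: Cauchy-Schwarz in y for almost every x, namely where the
  section of k is square-integrable, and then Tonelli in x.\<close>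

lemma
  assumes k: "sqint M12 k" and f: "sqint M2 f"
  shows sqint_kapp: "sqint M1 (kapp M2 k f)"
    and l2norm_kapp: "l2norm M1 (kapp M2 k f) \<le> l2norm M12 k * l2norm M2 f"
proof -
  have [measurable]: "k \<in> borel_measurable M12" "f \<in> borel_measurable M2"
    using k f by (auto simp: sqint_def)
  have "AE x in M1. ennreal ((cmod (kapp M2 k f x))\<^sup>2)
     \<le> (\<integral>\<^sup>+y. ennreal ((cmod (k (x, y)))\<^sup>2) \<partial>M2) * ennreal ((l2norm M2 f)\<^sup>2)"
    using sqint_section_fst[OF k]
  proof eventually_elim
    case (elim x)
    have "(cmod (kapp M2 k f x))\<^sup>2 \<le> (l2norm M2 (\<lambda>y. k (x, y)) * l2norm M2 f)\<^sup>2"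
      unfolding kapp_def by (intro power_mono norm_integral_mult_le elim f) simp
    then show ?case
      unfolding nn_eq_l2norm[OF elim] by (simp add: ennreal_leI power_mult_distrib flip: ennreal_mult)
  qed
  then have "nn2 M1 (kapp M2 k f)
     \<le> (\<integral>\<^sup>+x. (\<integral>\<^sup>+y. ennreal ((cmod (k (x, y)))\<^sup>2) \<partial>M2) * ennreal ((l2norm M2 f)\<^sup>2) \<partial>M1)"
    by (rule nn_integral_mono_AE)
  also have "\<dots> = (\<integral>\<^sup>+x. (\<integral>\<^sup>+y. ennreal ((cmod (k (x, y)))\<^sup>2) \<partial>M2) \<partial>M1) * ennreal ((l2norm M2 f)\<^sup>2)"
    by (rule nn_integral_multc) measurable
  also have "(\<integral>\<^sup>+x. (\<integral>\<^sup>+y. ennreal ((cmod (k (x, y)))\<^sup>2) \<partial>M2) \<partial>M1) = ennreal ((l2norm M12 k)\<^sup>2)"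
    using M2.nn_integral_fst[of "\<lambda>z. ennreal ((cmod (k z))\<^sup>2)" M1] nn_eq_l2norm[OF k] by simp
  finally have "nn2 M1 (kapp M2 k f)
     \<le> ennreal ((l2norm M12 k * l2norm M2 f)\<^sup>2)"
    by (simp add: power_mult_distrib flip: ennreal_mult)
  from sqintI_nn[OF kapp_measurable this] show "sqint M1 (kapp M2 k f)"
    "l2norm M1 (kapp M2 k f) \<le> l2norm M12 k * l2norm M2 f" by auto
qed

text \<open>Fubini for k(x,y) g(x) f(y), which is integrable as a product of two square-integrable
  functions on the product space.\<close>

lemma kapp_adjoint:
  assumes k: "sqint M12 k" and f: "sqint M2 f" and g: "sqint M1 g"
  shows "(LINT x|M1. kapp M2 k f x * g x) = (LINT y|M2. f y * kapp M1 (ktr k) g y)"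
proof -
  have [measurable]: "k \<in> borel_measurable M12" "f \<in> borel_measurable M2" "g \<in> borel_measurable M1"
    using k f g by (auto simp: sqint_def)
  have int: "integrable M12 (\<lambda>z. k z * (case z of (x, y) \<Rightarrow> g x * f y))"
    by (intro sqint_mult_integrable k sqint_tensor f g)
  have "(LINT x|M1. kapp M2 k f x * g x) = (LINT x|M1. LINT y|M2. k (x, y) * (g x * f y))"
    unfolding kapp_def by (simp add: mult_ac flip: integral_mult_right_zero integral_mult_left_zero)
  also have "\<dots> = (LINT y|M2. LINT x|M1. k (x, y) * (g x * f y))"
    using int by (intro Fubini_integral[symmetric]) (simp add: case_prod_unfold)
  also have "\<dots> = (LINT y|M2. f y * kapp M1 (ktr k) g y)"
    unfolding kapp_def ktr_def by (simp add: mult_ac flip: integral_mult_right_zero integral_mult_left_zero)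
  finally show ?thesis .
qed

text \<open>Links testing on the product space with testing in one variable; through it a weak
  derivative on X \<times> Y is read off variable by variable.\<close>

lemma integral_tensor_eq_kapp:
  assumes k: "sqint M12 k" and f: "sqint M2 f" and g: "sqint M1 g"
  shows "(LINT z|M12. k z * (case z of (x, y) \<Rightarrow> g x * f y)) = (LINT x|M1. kapp M2 k f x * g x)"
proof -
  have int: "integrable M12 (\<lambda>z. k z * (case z of (x, y) \<Rightarrow> g x * f y))"
    by (intro sqint_mult_integrable k sqint_tensor f g)
  show ?thesis
    unfolding integral_fst'[OF int, symmetric] kapp_def
    by (simp add: mult_ac flip: integral_mult_right_zero integral_mult_left_zero)
qed

text \<open>Splitting the integrals needs square-integrable sections of both kernels, hence the
  exceptional null set.\<close>

lemma kapp_diff: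
  assumes "sqint M12 k" "sqint M12 k'" "sqint M2 f" "sqint M2 f'"
  shows "AE x in M1. kapp M2 k f x - kapp M2 k' f' x = kapp M2 (\<lambda>z. k z - k' z) f x + kapp M2 k' (\<lambda>y. f y - f' y) x"
  using sqint_section_fst[OF assms(1)] sqint_section_fst[OF assms(2)]
  by eventually_elim (simp add: kapp_def left_diff_distrib right_diff_distrib sqint_mult_integrable assms(3,4))

lemma kapp_diff_norm_le:
  assumes k: "sqint M12 k" "sqint M12 k'" and f: "sqint M2 f" "sqint M2 f'"
  shows "l2norm M1 (\<lambda>x. kapp M2 k f x - kapp M2 k' f' x)
    \<le> l2norm M12 (\<lambda>z. k z - k' z) * l2norm M2 f + l2norm M12 k' * l2norm M2 (\<lambda>y. f y - f' y)"
proof -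
  have "l2norm M1 (\<lambda>x. kapp M2 k f x - kapp M2 k' f' x)
      = l2norm M1 (\<lambda>x. kapp M2 (\<lambda>z. k z - k' z) f x + kapp M2 k' (\<lambda>y. f y - f' y) x)"
    by (rule l2norm_cong_AE[OF kapp_diff]; intro sqint_measurable sqint_add sqint_diff sqint_kapp k f)
  also have "\<dots> \<le> l2norm M1 (kapp M2 (\<lambda>z. k z - k' z) f) + l2norm M1 (kapp M2 k' (\<lambda>y. f y - f' y))"
    by (intro l2norm_triangle sqint_diff sqint_kapp k f)
  finally show ?thesis
    using l2norm_kapp[OF sqint_diff[OF k] f(1)] l2norm_kapp[OF k(2) sqint_diff[OF f]] by simp
qed

lemma kapp_cong_AE:
  assumes "AE z in M12. k z = k' z" and [measurable]: "k \<in> borel_measurable M12"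
    "k' \<in> borel_measurable M12" "f \<in> borel_measurable M2"
  shows "AE x in M1. kapp M2 k f x = kapp M2 k' f x"
  using AE_pair[OF assms(1)] AE_space
proof eventually_elim
  case (elim x)
  have "AE y in M2. k (x, y) * f y = k' (x, y) * f y" using elim(1) by eventually_elim simp
  then show ?case unfolding kapp_def using elim(2) by (intro integral_cong_AE) auto
qed

end

text \<open>The three measures are kept distinct so that the locale can also be interpreted with the
  first two exchanged, as the adjoint formula for compositions requires.\<close>

locale triple_sigma_finite = M1?: sigma_finite_measure M1 + M2?: sigma_finite_measure M2 + M3?: sigma_finite_measure M3
  for M1 :: "'a measure" and M2 :: "'b measure" and M3 :: "'c measure"
begin

abbreviation (input) M12 where "M12 \<equiv> M1 \<Otimes>\<^sub>M M2"

abbreviation (input) M13 where "M13 \<equiv> M1 \<Otimes>\<^sub>M M3"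

abbreviation (input) M23 where "M23 \<equiv> M2 \<Otimes>\<^sub>M M3"

sublocale P12: pair_sigma_finite M1 M2 ..
sublocale P23: pair_sigma_finite M2 M3 ..
sublocale P13: pair_sigma_finite M1 M3 ..

lemma kcomp_measurable:
  assumes [measurable]: "k \<in> borel_measurable M12" "h \<in> borel_measurable M23"
  shows "kcomp M2 k h \<in> borel_measurable M13"
  unfolding kcomp_def by measurable

text \<open>Cauchy-Schwarz in \<xi> bounds the square by a function of x times a function of y,
  whose integrals factor. Infinite values are allowed, so the estimate can be used to prove
  finiteness.\<close>

lemma nn_kcomp_le:
  fixes a :: "'a \<times> 'b \<Rightarrow> ennreal" and b :: "'b \<times> 'c \<Rightarrow> ennreal"
  assumes [measurable]: "a \<in> borel_measurable M12" "b \<in> borel_measurable M23"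
  shows "(\<integral>\<^sup>+z. (\<integral>\<^sup>+\<xi>. a (fst z, \<xi>) * b (\<xi>, snd z) \<partial>M2)\<^sup>2 \<partial>M13)
    \<le> (\<integral>\<^sup>+z. (a z)\<^sup>2 \<partial>M12) * (\<integral>\<^sup>+z. (b z)\<^sup>2 \<partial>M23)"
proof -
  have "(\<integral>\<^sup>+z. (\<integral>\<^sup>+\<xi>. a (fst z, \<xi>) * b (\<xi>, snd z) \<partial>M2)\<^sup>2 \<partial>M13)
      = (\<integral>\<^sup>+x. \<integral>\<^sup>+y. (\<integral>\<^sup>+\<xi>. a (x, \<xi>) * b (\<xi>, y) \<partial>M2)\<^sup>2 \<partial>M3 \<partial>M1)"
    by (subst M3.nn_integral_fst[symmetric]) auto
  also have "\<dots> \<le> (\<integral>\<^sup>+x. \<integral>\<^sup>+y. (\<integral>\<^sup>+\<xi>. (a (x, \<xi>))\<^sup>2 \<partial>M2) * (\<integral>\<^sup>+\<xi>. (b (\<xi>, y))\<^sup>2 \<partial>M2) \<partial>M3 \<partial>M1)"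
    by (intro nn_integral_mono nn_integral_Cauchy_Schwarz) auto
  also have "\<dots> = (\<integral>\<^sup>+x. \<integral>\<^sup>+\<xi>. (a (x, \<xi>))\<^sup>2 \<partial>M2 \<partial>M1) * (\<integral>\<^sup>+y. \<integral>\<^sup>+\<xi>. (b (\<xi>, y))\<^sup>2 \<partial>M2 \<partial>M3)"
    by (simp add: nn_integral_cmult nn_integral_multc)
  also have "\<dots> = (\<integral>\<^sup>+z. (a z)\<^sup>2 \<partial>M12) * (\<integral>\<^sup>+z. (b z)\<^sup>2 \<partial>M23)"
    by (subst M2.nn_integral_fst, simp, subst P23.nn_integral_snd) auto
  finally show ?thesis .
qed

lemma
  assumes k: "sqint M12 k" and h: "sqint M23 h"
  shows sqint_kcomp: "sqint M13 (kcomp M2 k h)"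
    and l2norm_kcomp: "l2norm M13 (kcomp M2 k h) \<le> l2norm M12 k * l2norm M23 h"
proof -
  have [measurable]: "k \<in> borel_measurable M12" "h \<in> borel_measurable M23"
    using k h by (auto simp: sqint_def)
  let ?A = "\<lambda>z. \<integral>\<^sup>+\<xi>. ennreal (cmod (k (fst z, \<xi>))) * ennreal (cmod (h (\<xi>, snd z))) \<partial>M2"
  have "ennreal ((cmod (kcomp M2 k h z))\<^sup>2)
     \<le> (?A z)\<^sup>2" for z
  proof -
    have "ennreal (cmod (kcomp M2 k h z)) \<le> ?A z"
      using norm_integral_le_nn[of M2 "\<lambda>\<xi>. k (fst z, \<xi>) * h (\<xi>, snd z)"]
      by (simp add: kcomp_def case_prod_unfold norm_mult ennreal_mult)
    then have "(ennreal (cmod (kcomp M2 k h z)))\<^sup>2 \<le> (?A z)\<^sup>2"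
      by (rule power_mono) simp
    then show ?thesis by (simp add: ennreal_power)
  qed
  then have "nn2 M13 (kcomp M2 k h)
     \<le> (\<integral>\<^sup>+z. (?A z)\<^sup>2 \<partial>M13)"
    by (rule nn_integral_mono)
  also have "\<dots> \<le> (\<integral>\<^sup>+z. (ennreal (cmod (k z)))\<^sup>2 \<partial>M12) * (\<integral>\<^sup>+z. (ennreal (cmod (h z)))\<^sup>2 \<partial>M23)"
    by (rule nn_kcomp_le) auto
  also have "\<dots> = ennreal ((l2norm M12 k * l2norm M23 h)\<^sup>2)"
    using nn_eq_l2norm[OF k] nn_eq_l2norm[OF h] by (simp add: ennreal_power power_mult_distrib ennreal_mult)
  finally have "nn2 M13 (kcomp M2 k h)
     \<le> ennreal ((l2norm M12 k * l2norm M23 h)\<^sup>2)" .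
  from sqintI_nn[OF kcomp_measurable this] show "sqint M13 (kcomp M2 k h)"
    "l2norm M13 (kcomp M2 k h) \<le> l2norm M12 k * l2norm M23 h" by auto
qed

text \<open>For almost every fixed last variable this is \<open>kapp_adjoint\<close> for the
  sections of h and t. It moves k onto the test function, where a derivative can be shifted from one
  to the other.\<close>

lemma kcomp_adjoint:
  assumes k: "sqint M12 k" and h: "sqint M23 h" and t: "sqint M13 t"
  shows "(LINT z|M13. kcomp M2 k h z * t z) = (LINT z|M23. h z * kcomp M1 (ktr k) t z)"
proof -
  interpret Q: triple_sigma_finite M2 M1 M3 ..
  have [measurable]: "k \<in> borel_measurable M12" "h \<in> borel_measurable M23" "t \<in> borel_measurable M13"
    using k h t by (auto simp: sqint_def)
  have k': "sqint (M2 \<Otimes>\<^sub>M M1) (ktr k)" by (rule P12.sqint_ktr[OF k])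
  note [measurable] = kcomp_measurable[of k h] Q.kcomp_measurable[of "ktr k" t] sqint_measurable[OF k']
  have i1: "integrable M13 (\<lambda>z. kcomp M2 k h z * t z)"
    by (intro sqint_mult_integrable sqint_kcomp k h t)
  have i2: "integrable M23 (\<lambda>z. h z * kcomp M1 (ktr k) t z)"
    by (intro sqint_mult_integrable Q.sqint_kcomp k' h t)
  have "(LINT z|M13. kcomp M2 k h z * t z) = (LINT y|M3. LINT x|M1. kcomp M2 k h (x, y) * t (x, y))"
    by (subst P13.integral_snd) (use i1 in \<open>auto simp: case_prod_unfold\<close>)
  also have "\<dots> = (LINT y|M3. LINT \<xi>|M2. h (\<xi>, y) * kcomp M1 (ktr k) t (\<xi>, y))"
  proof (rule integral_cong_AE)
    show "AE y in M3. (LINT x|M1. kcomp M2 k h (x, y) * t (x, y)) = (LINT \<xi>|M2. h (\<xi>, y) * kcomp M1 (ktr k) t (\<xi>, y))"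
      using P23.sqint_section_snd[OF h] P13.sqint_section_snd[OF t]
      by eventually_elim (simp add: kcomp_eq_kapp P12.kapp_adjoint[OF k])
  qed measurable
  also have "\<dots> = (LINT z|M23. h z * kcomp M1 (ktr k) t z)"
    by (subst P23.integral_snd) (use i2 in \<open>auto simp: case_prod_unfold\<close>)
  finally show ?thesis .
qed

text \<open>This is \<open>kapp_adjoint\<close> with the section k(x, .) in the role of the test
  function, for those x whose section is square-integrable.\<close>

lemma kapp_kapp:
  assumes k: "sqint M12 k" and h: "sqint M23 h" and f: "sqint M3 f"
  shows "AE x in M1. kapp M2 k (kapp M3 h f) x = kapp M3 (kcomp M2 k h) f x"
  using P12.sqint_section_fst[OF k]
proof eventually_elim
  case (elim x)
  have "kapp M2 k (kapp M3 h f) x = (LINT \<xi>|M2. kapp M3 h f \<xi> * k (x, \<xi>))"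
    by (simp add: kapp_def[of M2 k] mult.commute)
  also have "\<dots> = (LINT y|M3. f y * kapp M2 (ktr h) (\<lambda>\<xi>. k (x, \<xi>)) y)"
    by (rule P23.kapp_adjoint[OF h f elim])
  also have "\<dots> = kapp M3 (kcomp M2 k h) f x"
    by (simp add: kapp_def[of M3] kcomp_eq_kapp_ktr mult.commute)
  finally show ?case .
qed

lemma kcomp_diff:
  assumes k: "sqint M12 k" "sqint M12 k'" and h: "sqint M23 h" "sqint M23 h'"
  shows "AE z in M13. kcomp M2 k h z - kcomp M2 k' h' z
    = kcomp M2 (\<lambda>z. k z - k' z) h z + kcomp M2 k' (\<lambda>z. h z - h' z) z"
proof (rule P13.AE_pair_measure)
  have [measurable]: "kcomp M2 k h \<in> borel_measurable M13" "kcomp M2 k' h' \<in> borel_measurable M13"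
    "kcomp M2 (\<lambda>z. k z - k' z) h \<in> borel_measurable M13" "kcomp M2 k' (\<lambda>z. h z - h' z) \<in> borel_measurable M13"
    by (intro kcomp_measurable sqint_measurable sqint_diff k h)+
  show "{z \<in> space M13. kcomp M2 k h z - kcomp M2 k' h' z
      = kcomp M2 (\<lambda>z. k z - k' z) h z + kcomp M2 k' (\<lambda>z. h z - h' z) z} \<in> sets M13"
    by measurable
  show "AE x in M1. AE y in M3. kcomp M2 k h (x, y) - kcomp M2 k' h' (x, y)
      = kcomp M2 (\<lambda>z. k z - k' z) h (x, y) + kcomp M2 k' (\<lambda>z. h z - h' z) (x, y)"
    using P12.sqint_section_fst[OF k(1)] P12.sqint_section_fst[OF k(2)]
  proof eventually_elim
    case (elim x)
    show ?case
      using P23.sqint_section_snd[OF h(1)] P23.sqint_section_snd[OF h(2)]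
      by eventually_elim (simp add: kcomp_def left_diff_distrib right_diff_distrib sqint_mult_integrable elim)
  qed
qed

text \<open>One telescoping step: the first factors are exchanged while h is kept, then the second
  ones while k' is kept.\<close>

lemma kcomp_diff_norm_le:
  assumes k: "sqint M12 k" "sqint M12 k'" and h: "sqint M23 h" "sqint M23 h'"
  shows "l2norm M13 (\<lambda>z. kcomp M2 k h z - kcomp M2 k' h' z)
    \<le> l2norm M12 (\<lambda>z. k z - k' z) * l2norm M23 h
      + l2norm M12 k' * l2norm M23 (\<lambda>z. h z - h' z)"
proof -
  have "l2norm M13 (\<lambda>z. kcomp M2 k h z - kcomp M2 k' h' z)
      = l2norm M13 (\<lambda>z. kcomp M2 (\<lambda>z. k z - k' z) h z + kcomp M2 k' (\<lambda>z. h z - h' z) z)"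
    by (rule l2norm_cong_AE[OF kcomp_diff]; intro sqint_measurable sqint_add sqint_diff sqint_kcomp k h)
  also have "\<dots> \<le> l2norm M13 (kcomp M2 (\<lambda>z. k z - k' z) h) + l2norm M13 (kcomp M2 k' (\<lambda>z. h z - h' z))"
    by (intro l2norm_triangle sqint_diff sqint_kcomp k h)
  finally show ?thesis
    using l2norm_kcomp[OF sqint_diff[OF k] h(1)] l2norm_kcomp[OF k(2) sqint_diff[OF h]] by simp
qed

end

subsection \<open>Test functions\<close>

definition smooth_fn :: "('a::euclidean_space \<Rightarrow> complex) \<Rightarrow> bool"
  where "smooth_fn \<phi> \<longleftrightarrow> (\<forall>bs. set bs \<subseteq> Basis \<longrightarrow> iter_partial bs \<phi> differentiable_on UNIV)"

lemma iter_partial_Nil [simp]: "iter_partial [] \<phi> = \<phi>"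
  and iter_partial_Cons [simp]: "iter_partial (b # bs) \<phi> = partial_deriv b (iter_partial bs \<phi>)"
  and iter_partial_snoc: "iter_partial (bs @ [b]) \<phi> = iter_partial bs (partial_deriv b \<phi>)"
  by (simp_all add: iter_partial_def)

text \<open>Spares every formula for iterated derivatives: for tensors, sections, transposes and
  bump functions it suffices to exhibit a class closed under one more derivative.\<close>

lemma smooth_fn_coinduct:
  assumes "f \<in> C" and diff: "\<And>g. g \<in> C \<Longrightarrow> g differentiable_on UNIV"
    and deriv: "\<And>g b. g \<in> C \<Longrightarrow> b \<in> Basis \<Longrightarrow> partial_deriv b g \<in> C"
  shows "smooth_fn f"
proof -
  have "iter_partial bs f \<in> C" if "set bs \<subseteq> Basis" for bs
    using that by (induction bs) (auto intro: deriv assms(1))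
  then show ?thesis unfolding smooth_fn_def using diff by blast
qed

lemma smooth_fn_partial_deriv:
  assumes "smooth_fn \<phi>" "b \<in> Basis"
  shows "smooth_fn (partial_deriv b \<phi>)"
  unfolding smooth_fn_def
proof (intro allI impI)
  fix bs :: "'a list" assume "set bs \<subseteq> Basis"
  \<comment> \<open>\<open>foldr\<close> applies the last list entry first, so differentiating the
    argument once more appends b at the end.\<close>
  then have "iter_partial (bs @ [b]) \<phi> differentiable_on UNIV"
    using assms unfolding smooth_fn_def by (metis Un_insert_right empty_set insert_subset list.simps(15) set_append sup_bot_right)
  then show "iter_partial bs (partial_deriv b \<phi>) differentiable_on UNIV" by (simp add: iter_partial_snoc)
qed

lemma smooth_fn_has_derivative:
  assumes "smooth_fn \<phi>"
  shows "(\<phi> has_derivative frechet_derivative \<phi> (at x)) (at x)"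
proof -
  have "iter_partial [] \<phi> differentiable_on UNIV" using assms unfolding smooth_fn_def by (metis empty_set empty_subsetI)
  then have "\<phi> differentiable (at x)" by (simp add: differentiable_on_def)
  then show ?thesis by (simp add: frechet_derivative_works)
qed

lemma smooth_fn_continuous:
  assumes "smooth_fn \<phi>" shows "continuous_on UNIV \<phi>"
  using smooth_fn_has_derivative[OF assms]
  by (auto simp: continuous_on_eq_continuous_at intro: has_derivative_continuous)

lemma partial_deriv_eqI:
  assumes "\<And>x. (f has_derivative f' x) (at x)"
  shows "partial_deriv b f = (\<lambda>x. f' x b)"
  unfolding partial_deriv_def using frechet_derivative_at[OF assms] by metis

text \<open>An arbitrary compact set outside which \<phi> vanishes is easier to transport through
  products, slices and swaps than the closure of the support.\<close>

lemma test_functions_iff: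
  "\<phi> \<in> test_functions \<Omega> \<longleftrightarrow> smooth_fn \<phi> \<and> (\<exists>K. compact K \<and> K \<subseteq> \<Omega> \<and> (\<forall>x. x \<notin> K \<longrightarrow> \<phi> x = 0))"
proof -
  have "compact (closure {x. \<phi> x \<noteq> 0}) \<and> closure {x. \<phi> x \<noteq> 0} \<subseteq> \<Omega> \<longleftrightarrow>
     (\<exists>K. compact K \<and> K \<subseteq> \<Omega> \<and> (\<forall>x. x \<notin> K \<longrightarrow> \<phi> x = 0))" (is "?L \<longleftrightarrow> ?R")
  proof
    assume ?L
    moreover have "\<phi> x = 0" if "x \<notin> closure {x. \<phi> x \<noteq> 0}" for x
      using that closure_subset[of "{x. \<phi> x \<noteq> 0}"] by auto
    ultimately show ?R by blast
  next
    assume ?R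
    then obtain K where K: "compact K" "K \<subseteq> \<Omega>" "\<forall>x. x \<notin> K \<longrightarrow> \<phi> x = 0" by blast
    then have "closure {x. \<phi> x \<noteq> 0} \<subseteq> K"
      by (intro closure_minimal) (auto intro: compact_imp_closed)
    moreover from this have "compact (closure {x. \<phi> x \<noteq> 0})"
      using compact_Int_closed[OF K(1), of "closure {x. \<phi> x \<noteq> 0}"] by (simp add: Int_absorb1)
    ultimately show ?L using K(2) by blast
  qed
  then show ?thesis unfolding test_functions_def smooth_fn_def by simp
qed

lemma test_functions_partial_deriv:
  assumes "\<phi> \<in> test_functions \<Omega>" "b \<in> Basis"
  shows "partial_deriv b \<phi> \<in> test_functions \<Omega>"
proof -
  obtain K where K: "compact K" "K \<subseteq> \<Omega>" "\<forall>x. x \<notin> K \<longrightarrow> \<phi> x = 0" and sm: "smooth_fn \<phi>"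
    using assms unfolding test_functions_iff by blast
  have "partial_deriv b \<phi> x = 0" if "x \<notin> K" for x
  proof -
    have "((\<lambda>_. 0) has_derivative (\<lambda>_. 0)) (at x)" by (rule has_derivative_const)
    then have "(\<phi> has_derivative (\<lambda>_. 0)) (at x)"
      by (rule has_derivative_transform_within_open[of _ _ _ _ "- K"])
         (use K that in \<open>auto intro: compact_imp_closed\<close>)
    from frechet_derivative_at[OF this] show ?thesis
      unfolding partial_deriv_def by (simp add: fun_eq_iff)
  qed
  then show ?thesis
    unfolding test_functions_iff using K smooth_fn_partial_deriv[OF sm assms(2)] by blast
qed

lemma measurable_lborel_on:
  assumes "f \<in> borel_measurable borel"
  shows "f \<in> borel_measurable (lborel_on X)"
  by (rule measurable_restrict_space1) (use assms in simp)

lemma sqint_compact_support: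
  assumes "X \<in> sets lborel" "f \<in> borel_measurable borel" "compact K" "\<And>x. x \<notin> K \<Longrightarrow> f x = 0" "\<And>x. cmod (f x) \<le> B"
  shows "sqint (lborel_on X) f"
proof -
  have "integrable lborel (\<lambda>x. indicator X x *\<^sub>R (cmod (f x))\<^sup>2)"
  proof (rule Bochner_Integration.integrable_bound)
    show "integrable lborel (\<lambda>x. B\<^sup>2 * indicator K x :: real)"
      using assms(3) emeasure_compact_finite[OF assms(3)]
      by (intro integrable_mult_right integrable_real_indicator) (auto intro: borel_compact)
    show "(\<lambda>x. indicator X x *\<^sub>R (cmod (f x))\<^sup>2) \<in> borel_measurable lborel"
      using assms(1,2) by measurable
    have "(cmod (f x))\<^sup>2 \<le> B\<^sup>2" for x using assms(5) by (intro power_mono) auto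
    then show "AE x in lborel. norm (indicator X x *\<^sub>R (cmod (f x))\<^sup>2) \<le> norm (B\<^sup>2 * indicator K x :: real)"
      using assms(4) by (intro AE_I2) (auto simp: indicator_def)
  qed
  then have "integrable (lborel_on X) (\<lambda>x. (cmod (f x))\<^sup>2)"
    using assms(1) by (subst integrable_restrict_space) auto
  then show ?thesis by (simp add: sqint_def measurable_lborel_on assms(2))
qed

lemma sqint_test_function:
  assumes "X \<in> sets lborel" "\<phi> \<in> test_functions \<Omega>"
  shows "sqint (lborel_on X) \<phi>"
proof -
  obtain K where K: "compact K" "K \<subseteq> \<Omega>" "\<forall>x. x \<notin> K \<longrightarrow> \<phi> x = 0" and sm: "smooth_fn \<phi>"
    using assms unfolding test_functions_iff by blast
  note cont = smooth_fn_continuous[OF sm]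
  have "compact (\<phi> ` K)" using K(1) cont by (intro compact_continuous_image) (auto intro: continuous_on_subset)
  then obtain B where B: "\<And>x. x \<in> K \<Longrightarrow> cmod (\<phi> x) \<le> B"
    by (meson bounded_iff compact_imp_bounded imageI)
  have "cmod (\<phi> x) \<le> max 0 B" for x
    by (cases "x \<in> K") (use B K(3) in \<open>auto simp: max.coboundedI2\<close>)
  then show ?thesis
    using cont K by (intro sqint_compact_support[OF assms(1) _ K(1)]) (auto intro: borel_measurable_continuous_onI)
qed

section \<open>Tensor products, sections and transposes of test functions\<close>

lemma tensor_has_derivative:
  assumes "(\<phi> has_derivative \<phi>') (at (fst z))" "(\<psi> has_derivative \<psi>') (at (snd z))"
  shows "((\<lambda>(x, y). \<phi> x * \<psi> y :: complex) has_derivative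
      (\<lambda>h. \<phi> (fst z) * \<psi>' (snd h) + \<phi>' (fst h) * \<psi> (snd z))) (at z)"
proof -
  have "((\<lambda>z. \<phi> (fst z)) has_derivative (\<lambda>h. \<phi>' (fst h))) (at z)"
    using has_derivative_compose[OF has_derivative_fst[OF has_derivative_ident] assms(1)] .
  moreover have "((\<lambda>z. \<psi> (snd z)) has_derivative (\<lambda>h. \<psi>' (snd h))) (at z)"
    using has_derivative_compose[OF has_derivative_snd[OF has_derivative_ident] assms(2)] .
  ultimately show ?thesis
    unfolding case_prod_unfold by (rule has_derivative_mult)
qed

lemma
  assumes "smooth_fn \<phi>" "smooth_fn \<psi>"
  shows partial_deriv_tensor_fst:
      "partial_deriv (e, 0) (\<lambda>(x, y). \<phi> x * \<psi> y) = (\<lambda>(x, y). partial_deriv e \<phi> x * \<psi> y)"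
    and partial_deriv_tensor_snd:
      "partial_deriv (0, e') (\<lambda>(x, y). \<phi> x * \<psi> y) = (\<lambda>(x, y). \<phi> x * partial_deriv e' \<psi> y)"
    and tensor_differentiable: "(\<lambda>(x, y). \<phi> x * \<psi> y) differentiable_on UNIV"
proof -
  note d1 = smooth_fn_has_derivative[OF assms(1)] and d2 = smooth_fn_has_derivative[OF assms(2)]
  note d = tensor_has_derivative[OF d1 d2]
  have [simp]: "frechet_derivative \<phi> (at x) 0 = 0" "frechet_derivative \<psi> (at y) 0 = 0" for x y
    using has_derivative_linear[OF d1] has_derivative_linear[OF d2] by (auto simp: linear_0)
  show "partial_deriv (e, 0) (\<lambda>(x, y). \<phi> x * \<psi> y) = (\<lambda>(x, y). partial_deriv e \<phi> x * \<psi> y)"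
    "partial_deriv (0, e') (\<lambda>(x, y). \<phi> x * \<psi> y) = (\<lambda>(x, y). \<phi> x * partial_deriv e' \<psi> y)"
    unfolding partial_deriv_eqI[OF d] by (auto simp: fun_eq_iff partial_deriv_def)
  show "(\<lambda>(x, y). \<phi> x * \<psi> y) differentiable_on UNIV"
    using d by (auto simp: differentiable_on_def differentiable_def)
qed

text \<open>A basis vector of the product space points into one factor, so each derivative hits one
  factor and the result is again a product.\<close>

lemma smooth_fn_tensor:
  fixes \<phi> :: "'a::euclidean_space \<Rightarrow> complex" and \<psi> :: "'b::euclidean_space \<Rightarrow> complex"
  assumes "smooth_fn \<phi>" "smooth_fn \<psi>"
  shows "smooth_fn (\<lambda>(x, y). \<phi> x * \<psi> y)"
proof (rule smooth_fn_coinduct)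
  let ?C = "{(\<lambda>(x, y). \<phi> x * \<psi> y) | (\<phi> :: 'a \<Rightarrow> complex) (\<psi> :: 'b \<Rightarrow> complex). smooth_fn \<phi> \<and> smooth_fn \<psi>}"
  show "(\<lambda>(x, y). \<phi> x * \<psi> y) \<in> ?C" using assms by blast
  fix g assume "g \<in> ?C"
  then obtain \<phi>1 \<psi>1 where g: "g = (\<lambda>(x, y). \<phi>1 x * \<psi>1 y)" "smooth_fn \<phi>1" "smooth_fn \<psi>1" by blast
  show "g differentiable_on UNIV" unfolding g(1) by (rule tensor_differentiable[OF g(2,3)])
  fix b :: "'a \<times> 'b" assume "b \<in> Basis"
  then consider e where "b = (e, 0)" "e \<in> Basis" | e where "b = (0, e)" "e \<in> Basis"
    by (auto simp: Basis_prod_def)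
  then show "partial_deriv b g \<in> ?C"
  proof cases
    case 1
    then show ?thesis using partial_deriv_tensor_fst[OF g(2,3), of e] smooth_fn_partial_deriv[OF g(2)] g by auto
  next
    case 2
    then show ?thesis using partial_deriv_tensor_snd[OF g(2,3), of e] smooth_fn_partial_deriv[OF g(3)] g by auto
  qed
qed

lemma test_functions_tensor:
  assumes "\<phi> \<in> test_functions X" "\<psi> \<in> test_functions Y"
  shows "(\<lambda>(x, y). \<phi> x * \<psi> y) \<in> test_functions (X \<times> Y)"
proof -
  obtain K where K: "compact K" "K \<subseteq> X" "\<forall>x. x \<notin> K \<longrightarrow> \<phi> x = 0" and s1: "smooth_fn \<phi>"
    using assms unfolding test_functions_iff by blast
  obtain L where L: "compact L" "L \<subseteq> Y" "\<forall>x. x \<notin> L \<longrightarrow> \<psi> x = 0" and s2: "smooth_fn \<psi>"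
    using assms unfolding test_functions_iff by blast
  show ?thesis
    unfolding test_functions_iff
    using smooth_fn_tensor[OF s1 s2] K L by (intro conjI exI[of _ "K \<times> L"]) (auto intro: compact_Times)
qed

lemma
  assumes "smooth_fn \<theta>"
  shows partial_deriv_section: "partial_deriv e (\<lambda>x. \<theta> (x, y)) = (\<lambda>x. partial_deriv (e, 0) \<theta> (x, y))"
    and section_differentiable: "(\<lambda>x. \<theta> (x, y)) differentiable_on UNIV"
proof -
  have d: "((\<lambda>x. \<theta> (x, y)) has_derivative (\<lambda>h. frechet_derivative \<theta> (at (x, y)) (h, 0))) (at x)" for x
    using has_derivative_compose[OF has_derivative_Pair[OF has_derivative_ident has_derivative_const]
        smooth_fn_has_derivative[OF assms]] .
  show "partial_deriv e (\<lambda>x. \<theta> (x, y)) = (\<lambda>x. partial_deriv (e, 0) \<theta> (x, y))"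
    unfolding partial_deriv_eqI[OF d] by (simp add: partial_deriv_def)
  show "(\<lambda>x. \<theta> (x, y)) differentiable_on UNIV"
    using d by (auto simp: differentiable_on_def differentiable_def)
qed

lemma smooth_fn_section:
  fixes \<theta> :: "'a::euclidean_space \<times> 'b::euclidean_space \<Rightarrow> complex"
  assumes "smooth_fn \<theta>"
  shows "smooth_fn (\<lambda>x. \<theta> (x, y))"
proof (rule smooth_fn_coinduct)
  let ?C = "{(\<lambda>x. \<theta> (x, y)) | \<theta> :: 'a \<times> 'b \<Rightarrow> complex. smooth_fn \<theta>}"
  show "(\<lambda>x. \<theta> (x, y)) \<in> ?C" using assms by blast
  fix g assume "g \<in> ?C"
  then obtain \<theta>' where g: "g = (\<lambda>x. \<theta>' (x, y))" "smooth_fn \<theta>'" by blast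
  show "g differentiable_on UNIV" unfolding g(1) by (rule section_differentiable[OF g(2)])
  fix b :: 'a assume "b \<in> Basis"
  then have "smooth_fn (partial_deriv (b, 0) \<theta>')"
    by (intro smooth_fn_partial_deriv g) (simp add: Basis_prod_def)
  then show "partial_deriv b g \<in> ?C"
    unfolding g(1) partial_deriv_section[OF g(2)] by blast
qed

lemma test_functions_section:
  assumes "\<theta> \<in> test_functions (X \<times> Y)"
  shows "(\<lambda>x. \<theta> (x, y)) \<in> test_functions X"
proof -
  obtain K where K: "compact K" "K \<subseteq> X \<times> Y" "\<forall>x. x \<notin> K \<longrightarrow> \<theta> x = 0" and sm: "smooth_fn \<theta>"
    using assms unfolding test_functions_iff by blast
  \<comment> \<open>The slice itself is merely known to be closed as a preimage; the intersection
    with the compact projection makes it compact.\<close>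
  let ?K = "fst ` K \<inter> (\<lambda>x. (x, y)) -` K"
  have "compact ?K"
    using K(1) by (auto intro!: compact_Int_closed compact_continuous_image continuous_intros
        closed_vimage dest: compact_imp_closed)
  moreover have "?K \<subseteq> X" using K(2) by auto
  moreover have "\<forall>x. x \<notin> ?K \<longrightarrow> \<theta> (x, y) = 0" using K(3) by force
  ultimately show ?thesis
    unfolding test_functions_iff using smooth_fn_section[OF sm] by blast
qed

lemma
  assumes "smooth_fn \<theta>"
  shows partial_deriv_ktr: "partial_deriv (b, a) (ktr \<theta>) = ktr (partial_deriv (a, b) \<theta>)"
    and ktr_differentiable: "ktr \<theta> differentiable_on UNIV"
proof -
  have "((\<lambda>z. \<theta> (snd z, fst z)) has_derivative (\<lambda>h. frechet_derivative \<theta> (at (snd z, fst z)) (snd h, fst h))) (at z)" for z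
    using has_derivative_compose[OF has_derivative_Pair[OF has_derivative_snd[OF has_derivative_ident]
          has_derivative_fst[OF has_derivative_ident]] smooth_fn_has_derivative[OF assms]] .
  then have d: "(ktr \<theta> has_derivative (\<lambda>h. frechet_derivative \<theta> (at (snd z, fst z)) (snd h, fst h))) (at z)" for z
    by (simp add: ktr_def case_prod_unfold)
  show "partial_deriv (b, a) (ktr \<theta>) = ktr (partial_deriv (a, b) \<theta>)"
    unfolding partial_deriv_eqI[OF d] by (auto simp: partial_deriv_def ktr_def)
  show "ktr \<theta> differentiable_on UNIV"
    using d by (auto simp: differentiable_on_def differentiable_def)
qed

lemma smooth_fn_ktr:
  fixes \<theta> :: "'a::euclidean_space \<times> 'b::euclidean_space \<Rightarrow> complex"
  assumes "smooth_fn \<theta>"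
  shows "smooth_fn (ktr \<theta>)"
proof (rule smooth_fn_coinduct)
  let ?C = "{ktr \<theta> | \<theta> :: 'a \<times> 'b \<Rightarrow> complex. smooth_fn \<theta>}"
  show "ktr \<theta> \<in> ?C" using assms by blast
  fix g assume "g \<in> ?C"
  then obtain \<theta>' where g: "g = ktr \<theta>'" "smooth_fn \<theta>'" by blast
  show "g differentiable_on UNIV" unfolding g(1) by (rule ktr_differentiable[OF g(2)])
  fix c :: "'b \<times> 'a" assume "c \<in> Basis"
  moreover obtain b a where c: "c = (b, a)" by (cases c)
  ultimately have "smooth_fn (partial_deriv (a, b) \<theta>')"
    by (intro smooth_fn_partial_deriv g) (auto simp: Basis_prod_def)
  then show "partial_deriv c g \<in> ?C"
    unfolding g(1) c partial_deriv_ktr[OF g(2)] by blast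
qed

lemma test_functions_ktr:
  assumes "\<theta> \<in> test_functions (X \<times> Y)"
  shows "ktr \<theta> \<in> test_functions (Y \<times> X)"
proof -
  obtain K where K: "compact K" "K \<subseteq> X \<times> Y" "\<forall>x. x \<notin> K \<longrightarrow> \<theta> x = 0" and sm: "smooth_fn \<theta>"
    using assms unfolding test_functions_iff by blast
  let ?K = "(\<lambda>z. (snd z, fst z)) ` K"
  have "compact ?K" using K(1) by (intro compact_continuous_image continuous_intros)
  moreover have "?K \<subseteq> Y \<times> X" using K(2) by auto
  moreover have "\<forall>z. z \<notin> ?K \<longrightarrow> ktr \<theta> z = 0" using K(3) by (force simp: ktr_def)
  ultimately show ?thesis unfolding test_functions_iff using smooth_fn_ktr[OF sm] by blast
qed

subsection \<open>Smooth approximations of the indicator of a box\<close>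

text \<open>The functions p(1/t) e^(-1/t), extended by 0, are closed under differentiation: with s =
  1/t the derivative in t of p(s) e^(-s) is s^2 (p(s) - p'(s)) e^(-s), which is the polynomial
  \<open>[:0, 0, 1:] * (p - pderiv p)\<close> of the next lemmas.\<close>

definition flat_exp :: "real poly \<Rightarrow> real \<Rightarrow> real"
  where "flat_exp p t = (if t > 0 then poly p (1 / t) * exp (- (1 / t)) else 0)"

lemma poly_mult_exp_tendsto_0: "((\<lambda>s. poly p s * exp (- s)) \<longlongrightarrow> (0::real)) at_top"
proof -
  have "((\<lambda>s. \<Sum>i\<le>degree p. coeff p i * (s ^ i / exp s)) \<longlongrightarrow> (\<Sum>i\<le>degree p. coeff p i * 0)) at_top"
    by (intro tendsto_intros tendsto_power_div_exp_0)
  then show ?thesis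
    by (simp add: poly_altdef sum_distrib_right exp_minus divide_inverse mult.assoc)
qed

lemma DERIV_flat_exp: "(flat_exp p has_real_derivative flat_exp ([:0, 0, 1:] * (p - pderiv p)) t) (at t)"
proof -
  consider "t > 0" | "t < 0" | "t = 0" by linarith
  then show ?thesis
  proof cases
    case 1
    have "((\<lambda>t. poly p (1 / t) * exp (- (1 / t))) has_real_derivative
        flat_exp ([:0, 0, 1:] * (p - pderiv p)) t) (at t)"
      using 1 by (auto intro!: derivative_eq_intros DERIV_chain2[OF poly_DERIV]
          simp: flat_exp_def field_simps power2_eq_square)
    then show ?thesis
      by (rule has_field_derivative_transform_within_open[of _ _ _ "{0<..}"]) (use 1 in \<open>auto simp: flat_exp_def\<close>)
  next
    case 2
    have "((\<lambda>t. 0) has_real_derivative flat_exp ([:0, 0, 1:] * (p - pderiv p)) t) (at t)"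
      using 2 by (auto simp: flat_exp_def)
    then show ?thesis
      by (rule has_field_derivative_transform_within_open[of _ _ _ "{..<0}"]) (use 2 in \<open>auto simp: flat_exp_def\<close>)
  next
    case 3
    \<comment> \<open>The difference quotient at 0 is s p(s) e^(-s) with s = 1/h; the extra factor s
      is the \<open>pCons 0\<close>.\<close>
    have "((\<lambda>h. poly (pCons 0 p) (inverse h) * exp (- inverse h)) \<longlongrightarrow> 0) (at_right 0)"
      by (rule filterlim_compose[OF poly_mult_exp_tendsto_0 filterlim_inverse_at_top_right])
    moreover have "\<forall>\<^sub>F h in at_right 0. poly (pCons 0 p) (inverse h) * exp (- inverse h) = flat_exp p h / h"
      unfolding eventually_at_right_field by (auto intro!: exI[of _ 1] simp: flat_exp_def field_simps)
    ultimately have "((\<lambda>h. flat_exp p h / h) \<longlongrightarrow> 0) (at_right 0)"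
      by (rule Lim_transform_eventually)
    moreover have "((\<lambda>h. flat_exp p h / h) \<longlongrightarrow> 0) (at_left 0)"
      by (rule Lim_transform_eventually[OF tendsto_const])
         (auto simp: eventually_at_left_field flat_exp_def intro!: exI[of _ "-1"])
    ultimately have "((\<lambda>h. flat_exp p h / h) \<longlongrightarrow> 0) (at 0)"
      by (simp add: filterlim_split_at)
    then show ?thesis using 3 by (simp add: DERIV_def flat_exp_def)
  qed
qed

text \<open>An algebra closed under partial derivatives: in the base case the chain rule contributes
  just the constant factor b \<bullet> v, and sums and products follow the usual rules. Hence all
  its members are smooth.\<close>

inductive_set flat_alg :: "('a::euclidean_space \<Rightarrow> complex) set" where
  base: "(\<lambda>x. of_real (flat_exp p (c + x \<bullet> v))) \<in> flat_alg"
| const: "(\<lambda>x. c) \<in> flat_alg"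
| add: "f \<in> flat_alg \<Longrightarrow> g \<in> flat_alg \<Longrightarrow> (\<lambda>x. f x + g x) \<in> flat_alg"
| mult: "f \<in> flat_alg \<Longrightarrow> g \<in> flat_alg \<Longrightarrow> (\<lambda>x. f x * g x) \<in> flat_alg"

lemma flat_alg_derivative:
  assumes "f \<in> flat_alg"
  shows "\<exists>f'. (\<forall>x. (f has_derivative f' x) (at x)) \<and> (\<forall>b. (\<lambda>x. f' x b) \<in> flat_alg)"
  using assms
proof induction
  case (base p c v)
  let ?q = "[:0, 0, 1:] * (p - pderiv p)"
  have "((\<lambda>x. flat_exp p (c + x \<bullet> v)) has_derivative (\<lambda>h. flat_exp ?q (c + x \<bullet> v) * (h \<bullet> v))) (at x)" for x
  proof -
    have "((\<lambda>x. c + x \<bullet> v) has_derivative (\<lambda>h. h \<bullet> v)) (at x)"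
      by (auto intro!: derivative_eq_intros)
    from has_derivative_compose[OF this DERIV_flat_exp[unfolded has_field_derivative_def]]
    show ?thesis .
  qed
  then have "((\<lambda>x. complex_of_real (flat_exp p (c + x \<bullet> v))) has_derivative
      (\<lambda>h. of_real (flat_exp ?q (c + x \<bullet> v) * (h \<bullet> v)))) (at x)" for x
    by (rule has_derivative_of_real)
  moreover have "(\<lambda>x. complex_of_real (flat_exp ?q (c + x \<bullet> v) * (b \<bullet> v))) \<in> flat_alg" for b
    using flat_alg.mult[OF flat_alg.base[of ?q c v] flat_alg.const[of "of_real (b \<bullet> v)"]] by simp
  ultimately show ?case by (intro exI[of _ "\<lambda>x h. of_real (flat_exp ?q (c + x \<bullet> v) * (h \<bullet> v))"]) blast
next
  case (const c)
  show ?case by (rule exI[of _ "\<lambda>x h. 0"]) (auto intro: flat_alg.const)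
next
  case (add f g)
  then obtain f' g' where "\<And>x. (f has_derivative f' x) (at x)" "\<And>b. (\<lambda>x. f' x b) \<in> flat_alg"
    "\<And>x. (g has_derivative g' x) (at x)" "\<And>b. (\<lambda>x. g' x b) \<in> flat_alg" by blast
  then show ?case
    by (intro exI[of _ "\<lambda>x h. f' x h + g' x h"]) (auto intro: has_derivative_add flat_alg.add)
next
  case (mult f g)
  then obtain f' g' where "\<And>x. (f has_derivative f' x) (at x)" "\<And>b. (\<lambda>x. f' x b) \<in> flat_alg"
    "\<And>x. (g has_derivative g' x) (at x)" "\<And>b. (\<lambda>x. g' x b) \<in> flat_alg" by blast
  then show ?case
    using mult.hyps
    by (intro exI[of _ "\<lambda>x h. f x * g' x h + f' x h * g x"])
       (auto intro: has_derivative_mult intro!: flat_alg.add flat_alg.mult)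
qed

lemma flat_alg_smooth:
  assumes "f \<in> flat_alg"
  shows "smooth_fn f"
proof (rule smooth_fn_coinduct[OF assms])
  fix g :: "'a \<Rightarrow> complex" assume "g \<in> flat_alg"
  from flat_alg_derivative[OF this] obtain f' where f': "\<And>x. (g has_derivative f' x) (at x)" "\<And>b. (\<lambda>x. f' x b) \<in> flat_alg"
    by blast
  then show "g differentiable_on UNIV" by (auto simp: differentiable_on_def differentiable_def)
  show "partial_deriv b g \<in> flat_alg" for b unfolding partial_deriv_eqI[OF f'(1)] by (rule f'(2))
qed

lemma flat_alg_prod:
  assumes "finite I" "\<And>i. i \<in> I \<Longrightarrow> f i \<in> flat_alg"
  shows "(\<lambda>x. \<Prod>i\<in>I. f i x) \<in> flat_alg"
  using assms by (induction I) (auto intro: flat_alg.const flat_alg.mult)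

text \<open>A factor at distance s > 0 from its face is exp (-1 / ((n+1) s)) and tends to 1, while
  outside the open box some factor vanishes. So the limit is the indicator of the open box, with
  supports in the fixed closed box for every n.\<close>

definition box_bump :: "'a::euclidean_space \<Rightarrow> 'a \<Rightarrow> nat \<Rightarrow> 'a \<Rightarrow> real"
  where "box_bump a c n x = (\<Prod>b\<in>Basis. flat_exp 1 (real (Suc n) * (x \<bullet> b - a \<bullet> b)) * flat_exp 1 (real (Suc n) * (c \<bullet> b - x \<bullet> b)))"

lemma flat_exp_1_bounds: "0 \<le> flat_exp 1 t" "flat_exp 1 t \<le> 1" "flat_exp 1 t = 0 \<longleftrightarrow> t \<le> 0"
  by (auto simp: flat_exp_def)

lemma flat_exp_1_tendsto:
  assumes "s > 0"
  shows "(\<lambda>n. flat_exp 1 (real (Suc n) * s)) \<longlonglongrightarrow> 1"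
proof -
  have "(\<lambda>n. exp (- (1 / s * inverse (real (Suc n))))) \<longlonglongrightarrow> exp (- (1 / s * 0))"
    by (intro tendsto_intros LIMSEQ_inverse_real_of_nat)
  moreover have "exp (- (1 / s * inverse (real (Suc n)))) = flat_exp 1 (real (Suc n) * s)" for n
    using assms by (simp add: flat_exp_def divide_inverse mult.commute)
  ultimately show ?thesis by simp
qed

lemma box_bump_bounds: "0 \<le> box_bump a c n x" "box_bump a c n x \<le> 1"
  unfolding box_bump_def by (auto intro!: prod_nonneg prod_le_1 mult_nonneg_nonneg mult_le_one flat_exp_1_bounds)

lemma box_bump_eq_0: "x \<notin> box a c \<Longrightarrow> box_bump a c n x = 0"
proof -
  assume "x \<notin> box a c"
  then obtain b where b: "b \<in> Basis" "x \<bullet> b \<le> a \<bullet> b \<or> c \<bullet> b \<le> x \<bullet> b" by (force simp: mem_box)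
  then have "flat_exp 1 (real (Suc n) * (x \<bullet> b - a \<bullet> b)) * flat_exp 1 (real (Suc n) * (c \<bullet> b - x \<bullet> b)) = 0"
    unfolding mult_eq_0_iff flat_exp_1_bounds(3) by (auto intro: mult_nonneg_nonpos)
  then show ?thesis unfolding box_bump_def using b(1) by (intro prod_zero) auto
qed

lemma box_bump_tendsto: "(\<lambda>n. box_bump a c n x) \<longlonglongrightarrow> indicator (box a c) x"
proof (cases "x \<in> box a c")
  case True
  then have "(\<lambda>n. box_bump a c n x) \<longlonglongrightarrow> (\<Prod>b\<in>(Basis::'a set). 1 * 1)"
    unfolding box_bump_def by (intro tendsto_intros flat_exp_1_tendsto) (auto simp: mem_box)
  then show ?thesis using True by simp
qed (simp add: box_bump_eq_0)

lemma box_bump_test: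
  assumes "cbox a c \<subseteq> \<Omega>"
  shows "(\<lambda>x. of_real (box_bump a c n x)) \<in> test_functions \<Omega>"
proof -
  have "(\<lambda>x. complex_of_real (flat_exp 1 (real (Suc n) * (x \<bullet> b - a \<bullet> b)))) \<in> flat_alg" for b
    using flat_alg.base[of 1 "- (real (Suc n) * (a \<bullet> b))" "real (Suc n) *\<^sub>R b"] by (simp add: algebra_simps)
  moreover have "(\<lambda>x. complex_of_real (flat_exp 1 (real (Suc n) * (c \<bullet> b - x \<bullet> b)))) \<in> flat_alg" for b
    using flat_alg.base[of 1 "real (Suc n) * (c \<bullet> b)" "- real (Suc n) *\<^sub>R b"] by (simp add: algebra_simps)
  ultimately have "(\<lambda>x. \<Prod>b\<in>Basis. complex_of_real (flat_exp 1 (real (Suc n) * (x \<bullet> b - a \<bullet> b))) *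
      complex_of_real (flat_exp 1 (real (Suc n) * (c \<bullet> b - x \<bullet> b)))) \<in> flat_alg"
    by (intro flat_alg_prod flat_alg.mult) auto
  then have "smooth_fn (\<lambda>x. complex_of_real (box_bump a c n x))"
    unfolding box_bump_def by (intro flat_alg_smooth) simp
  moreover have "x \<notin> cbox a c \<Longrightarrow> box_bump a c n x = 0" for x
    using box_bump_eq_0 box_subset_cbox by blast
  ultimately show ?thesis
    unfolding test_functions_iff using assms compact_cbox by (intro conjI exI[of _ "cbox a c"]) auto
qed

subsection \<open>The fundamental lemma of the calculus of variations\<close>

text \<open>The bumps show that g has integral 0 over every open box whose closed box lies in
  \<Omega>. Open boxes are stable under intersection and generate the Borel sets, so inside one such
  box all Borel integrals vanish and g is 0 almost everywhere. Countably many closed boxes exhaust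
  \<Omega>.\<close>

theorem fundamental_lemma:
  fixes g :: "'a::euclidean_space \<Rightarrow> complex"
  assumes "open \<Omega>" and g: "sqint (lborel_on \<Omega>) g"
    and zero: "\<And>\<psi>. \<psi> \<in> test_functions \<Omega> \<Longrightarrow> (LINT x|lborel_on \<Omega>. g x * \<psi> x) = 0"
  shows "AE x in lborel_on \<Omega>. g x = 0"
proof -
  have O [measurable]: "\<Omega> \<in> sets lborel" and O': "\<Omega> \<inter> space lborel \<in> sets lborel" using assms(1) by auto
  have g_meas: "g \<in> borel_measurable (lborel_on \<Omega>)" by (rule sqint_measurable[OF g])
  have box_int: "integrable lborel (\<lambda>x. indicator (box a c) x *\<^sub>R g x)"
    and box_zero: "(LINT x|lborel. indicator (box a c) x *\<^sub>R g x) = 0" if sub: "cbox a c \<subseteq> \<Omega>" for a c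
  proof -
    let ?I = "\<lambda>x. complex_of_real (indicator (cbox a c) x)" and ?J = "\<lambda>x. complex_of_real (indicator (box a c) x)"
      and ?B = "\<lambda>n x. complex_of_real (box_bump a c n x)"
    have Jm: "(\<lambda>x. g x * ?J x) \<in> borel_measurable (lborel_on \<Omega>)"
      by (intro borel_measurable_times g_meas measurable_lborel_on) simp
    have sub': "box a c \<subseteq> \<Omega>" using sub box_subset_cbox by blast
    have "sqint (lborel_on \<Omega>) ?I"
      by (rule sqint_compact_support[OF O _ compact_cbox[of a c], of _ 1]) (auto simp: indicator_def)
    then have intI: "integrable (lborel_on \<Omega>) (\<lambda>x. g x * ?I x)" by (rule sqint_mult_integrable[OF g])
    have "(\<lambda>n. LINT x|lborel_on \<Omega>. g x * ?B n x) \<longlonglongrightarrow> (LINT x|lborel_on \<Omega>. g x * ?J x)"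
    \<comment> \<open>The majorant is |g| on the closed box, integrable because g is
      square-integrable and the box has finite measure.\<close>
    proof (rule integral_dominated_convergence[where w = "\<lambda>x. cmod (g x * ?I x)"])
      show "(\<lambda>x. g x * ?J x) \<in> borel_measurable (lborel_on \<Omega>)" by (rule Jm)
      show "(\<lambda>x. g x * ?B n x) \<in> borel_measurable (lborel_on \<Omega>)" for n
        by (intro borel_measurable_times g_meas sqint_measurable sqint_test_function[OF O box_bump_test[OF sub]])
      show "integrable (lborel_on \<Omega>) (\<lambda>x. cmod (g x * ?I x))" using intI by (rule integrable_norm)
      show "AE x in lborel_on \<Omega>. (\<lambda>n. g x * ?B n x) \<longlonglongrightarrow> g x * ?J x"
        by (intro AE_I2 tendsto_intros box_bump_tendsto)
      have "\<bar>box_bump a c n x\<bar> \<le> indicator (cbox a c) x" for n x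
        using box_bump_bounds[of a c n x] box_bump_eq_0[of x a c n] box_subset_cbox[of a c]
        by (cases "x \<in> cbox a c") auto
      then show "AE x in lborel_on \<Omega>. cmod (g x * ?B n x) \<le> cmod (g x * ?I x)" for n
        by (intro AE_I2) (auto simp: norm_mult intro!: mult_left_mono)
    qed
    then have z: "(LINT x|lborel_on \<Omega>. g x * ?J x) = 0"
      using zero[OF box_bump_test[OF sub]] by (simp add: LIMSEQ_const_iff)
    have eq: "indicator \<Omega> x *\<^sub>R (g x * ?J x) = indicator (box a c) x *\<^sub>R g x" for x
      using sub' by (auto simp: indicator_def)
    show "(LINT x|lborel. indicator (box a c) x *\<^sub>R g x) = 0"
      using z unfolding integral_restrict_space[OF O'] eq .
    have "integrable (lborel_on \<Omega>) (\<lambda>x. g x * ?J x)"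
    proof (rule Bochner_Integration.integrable_bound[OF intI])
      show "(\<lambda>x. g x * ?J x) \<in> borel_measurable (lborel_on \<Omega>)" by (rule Jm)
      show "AE x in lborel_on \<Omega>. cmod (g x * ?J x) \<le> cmod (g x * ?I x)"
        using box_subset_cbox[of a c] by (intro AE_I2) (auto simp: indicator_def)
    qed
    then show "integrable lborel (\<lambda>x. indicator (box a c) x *\<^sub>R g x)"
      unfolding integrable_restrict_space[OF O'] eq .
  qed
  have cbox_AE: "AE x in lborel. x \<in> cbox a c \<longrightarrow> g x = 0" if sub: "cbox a c \<subseteq> \<Omega>" for a c
  proof -
    \<comment> \<open>Cut off to the box, g is integrable, as \<open>density_zero\<close> demands;
      on \<Omega> it is assumed square-integrable.\<close>
    let ?G = "\<lambda>x. indicator (box a c) x *\<^sub>R g x"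
    note intG = box_int[OF sub]
    have int_set: "set_integrable lborel A ?G" if "A \<in> sets borel" for A
      unfolding set_integrable_def by (rule integrable_mult_indicator[OF _ intG]) (use that in simp)
    have "AE x in lborel. ?G x = 0"
    proof (rule sigma_finite_measure.density_zero[OF sigma_finite_lborel intG])
      fix A :: "'a set" assume "A \<in> sets lborel"
      then have A: "A \<in> sigma_sets UNIV (range (\<lambda>(a, b). box a b))"
        unfolding sets_lborel borel_eq_box by simp
      have sets_eq: "sigma_sets UNIV (range (\<lambda>(a, b). box a b :: 'a set)) = sets borel"
        unfolding borel_eq_box by simp
      have stable: "Int_stable (range (\<lambda>(a, b). box a b :: 'a set))"
        by (auto simp: Int_stable_def box_Int_box)
      have Pow: "range (\<lambda>(a, b). box a b :: 'a set) \<subseteq> Pow UNIV" by simp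
      show "(LINT x:A|lborel. ?G x) = 0"
        using stable Pow A
      proof (induction rule: sigma_sets_induct_disjoint)
        case (basic A)
        then obtain u v where uv: "A = box u v" by auto
        obtain p q where pq: "box u v \<inter> box a c = box p q" unfolding box_Int_box by blast
        have eq: "indicat_real A x *\<^sub>R ?G x = indicat_real (box p q) x *\<^sub>R g x" for x
          unfolding uv pq[symmetric] by (simp add: indicator_inter_arith)
        show ?case
        \<comment> \<open>When the open box is empty, \<open>cbox p q\<close> can be nonempty and
          leave \<Omega>, so \<open>box_zero\<close> is reserved for the other case.\<close>
        proof (cases "box p q = {}")
          case True
          then show ?thesis unfolding set_lebesgue_integral_def eq by simp
        next
          case False
          then have "cbox p q = closure (box p q)" by (simp add: closure_box)
          also have "\<dots> \<subseteq> cbox a c"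
            using pq box_subset_cbox[of a c] by (intro closure_minimal) auto
          finally have "cbox p q \<subseteq> \<Omega>" using sub by blast
          then show ?thesis unfolding set_lebesgue_integral_def eq by (rule box_zero)
        qed
      next
        case empty
        show ?case by (simp add: set_lebesgue_integral_def)
      next
        case (compl A)
        then have AB: "A \<in> sets borel" unfolding sets_eq by simp
        have eq: "indicat_real (UNIV - A) x *\<^sub>R ?G x = ?G x - indicat_real A x *\<^sub>R ?G x" for x
          by (auto simp: indicator_def)
        have "(LINT x:UNIV - A|lborel. ?G x) = (LINT x|lborel. ?G x) - (LINT x:A|lborel. ?G x)"
          unfolding set_lebesgue_integral_def eq
          by (rule Bochner_Integration.integral_diff[OF intG int_set[OF AB, unfolded set_integrable_def]])
        then show ?case using compl box_zero[OF sub] by simp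
      next
        case (union A)
        have AB: "A i \<in> sets borel" for i using union(2) unfolding sets_eq by auto
        have "(LINT x:(\<Union>i. A i)|lborel. ?G x) = (\<Sum>i. (LINT x:(A i)|lborel. ?G x))"
          using union(1) AB by (intro lebesgue_integral_countable_add int_set) (auto simp: disjoint_family_on_def)
        then show ?case using union(3) by simp
      qed
    qed
    \<comment> \<open>The boundary is a null set. The passage to closed boxes prepares the countable
      covering of \<Omega>.\<close>
    moreover have "AE x in lborel. x \<notin> cbox a c - box a c"
      by (rule AE_not_in) (simp add: emeasure_Diff emeasure_lborel_box_eq emeasure_lborel_cbox_eq null_setsI subset_box)
    ultimately show ?thesis by eventually_elim auto
  qed
  obtain \<D> where D: "countable \<D>" "\<D> \<subseteq> Pow \<Omega>" "\<And>X. X \<in> \<D> \<Longrightarrow> \<exists>a b. X = cbox a b" "\<Union>\<D> = \<Omega>"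
    using open_countable_Union_open_cbox[OF assms(1)] by blast
  have "AE x in lborel. \<forall>X\<in>\<D>. x \<in> X \<longrightarrow> g x = 0"
    unfolding AE_ball_countable[OF D(1)] using D(2,3) cbox_AE by blast
  then show ?thesis
    unfolding AE_restrict_space_iff[OF O'] by eventually_elim (use D(4) in blast)
qed

subsection \<open>First-order weak derivatives\<close>

lemma L2_space_iff: "f \<in> L2_space \<Omega> \<longleftrightarrow> sqint (lborel_on \<Omega>) f"
  by (simp add: L2_space_def sqint_def)

lemma L2_norm_on_eq: "L2_norm_on \<Omega> f = l2norm (lborel_on \<Omega>) f"
  by (simp add: L2_norm_on_def l2norm_def)

lemma sigma_finite_lborel_on: "open X \<Longrightarrow> sigma_finite_measure (lborel_on X)"
  by (intro sigma_finite_measure_restrict_space sigma_finite_lborel) simp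

lemma pair_lborel_on: "open X \<Longrightarrow> open Y \<Longrightarrow> pair_sigma_finite (lborel_on X) (lborel_on Y)"
  by (simp add: pair_sigma_finite_def sigma_finite_lborel_on)

lemma triple_lborel_on:
  "open X \<Longrightarrow> open Y \<Longrightarrow> open Z \<Longrightarrow> triple_sigma_finite (lborel_on X) (lborel_on Y) (lborel_on Z)"
  by (simp add: triple_sigma_finite_def sigma_finite_lborel_on)

text \<open>Joins the two halves of the proof: Sobolev spaces live on restricted Lebesgue measure,
  the kernel estimates on product measures.\<close>

lemma lborel_on_Times:
  fixes X :: "'a::euclidean_space set" and Y :: "'b::euclidean_space set"
  assumes "open X" "open Y"
  shows "lborel_on (X \<times> Y) = lborel_on X \<Otimes>\<^sub>M lborel_on Y"
proof (rule pair_measure_eqI[symmetric])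
  show "sigma_finite_measure (lborel_on X)" "sigma_finite_measure (lborel_on Y)"
    using assms by (auto intro: sigma_finite_lborel_on)
  have XY: "X \<times> Y \<in> sets borel" using assms by (intro borel_open open_Times)
  have bp: "(borel :: ('a \<times> 'b) measure) = borel \<Otimes>\<^sub>M borel" by (simp add: borel_prod)
  have sub1: "A \<times> B \<in> sets (lborel_on (X \<times> Y))" if "A \<in> sets (lborel_on X)" "B \<in> sets (lborel_on Y)" for A B
  proof -
    have "A \<in> sets borel" "A \<subseteq> X" "B \<in> sets borel" "B \<subseteq> Y"
      using that assms by (auto simp: sets_restrict_space_iff)
    then have "A \<times> B \<in> sets borel" "A \<times> B \<subseteq> X \<times> Y" unfolding bp by auto
    then show ?thesis using XY by (simp add: sets_restrict_space_iff)
  qed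
  show "sets (lborel_on X \<Otimes>\<^sub>M lborel_on Y) = sets (lborel_on (X \<times> Y))"
  proof (intro subset_antisym subsetI)
    fix C assume "C \<in> sets (lborel_on X \<Otimes>\<^sub>M lborel_on Y)"
    then have "C \<in> sigma_sets (space (lborel_on X) \<times> space (lborel_on Y))
        {a \<times> b |a b. a \<in> sets (lborel_on X) \<and> b \<in> sets (lborel_on Y)}" by (simp add: sets_pair_measure)
    moreover have "space (lborel_on X) \<times> space (lborel_on Y) = space (lborel_on (X \<times> Y))"
      by (simp add: space_restrict_space)
    ultimately have "C \<in> sigma_sets (space (lborel_on (X \<times> Y)))
        {a \<times> b |a b. a \<in> sets (lborel_on X) \<and> b \<in> sets (lborel_on Y)}" by simp
    then show "C \<in> sets (lborel_on (X \<times> Y))"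
      by (rule rev_subsetD[OF _ sets.sigma_sets_subset]) (auto intro: sub1)
  next
    fix C assume C: "C \<in> sets (lborel_on (X \<times> Y))"
    have CB: "C \<in> sets (borel \<Otimes>\<^sub>M borel)"
      unfolding bp[symmetric] using C XY by (simp add: sets_restrict_space_iff)
    have CX: "C \<subseteq> X \<times> Y" using C XY by (simp add: sets_restrict_space_iff)
    \<comment> \<open>The identity, written by components, is measurable into the unrestricted
      product, and the preimage of C under it is C.\<close>
    have "(\<lambda>z. (fst z, snd z)) \<in> (lborel_on X \<Otimes>\<^sub>M lborel_on Y) \<rightarrow>\<^sub>M borel \<Otimes>\<^sub>M borel"
      by (intro measurable_Pair measurable_compose[OF measurable_fst] measurable_compose[OF measurable_snd]
          measurable_restrict_space1) simp_all
    from measurable_sets[OF this CB]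
    have "(\<lambda>z. (fst z, snd z)) -` C \<inter> space (lborel_on X \<Otimes>\<^sub>M lborel_on Y) \<in> sets (lborel_on X \<Otimes>\<^sub>M lborel_on Y)" .
    also have "(\<lambda>z. (fst z, snd z)) -` C \<inter> space (lborel_on X \<Otimes>\<^sub>M lborel_on Y) = C"
      using CX by (auto simp: space_pair_measure space_restrict_space)
    finally show "C \<in> sets (lborel_on X \<Otimes>\<^sub>M lborel_on Y)" .
  qed
  fix A B assume AB: "A \<in> sets (lborel_on X)" "B \<in> sets (lborel_on Y)"
  then have *: "A \<in> sets borel" "A \<subseteq> X" "B \<in> sets borel" "B \<subseteq> Y"
    using assms by (auto simp: sets_restrict_space_iff)
  have "emeasure lborel (A \<times> B) = emeasure lborel A * emeasure lborel B"
    unfolding lborel_prod[symmetric] using * by (intro lborel.emeasure_pair_measure_Times) auto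
  then show "emeasure (lborel_on X) A * emeasure (lborel_on Y) B = emeasure (lborel_on (X \<times> Y)) (A \<times> B)"
    using * assms XY by (subst (1 2 3) emeasure_restrict_space) auto
qed

section \<open>Weak derivatives along one basis vector\<close>

abbreviation (input) lint :: "'a::euclidean_space set \<Rightarrow> ('a \<Rightarrow> complex) \<Rightarrow> ('a \<Rightarrow> complex) \<Rightarrow> complex"
  where "lint \<Omega> f g \<equiv> LINT x|lborel_on \<Omega>. f x * g x"

definition wderiv :: "'a::euclidean_space set \<Rightarrow> 'a \<Rightarrow> ('a \<Rightarrow> complex) \<Rightarrow> ('a \<Rightarrow> complex) \<Rightarrow> bool"
  where "wderiv \<Omega> b f g \<longleftrightarrow> (\<forall>\<phi>\<in>test_functions \<Omega>.
     lint \<Omega> f (partial_deriv b \<phi>) = - lint \<Omega> g \<phi>)"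

lemma wderiv_zero: "wderiv \<Omega> b (\<lambda>x. 0) (\<lambda>x. 0)"
  by (simp add: wderiv_def)

lemma wderiv_cmult: "wderiv \<Omega> b f g \<Longrightarrow> wderiv \<Omega> b (\<lambda>x. c * f x) (\<lambda>x. c * g x)"
  by (simp add: wderiv_def mult.assoc)

lemma wderiv_add:
  assumes "open \<Omega>" "b \<in> Basis" "sqint (lborel_on \<Omega>) f" "sqint (lborel_on \<Omega>) g"
    "sqint (lborel_on \<Omega>) f'" "sqint (lborel_on \<Omega>) g'" "wderiv \<Omega> b f g" "wderiv \<Omega> b f' g'"
  shows "wderiv \<Omega> b (\<lambda>x. f x + f' x) (\<lambda>x. g x + g' x)"
  unfolding wderiv_def
proof
  fix \<phi> assume \<phi>: "\<phi> \<in> test_functions \<Omega>"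
  have O: "\<Omega> \<in> sets lborel" using assms(1) by simp
  note t = sqint_test_function[OF O \<phi>] sqint_test_function[OF O test_functions_partial_deriv[OF \<phi> assms(2)]]
  show "(LINT x|lborel_on \<Omega>. (f x + f' x) * partial_deriv b \<phi> x) = - (LINT x|lborel_on \<Omega>. (g x + g' x) * \<phi> x)"
    using assms \<phi> t unfolding wderiv_def by (simp add: distrib_right sqint_mult_integrable)
qed

lemma wderiv_sum:
  assumes "open \<Omega>" "b \<in> Basis" "\<And>i. i \<in> I \<Longrightarrow> sqint (lborel_on \<Omega>) (f i)" "\<And>i. i \<in> I \<Longrightarrow> sqint (lborel_on \<Omega>) (g i)"
    "\<And>i. i \<in> I \<Longrightarrow> wderiv \<Omega> b (f i) (g i)"
  shows "wderiv \<Omega> b (\<lambda>x. \<Sum>i\<in>I. f i x) (\<lambda>x. \<Sum>i\<in>I. g i x)"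
  using assms
proof (induction I rule: infinite_finite_induct)
  case (insert i I)
  then show ?case by (simp, intro wderiv_add) (auto intro!: sqint_sum)
qed (auto simp: wderiv_zero)

text \<open>Closedness of the weak derivative: both sides of the defining identity are continuous in
  the L2 norm.\<close>

lemma wderiv_limit:
  assumes "open \<Omega>" "b \<in> Basis" "\<And>n. sqint (lborel_on \<Omega>) (f n)" "\<And>n. sqint (lborel_on \<Omega>) (g n)"
    "sqint (lborel_on \<Omega>) s" "sqint (lborel_on \<Omega>) t" "\<And>n. wderiv \<Omega> b (f n) (g n)"
    "(\<lambda>n. l2norm (lborel_on \<Omega>) (\<lambda>x. f n x - s x)) \<longlonglongrightarrow> 0"
    "(\<lambda>n. l2norm (lborel_on \<Omega>) (\<lambda>x. g n x - t x)) \<longlonglongrightarrow> 0"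
  shows "wderiv \<Omega> b s t"
  unfolding wderiv_def
proof
  fix \<phi> assume \<phi>: "\<phi> \<in> test_functions \<Omega>"
  have O: "\<Omega> \<in> sets lborel" using assms(1) by simp
  note q = sqint_test_function[OF O \<phi>] sqint_test_function[OF O test_functions_partial_deriv[OF \<phi> assms(2)]]
  have "(\<lambda>n. LINT x|lborel_on \<Omega>. f n x * partial_deriv b \<phi> x) \<longlonglongrightarrow> lint \<Omega> s (partial_deriv b \<phi>)"
    by (intro l2_limit_integral_mult assms q)
  moreover have "(\<lambda>n. - lint \<Omega> (g n) \<phi>) \<longlonglongrightarrow> - lint \<Omega> t \<phi>"
    by (intro tendsto_minus l2_limit_integral_mult assms q)
  moreover have "lint \<Omega> (f n) (partial_deriv b \<phi>) = - lint \<Omega> (g n) \<phi>" for n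
    using assms(7) \<phi> by (simp add: wderiv_def)
  ultimately show "lint \<Omega> s (partial_deriv b \<phi>) = - lint \<Omega> t \<phi>"
    by (simp add: LIMSEQ_unique)
qed

text \<open>For fixed \<phi> the hypothesis is tested with \<phi>(x) \<psi>(y). After Fubini it says
  that the sum \<open>?G\<close> of both sides is orthogonal to every \<psi>, and the fundamental
  lemma in y makes it vanish. The exceptional null set depends on \<phi>.\<close>

lemma wderiv_slice:
  assumes o: "open X" "open Y" and e: "e \<in> Basis"
    and k: "sqint (lborel_on (X \<times> Y)) k" and g: "sqint (lborel_on (X \<times> Y)) g"
    and wd: "wderiv (X \<times> Y) (e, 0) k g" and \<phi>: "\<phi> \<in> test_functions X"
  shows "AE y in lborel_on Y. kapp (lborel_on X) (ktr k) (partial_deriv e \<phi>) y = - kapp (lborel_on X) (ktr g) \<phi> y"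
proof -
  let ?X = "lborel_on X" and ?Y = "lborel_on Y"
  let ?P = "kapp ?X (ktr k) (partial_deriv e \<phi>)" and ?Q = "kapp ?X (ktr g) \<phi>"
  interpret P: pair_sigma_finite ?X ?Y using o by (rule pair_lborel_on)
  interpret Q: pair_sigma_finite ?Y ?X using o(2,1) by (rule pair_lborel_on)
  have X: "X \<in> sets lborel" and Y: "Y \<in> sets lborel" using o by auto
  note k' = k[unfolded lborel_on_Times[OF o]] and g' = g[unfolded lborel_on_Times[OF o]]
  have d\<phi>: "partial_deriv e \<phi> \<in> test_functions X" by (rule test_functions_partial_deriv[OF \<phi> e])
  note s\<phi> = sqint_test_function[OF X \<phi>] and sd\<phi> = sqint_test_function[OF X d\<phi>]
  let ?G = "\<lambda>y. ?P y + ?Q y"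
  have s1: "sqint ?Y (?P)"
    and s2: "sqint ?Y (?Q)"
    by (intro Q.sqint_kapp P.sqint_ktr k' g' s\<phi> sd\<phi>)+
  have "AE y in ?Y. ?G y = 0"
  proof (rule fundamental_lemma[OF o(2) sqint_add[OF s1 s2]])
    fix \<psi> assume \<psi>: "\<psi> \<in> test_functions Y"
    note s\<psi> = sqint_test_function[OF Y \<psi>]
    have sm: "smooth_fn \<phi>" "smooth_fn \<psi>" using \<phi> \<psi> by (auto simp: test_functions_iff)
    have "(LINT y|?Y. ?G y * \<psi> y) =
       (LINT y|?Y. \<psi> y * ?P y)
       + (LINT y|?Y. \<psi> y * ?Q y)"
      using sqint_mult_integrable[OF s1 s\<psi>] sqint_mult_integrable[OF s2 s\<psi>]
      by (simp add: distrib_right mult.commute[of "\<psi> _"])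
    also have "\<dots> = (LINT x|?X. kapp ?Y k \<psi> x * partial_deriv e \<phi> x)
       + (LINT x|?X. kapp ?Y g \<psi> x * \<phi> x)"
      using P.kapp_adjoint[OF k' s\<psi> sd\<phi>] P.kapp_adjoint[OF g' s\<psi> s\<phi>] by simp
    also have "\<dots> = (LINT z|lborel_on (X \<times> Y). k z * (case z of (x, y) \<Rightarrow> partial_deriv e \<phi> x * \<psi> y))
       + (LINT z|lborel_on (X \<times> Y). g z * (case z of (x, y) \<Rightarrow> \<phi> x * \<psi> y))"
      unfolding lborel_on_Times[OF o]
      using P.integral_tensor_eq_kapp[OF k' s\<psi> sd\<phi>] P.integral_tensor_eq_kapp[OF g' s\<psi> s\<phi>] by simp
    also have "\<dots> = 0"
      using wd test_functions_tensor[OF \<phi> \<psi>] unfolding wderiv_def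
      by (auto simp flip: partial_deriv_tensor_fst[OF sm])
    finally show "(LINT y|?Y. ?G y * \<psi> y) = 0" .
  qed
  then show ?thesis by eventually_elim (simp add: add_eq_0_iff2)
qed

text \<open>The operator is moved onto \<phi> by the adjoint, the derivative is shifted there by
  \<open>wderiv_slice\<close>, and the adjoint leads back.\<close>

lemma wderiv_kapp:
  assumes o: "open X" "open Y" and e: "e \<in> Basis"
    and k: "sqint (lborel_on (X \<times> Y)) k" and g: "sqint (lborel_on (X \<times> Y)) g"
    and wd: "wderiv (X \<times> Y) (e, 0) k g" and f: "sqint (lborel_on Y) f"
  shows "wderiv X e (kapp (lborel_on Y) k f) (kapp (lborel_on Y) g f)"
  unfolding wderiv_def
proof
  fix \<phi> assume \<phi>: "\<phi> \<in> test_functions X"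
  let ?X = "lborel_on X" and ?Y = "lborel_on Y"
  interpret P: pair_sigma_finite ?X ?Y using o by (rule pair_lborel_on)
  interpret Q: pair_sigma_finite ?Y ?X using o(2,1) by (rule pair_lborel_on)
  have X: "X \<in> sets lborel" using o by auto
  note k' = k[unfolded lborel_on_Times[OF o]] and g' = g[unfolded lborel_on_Times[OF o]]
  note s\<phi> = sqint_test_function[OF X \<phi>] and sd\<phi> = sqint_test_function[OF X test_functions_partial_deriv[OF \<phi> e]]
  note m = sqint_measurable[OF Q.sqint_kapp[OF P.sqint_ktr[OF k'] sd\<phi>]] sqint_measurable[OF Q.sqint_kapp[OF P.sqint_ktr[OF g'] s\<phi>]]
    sqint_measurable[OF f]
  let ?l = "LINT x|?X. kapp ?Y k f x * partial_deriv e \<phi> x" and ?r = "LINT x|?X. kapp ?Y g f x * \<phi> x"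
  have "?l = (LINT y|?Y. f y * kapp ?X (ktr k) (partial_deriv e \<phi>) y)"
    by (rule P.kapp_adjoint[OF k' f sd\<phi>])
  also have "\<dots> = (LINT y|?Y. - (f y * kapp ?X (ktr g) \<phi> y))"
  proof (rule integral_cong_AE)
    show "AE y in ?Y. f y * kapp ?X (ktr k) (partial_deriv e \<phi>) y = - (f y * kapp ?X (ktr g) \<phi> y)"
      using wderiv_slice[OF o e k g wd \<phi>] by eventually_elim simp
  qed (use m in auto)
  also have "\<dots> = - ?r"
    using P.kapp_adjoint[OF g' f s\<phi>] by simp
  finally show "?l = - ?r" .
qed

text \<open>The same scheme as for \<open>wderiv_kapp\<close>, but \<theta> is a general test
  function in two variables. With the last variable frozen it becomes a test function in x, to which
  \<open>wderiv_slice\<close> applies.\<close>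

lemma wderiv_kcomp_left:
  assumes o: "open X" "open Y" "open Z" and e: "e \<in> Basis"
    and k: "sqint (lborel_on (X \<times> Y)) k" and g: "sqint (lborel_on (X \<times> Y)) g"
    and wd: "wderiv (X \<times> Y) (e, 0) k g" and h: "sqint (lborel_on (Y \<times> Z)) h"
  shows "wderiv (X \<times> Z) (e, 0) (kcomp (lborel_on Y) k h) (kcomp (lborel_on Y) g h)"
  unfolding wderiv_def
proof
  fix \<theta> assume \<theta>: "\<theta> \<in> test_functions (X \<times> Z)"
  let ?X = "lborel_on X" and ?Y = "lborel_on Y" and ?Z = "lborel_on Z"
  let ?P = "kcomp ?X (ktr k) (partial_deriv (e, 0) \<theta>)" and ?Q = "kcomp ?X (ktr g) \<theta>"
  let ?l = "LINT w|lborel_on (X \<times> Z). kcomp ?Y k h w * partial_deriv (e, 0) \<theta> w"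
    and ?r = "LINT w|lborel_on (X \<times> Z). kcomp ?Y g h w * \<theta> w"
  interpret T: triple_sigma_finite ?X ?Y ?Z using o by (rule triple_lborel_on)
  interpret S: triple_sigma_finite ?Y ?X ?Z using o(2,1,3) by (rule triple_lborel_on)
  have XZ: "X \<times> Z \<in> sets lborel" using o by (simp add: open_Times)
  have eb: "(e, 0) \<in> Basis" using e by (simp add: Basis_prod_def)
  have sm: "smooth_fn \<theta>" using \<theta> by (simp add: test_functions_iff)
  note d = test_functions_partial_deriv[OF \<theta> eb]
  note k' = k[unfolded lborel_on_Times[OF o(1,2)]] and g' = g[unfolded lborel_on_Times[OF o(1,2)]]
    and h' = h[unfolded lborel_on_Times[OF o(2,3)]]
    and s\<theta> = sqint_test_function[OF XZ \<theta>, unfolded lborel_on_Times[OF o(1,3)]]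
    and sd\<theta> = sqint_test_function[OF XZ d, unfolded lborel_on_Times[OF o(1,3)]]
  have [measurable]: "?P \<in> borel_measurable (?Y \<Otimes>\<^sub>M ?Z)"
    "?Q \<in> borel_measurable (?Y \<Otimes>\<^sub>M ?Z)" "h \<in> borel_measurable (?Y \<Otimes>\<^sub>M ?Z)"
    by (intro sqint_measurable S.sqint_kcomp T.P12.sqint_ktr k' g' h' s\<theta> sd\<theta>)+
  \<comment> \<open>Valid for every z, with a null set of y that varies with z. Measurability of
    both sides turns these into one null set in the product.\<close>
  have "AE z in ?Z. AE y in ?Y. ?P (y, z) = - ?Q (y, z)"
  proof (rule AE_I2)
    fix z
    show "AE y in ?Y. ?P (y, z) = - ?Q (y, z)"
      using wderiv_slice[OF o(1,2) e k g wd test_functions_section[OF \<theta>, of z]]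
      unfolding partial_deriv_section[OF sm] kcomp_eq_kapp .
  qed
  then have "AE y in ?Y. AE z in ?Z. ?P (y, z) = - ?Q (y, z)"
    by (subst T.P23.AE_commute) auto
  then have AE: "AE w in ?Y \<Otimes>\<^sub>M ?Z. ?P w = - ?Q w"
    by (intro T.P23.AE_pair_measure) auto
  have "?l = (LINT w|(?Y \<Otimes>\<^sub>M ?Z). h w * ?P w)"
    unfolding lborel_on_Times[OF o(1,3)] by (rule T.kcomp_adjoint[OF k' h' sd\<theta>])
  also have "\<dots> = (LINT w|(?Y \<Otimes>\<^sub>M ?Z). - (h w * ?Q w))"
  proof (rule integral_cong_AE)
    show "AE w in ?Y \<Otimes>\<^sub>M ?Z. h w * ?P w = - (h w * ?Q w)"
      using AE by eventually_elim simp
  qed measurable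
  also have "\<dots> = - ?r"
    unfolding lborel_on_Times[OF o(1,3)] using T.kcomp_adjoint[OF g' h' s\<theta>] by simp
  finally show "?l = - ?r" .
qed

lemma sqint_lborel_on_ktr:
  assumes "open X" "open Y" "sqint (lborel_on (X \<times> Y)) k"
  shows "sqint (lborel_on (Y \<times> X)) (ktr k)"
proof -
  interpret P: pair_sigma_finite "lborel_on X" "lborel_on Y" using assms(1,2) by (rule pair_lborel_on)
  show ?thesis using P.sqint_ktr assms by (simp add: lborel_on_Times)
qed

text \<open>Exchanging the variables preserves the product measure and carries test functions to
  test functions.\<close>

lemma wderiv_ktr:
  assumes o: "open X" "open Y" and ab: "(a, b) \<in> Basis"
    and k: "sqint (lborel_on (X \<times> Y)) k" and g: "sqint (lborel_on (X \<times> Y)) g" and wd: "wderiv (X \<times> Y) (a, b) k g"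
  shows "wderiv (Y \<times> X) (b, a) (ktr k) (ktr g)"
  unfolding wderiv_def
proof
  fix \<theta> assume \<theta>: "\<theta> \<in> test_functions (Y \<times> X)"
  interpret P: pair_sigma_finite "lborel_on X" "lborel_on Y" using o by (rule pair_lborel_on)
  have XY: "X \<times> Y \<in> sets lborel" using o by (simp add: open_Times)
  have swap: "lint (Y \<times> X) (ktr u) v = lint (X \<times> Y) u (ktr v)"
    if "sqint (lborel_on (X \<times> Y)) u" "ktr v \<in> test_functions (X \<times> Y)" for u v
    using P.integral_product_swap[of "\<lambda>z. u z * ktr v z"] sqint_measurable[OF that(1)]
      sqint_measurable[OF sqint_test_function[OF XY that(2)]]
    by (simp add: lborel_on_Times o ktr_def case_prod_unfold)
  note t = test_functions_ktr[OF \<theta>]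
  have d: "ktr (partial_deriv (b, a) \<theta>) = partial_deriv (a, b) (ktr \<theta>)"
    using \<theta> by (intro partial_deriv_ktr[symmetric]) (simp add: test_functions_iff)
  show "lint (Y \<times> X) (ktr k) (partial_deriv (b, a) \<theta>) = - lint (Y \<times> X) (ktr g) \<theta>"
    using wd t test_functions_partial_deriv[OF t ab] swap[OF k, of "partial_deriv (b, a) \<theta>"] swap[OF g t]
    by (simp add: d wderiv_def)
qed

text \<open>Transposition reverses a composition, which makes this a case of
  \<open>wderiv_kcomp_left\<close>.\<close>

lemma wderiv_kcomp_right:
  assumes o: "open X" "open Y" "open Z" and e: "e \<in> Basis"
    and k: "sqint (lborel_on (X \<times> Y)) k" and h: "sqint (lborel_on (Y \<times> Z)) h" and g: "sqint (lborel_on (Y \<times> Z)) g"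
    and wd: "wderiv (Y \<times> Z) (0, e) h g"
  shows "wderiv (X \<times> Z) (0, e) (kcomp (lborel_on Y) k h) (kcomp (lborel_on Y) k g)"
proof -
  interpret T: triple_sigma_finite "lborel_on X" "lborel_on Y" "lborel_on Z" using o by (rule triple_lborel_on)
  have b: "(0, e) \<in> Basis" "(e, 0) \<in> Basis" using e by (auto simp: Basis_prod_def)
  note t = sqint_lborel_on_ktr[OF o(1,2) k] sqint_lborel_on_ktr[OF o(2,3) h] sqint_lborel_on_ktr[OF o(2,3) g]
  have "sqint (lborel_on (X \<times> Z)) (kcomp (lborel_on Y) k u)" if "sqint (lborel_on (Y \<times> Z)) u" for u
    using T.sqint_kcomp k that by (simp add: lborel_on_Times o)
  then have s: "sqint (lborel_on (Z \<times> X)) (kcomp (lborel_on Y) (ktr u) (ktr k))" if "sqint (lborel_on (Y \<times> Z)) u" for u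
    unfolding kcomp_ktr using that by (intro sqint_lborel_on_ktr o)
  have "wderiv (Z \<times> X) (e, 0) (kcomp (lborel_on Y) (ktr h) (ktr k)) (kcomp (lborel_on Y) (ktr g) (ktr k))"
    by (intro wderiv_kcomp_left[OF o(3,2,1) e t(2,3) _ t(1)] wderiv_ktr[OF o(2,3) b(1) h g wd])
  from wderiv_ktr[OF o(3,1) b(2) s[OF h] s[OF g] this] show ?thesis by (simp add: kcomp_ktr)
qed

subsection \<open>Families of weak derivatives\<close>

type_synonym 'a parts = "('a \<Rightarrow> nat) \<Rightarrow> 'a \<Rightarrow> complex"

abbreviation (input) on_basis :: "('a::euclidean_space \<Rightarrow> nat) \<Rightarrow> bool"
  where "on_basis \<gamma> \<equiv> \<forall>b. b \<notin> Basis \<longrightarrow> \<gamma> b = 0"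

text \<open>Consistency is imposed through single steps \<gamma> to \<gamma> + b alone, since these
  are what kernels and limits respect. The component at 0 may differ from f on a null set, as limits
  and iterated kernels are determined no better.\<close>

definition wfam :: "'a::euclidean_space set \<Rightarrow> ('a \<Rightarrow> complex) \<Rightarrow> 'a parts \<Rightarrow> bool"
  where "wfam \<Omega> f G \<longleftrightarrow> (\<forall>\<gamma>. sqint (lborel_on \<Omega>) (G \<gamma>)) \<and> (AE x in lborel_on \<Omega>. G (\<lambda>_. 0) x = f x) \<and>
     (\<forall>\<gamma>. \<forall>b\<in>Basis. wderiv \<Omega> b (G \<gamma>) (G (\<gamma>(b := Suc (\<gamma> b)))))"

lemma wfamD:
  assumes "wfam \<Omega> f G"
  shows "sqint (lborel_on \<Omega>) (G \<gamma>)" "AE x in lborel_on \<Omega>. G (\<lambda>_. 0) x = f x"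
    "b \<in> Basis \<Longrightarrow> wderiv \<Omega> b (G \<gamma>) (G (\<gamma>(b := Suc (\<gamma> b))))"
  using assms by (auto simp: wfam_def)

lemma test_functions_iter_partial:
  "\<phi> \<in> test_functions \<Omega> \<Longrightarrow> set bs \<subseteq> Basis \<Longrightarrow> iter_partial bs \<phi> \<in> test_functions \<Omega>"
  by (induction bs) (auto intro: test_functions_partial_deriv)

text \<open>Integration by parts once per list entry, starting with the outermost derivative;
  \<gamma> must vary in the induction because it grows by b each time.\<close>

lemma wfam_iter_partial:
  assumes G: "wfam \<Omega> f G" and \<phi>: "\<phi> \<in> test_functions \<Omega>" and "set bs \<subseteq> Basis"
  shows "lint \<Omega> (G \<gamma>) (iter_partial bs \<phi>)
    = (-1) ^ length bs * lint \<Omega> (G (\<lambda>c. count_list bs c + \<gamma> c)) \<phi>"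
  using assms(3)
proof (induction bs arbitrary: \<gamma>)
  case (Cons b bs)
  have eq: "(\<lambda>c. count_list bs c + (\<gamma>(b := Suc (\<gamma> b))) c) = (\<lambda>c. count_list (b # bs) c + \<gamma> c)"
    by auto
  have sub: "set bs \<subseteq> Basis" using Cons.prems by simp
  have "lint \<Omega> (G \<gamma>) (partial_deriv b (iter_partial bs \<phi>))
     = - lint \<Omega> (G (\<gamma>(b := Suc (\<gamma> b)))) (iter_partial bs \<phi>)"
    using wfamD(3)[OF G, of b \<gamma>] test_functions_iter_partial[OF \<phi>, of bs] Cons.prems
    by (auto simp: wderiv_def)
  also have "\<dots> = - ((-1) ^ length bs * lint \<Omega> (G (\<lambda>c. count_list (b # bs) c + \<gamma> c)) \<phi>)"
    unfolding Cons.IH[OF sub, of "\<gamma>(b := Suc (\<gamma> b))"] eq ..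
  finally show ?case by simp
qed simp

lemma multi_index_order_count:
  assumes "\<forall>b. count_list bs b = \<alpha> b" "on_basis \<alpha>"
  shows "set bs \<subseteq> Basis" "multi_index_order \<alpha> = length bs" "count_list bs = \<alpha>"
proof -
  show s: "set bs \<subseteq> Basis"
    using assms by (metis count_list_0_iff subsetI)
  show c: "count_list bs = \<alpha>" using assms(1) by auto
  show "multi_index_order \<alpha> = length bs"
    unfolding multi_index_order_def c[symmetric] using sum_count_set[OF s finite_Basis] .
qed

text \<open>\<open>has_weak_partial\<close> quantifies over lists realising \<alpha> and would be
  vacuous without one; uniqueness rests on this existence.\<close>

lemma exists_count_list:
  fixes \<alpha> :: "'a::euclidean_space \<Rightarrow> nat"
  assumes "on_basis \<alpha>"
  shows "\<exists>bs. \<forall>b. count_list bs b = \<alpha> b"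
proof -
  have rep: "count_list (replicate n x) y = (if x = y then n else 0)" for n and x y :: 'a
    by (induction n) auto
  have "\<exists>bs. \<forall>b. count_list bs b = (if b \<in> B then \<alpha> b else 0)" if "finite B" for B
    using that
  proof (induction B)
    case (insert x B)
    then obtain bs where "\<forall>b. count_list bs b = (if b \<in> B then \<alpha> b else 0)" by blast
    then show ?case using insert.hyps
      by (intro exI[of _ "replicate (\<alpha> x) x @ bs"]) (auto simp: rep)
  qed (auto intro: exI[of _ "[]"])
  from this[OF finite_Basis] show ?thesis using assms by metis
qed

lemma wfam_has_weak_partial:
  assumes o: "open \<Omega>" and G: "wfam \<Omega> f G" and f: "f \<in> borel_measurable (lborel_on \<Omega>)"
    and \<alpha>: "on_basis \<alpha>"
  shows "has_weak_partial \<Omega> \<alpha> f (G \<alpha>)"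
  unfolding has_weak_partial_def
proof (intro ballI allI impI)
  fix \<phi> bs assume \<phi>: "\<phi> \<in> test_functions \<Omega>" and bs: "\<forall>b. count_list bs b = \<alpha> b"
  note b = multi_index_order_count[OF bs \<alpha>]
  have O: "\<Omega> \<in> sets lborel" using o by simp
  note t = sqint_test_function[OF O test_functions_iter_partial[OF \<phi> b(1)]]
  have "lint \<Omega> f (iter_partial bs \<phi>) = lint \<Omega> (G (\<lambda>_. 0)) (iter_partial bs \<phi>)"
  proof (rule integral_cong_AE)
    show "AE x in lborel_on \<Omega>. f x * iter_partial bs \<phi> x = G (\<lambda>_. 0) x * iter_partial bs \<phi> x"
      using wfamD(2)[OF G] by eventually_elim simp
  qed (use f sqint_measurable[OF wfamD(1)[OF G]] sqint_measurable[OF t] in auto)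
  also have "\<dots> = (-1) ^ length bs * lint \<Omega> (G \<alpha>) \<phi>"
    using wfam_iter_partial[OF G \<phi> b(1), of "\<lambda>_. 0"] b(3) by simp
  finally show "lint \<Omega> f (iter_partial bs \<phi>) = (-1) ^ multi_index_order \<alpha> * lint \<Omega> (G \<alpha>) \<phi>"
    by (simp add: b(2))
qed

lemma has_weak_partialD:
  assumes "has_weak_partial \<Omega> \<alpha> f g" "\<phi> \<in> test_functions \<Omega>" "\<forall>b. count_list bs b = \<alpha> b"
  shows "lint \<Omega> f (iter_partial bs \<phi>)
    = (-1) ^ multi_index_order \<alpha> * lint \<Omega> g \<phi>"
  using assms by (simp add: has_weak_partial_def)

text \<open>Because of this the arbitrary choice in \<open>weak_partial\<close> does not affect any
  norm.\<close>

lemma has_weak_partial_unique: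
  assumes o: "open \<Omega>" and \<alpha>: "on_basis \<alpha>"
    and g: "sqint (lborel_on \<Omega>) g" "has_weak_partial \<Omega> \<alpha> f g"
    and g': "sqint (lborel_on \<Omega>) g'" "has_weak_partial \<Omega> \<alpha> f g'"
  shows "AE x in lborel_on \<Omega>. g x = g' x"
proof -
  obtain bs where bs: "\<forall>b. count_list bs b = \<alpha> b" using exists_count_list[OF \<alpha>] by blast
  have O: "\<Omega> \<in> sets lborel" using o by simp
  have "AE x in lborel_on \<Omega>. g x - g' x = 0"
  proof (rule fundamental_lemma[OF o sqint_diff[OF g(1) g'(1)]])
    fix \<psi> assume \<psi>: "\<psi> \<in> test_functions \<Omega>"
    note t = sqint_test_function[OF O \<psi>]
    have "(-1) ^ multi_index_order \<alpha> * lint \<Omega> g \<psi>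
        = (-1) ^ multi_index_order \<alpha> * lint \<Omega> g' \<psi>"
      using has_weak_partialD[OF g(2) \<psi> bs] has_weak_partialD[OF g'(2) \<psi> bs] by simp
    then show "(LINT x|lborel_on \<Omega>. (g x - g' x) * \<psi> x) = 0"
      using g g' t by (simp add: left_diff_distrib sqint_mult_integrable)
  qed
  then show ?thesis by simp
qed

section \<open>Sobolev norms computed from families\<close>

lemma multi_indicesD:
  assumes "\<alpha> \<in> multi_indices m"
  shows "on_basis \<alpha>" "multi_index_order \<alpha> \<le> m"
  using assms by (auto simp: multi_indices_def)

text \<open>Gives the Sobolev norm its meaning: a sum over an infinite index set would be 0 by
  convention.\<close>

lemma finite_multi_indices: "finite (multi_indices m :: ('a::euclidean_space \<Rightarrow> nat) set)"
proof (rule finite_subset[OF _ finite_set_of_finite_funs[OF finite_Basis finite_atMost[of m], of 0]])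
  show "(multi_indices m :: ('a \<Rightarrow> nat) set) \<subseteq> {f. \<forall>x. (x \<in> Basis \<longrightarrow> f x \<in> {..m}) \<and> (x \<notin> Basis \<longrightarrow> f x = 0)}"
  proof safe
    fix \<alpha> :: "'a \<Rightarrow> nat" and x :: 'a assume a: "\<alpha> \<in> multi_indices m"
    show "x \<notin> Basis \<Longrightarrow> \<alpha> x = 0" using multi_indicesD(1)[OF a] by simp
    assume x: "x \<in> Basis"
    have "\<alpha> x \<le> multi_index_order \<alpha>"
      unfolding multi_index_order_def using x by (intro member_le_sum) auto
    then show "\<alpha> x \<le> m" using multi_indicesD(2)[OF a] by simp
  qed
qed

lemma zero_multi_indices [simp]: "(\<lambda>_. 0) \<in> multi_indices m"
  by (simp add: multi_indices_def multi_index_order_def)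

text \<open>From here on a bound for the members of any family, however constructed, is a bound for
  the Sobolev norm.\<close>

lemma
  assumes o: "open \<Omega>" and G: "wfam \<Omega> f G" and f: "f \<in> borel_measurable (lborel_on \<Omega>)"
  shows wfam_Sobolev_inf: "f \<in> Sobolev_inf \<Omega>"
    and wfam_weak_partial: "\<alpha> \<in> multi_indices m \<Longrightarrow> l2norm (lborel_on \<Omega>) (weak_partial \<Omega> \<alpha> f) = l2norm (lborel_on \<Omega>) (G \<alpha>)"
proof -
  have sf: "sqint (lborel_on \<Omega>) f"
    by (rule sqint_cong_AE[OF wfamD(2)[OF G] wfamD(1)[OF G] f])
  show "f \<in> Sobolev_inf \<Omega>"
    unfolding Sobolev_inf_def Sobolev_def
    using sf wfam_has_weak_partial[OF o G f multi_indicesD(1)] wfamD(1)[OF G]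
    by (auto simp: L2_space_iff intro!: bexI[of _ "G _"])
  assume \<alpha>: "\<alpha> \<in> multi_indices m"
  note hw = wfam_has_weak_partial[OF o G f multi_indicesD(1)[OF \<alpha>]]
  have "weak_partial \<Omega> \<alpha> f \<in> L2_space \<Omega> \<and> has_weak_partial \<Omega> \<alpha> f (weak_partial \<Omega> \<alpha> f)"
    unfolding weak_partial_def by (rule someI[of _ "G \<alpha>"]) (use hw wfamD(1)[OF G] in \<open>auto simp: L2_space_iff\<close>)
  then have w: "sqint (lborel_on \<Omega>) (weak_partial \<Omega> \<alpha> f)" "has_weak_partial \<Omega> \<alpha> f (weak_partial \<Omega> \<alpha> f)"
    by (auto simp: L2_space_iff)
  show "l2norm (lborel_on \<Omega>) (weak_partial \<Omega> \<alpha> f) = l2norm (lborel_on \<Omega>) (G \<alpha>)"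
    by (rule l2norm_cong_AE[OF has_weak_partial_unique[OF o multi_indicesD(1)[OF \<alpha>] w wfamD(1)[OF G] hw]])
       (use w wfamD(1)[OF G] in \<open>auto simp: sqint_def\<close>)
qed

lemma Sobolev_norm_wfam:
  assumes "open \<Omega>" "wfam \<Omega> f G" "f \<in> borel_measurable (lborel_on \<Omega>)"
  shows "Sobolev_norm \<Omega> m f = (\<Sum>\<alpha>\<in>multi_indices m. l2norm (lborel_on \<Omega>) (G \<alpha>))"
  unfolding Sobolev_norm_def L2_norm_on_eq using wfam_weak_partial[OF assms] by (intro sum.cong) auto

lemma Sobolev_norm_nonneg: "0 \<le> Sobolev_norm \<Omega> m f"
  unfolding Sobolev_norm_def L2_norm_on_eq by (intro sum_nonneg) simp

lemma l2norm_le_Sobolev_norm: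
  assumes "open \<Omega>" "wfam \<Omega> f G" "f \<in> borel_measurable (lborel_on \<Omega>)" "\<alpha> \<in> multi_indices m"
  shows "l2norm (lborel_on \<Omega>) (G \<alpha>) \<le> Sobolev_norm \<Omega> m f"
  unfolding Sobolev_norm_wfam[OF assms(1-3)] by (rule member_le_sum) (use assms(4) finite_multi_indices in auto)

text \<open>The count depends on the dimension, which the type of \<Omega> supplies.\<close>

definition num_indices :: "'a::euclidean_space set \<Rightarrow> nat \<Rightarrow> real"
  where "num_indices \<Omega> m = real (card (multi_indices m :: ('a \<Rightarrow> nat) set))"

lemma Sobolev_norm_le:
  assumes "open \<Omega>" "wfam \<Omega> f G" "f \<in> borel_measurable (lborel_on \<Omega>)"
    and "\<And>\<alpha>. \<alpha> \<in> multi_indices m \<Longrightarrow> l2norm (lborel_on \<Omega>) (G \<alpha>) \<le> C"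
  shows "Sobolev_norm \<Omega> m f \<le> num_indices \<Omega> m * C"
  unfolding Sobolev_norm_wfam[OF assms(1-3)] num_indices_def 
  using sum_bounded_above[of "multi_indices m" "\<lambda>\<alpha>. l2norm (lborel_on \<Omega>) (G \<alpha>)" C] assms(4) by simp

text \<open>The value 0 at multi-indices that are not supported on the basis keeps the recursion of
  \<^const>\<open>wfam\<close> unconditional.\<close>

definition wparts :: "'a::euclidean_space set \<Rightarrow> ('a \<Rightarrow> complex) \<Rightarrow> 'a parts"
  where "wparts \<Omega> f \<gamma> = (if on_basis \<gamma> then weak_partial \<Omega> \<gamma> f else (\<lambda>x. 0))"

lemma Sobolev_inf_sqint: "f \<in> Sobolev_inf \<Omega> \<Longrightarrow> sqint (lborel_on \<Omega>) f"
  by (auto simp: Sobolev_inf_def Sobolev_def L2_space_iff)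

text \<open>The weak derivatives are chosen separately for each \<gamma>, yet they fit together:
  pairing the one for \<gamma> with \<open>partial_deriv b \<phi>\<close> and the one for \<gamma> +
  b with \<phi> both lead back to the same integral of f.\<close>

lemma Sobolev_inf_wfam:
  fixes \<Omega> :: "'a::euclidean_space set"
  assumes o: "open \<Omega>" and f: "f \<in> Sobolev_inf \<Omega>"
  shows "wfam \<Omega> f (wparts \<Omega> f)"
proof -
  have w: "sqint (lborel_on \<Omega>) (weak_partial \<Omega> \<gamma> f)" "has_weak_partial \<Omega> \<gamma> f (weak_partial \<Omega> \<gamma> f)"
    if "on_basis \<gamma>" for \<gamma>
  proof -
    have "\<gamma> \<in> multi_indices (multi_index_order \<gamma>)" using that by (simp add: multi_indices_def)
    then have "\<exists>g. g \<in> L2_space \<Omega> \<and> has_weak_partial \<Omega> \<gamma> f g"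
      using f unfolding Sobolev_inf_def Sobolev_def by blast
    from someI_ex[OF this] show "sqint (lborel_on \<Omega>) (weak_partial \<Omega> \<gamma> f)" "has_weak_partial \<Omega> \<gamma> f (weak_partial \<Omega> \<gamma> f)"
      unfolding weak_partial_def L2_space_iff by auto
  qed
  have "has_weak_partial \<Omega> (\<lambda>_. 0) f f"
    unfolding has_weak_partial_def
  proof (intro ballI allI impI)
    fix \<phi> :: "'a \<Rightarrow> complex" and bs :: "'a list" assume "\<forall>b. count_list bs b = 0"
    then have "bs = []" by (metis count_list_0_iff last_in_set)
    then show "lint \<Omega> f (iter_partial bs \<phi>) = (-1) ^ multi_index_order (\<lambda>_. 0) * lint \<Omega> f \<phi>"
      by (simp add: multi_index_order_def)
  qed
  then have "AE x in lborel_on \<Omega>. wparts \<Omega> f (\<lambda>_. 0) x = f x"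
    using has_weak_partial_unique[OF o _ w(1,2) Sobolev_inf_sqint[OF f]] by (simp add: wparts_def)
  moreover have "wderiv \<Omega> b (wparts \<Omega> f \<gamma>) (wparts \<Omega> f (\<gamma>(b := Suc (\<gamma> b))))" if b: "b \<in> Basis" for \<gamma> b
  proof (cases "on_basis \<gamma>")
    case True
    let ?\<gamma>' = "\<gamma>(b := Suc (\<gamma> b))"
    have True': "on_basis ?\<gamma>'" using True b by auto
    obtain bs where bs: "\<forall>b. count_list bs b = \<gamma> b" using exists_count_list[OF True] by blast
    \<comment> \<open>Appending b at the end makes it the innermost derivative, the one that acts on
      \<phi> first.\<close>
    then have bs': "\<forall>c. count_list (bs @ [b]) c = ?\<gamma>' c" by auto
    have ord: "multi_index_order \<gamma> = length bs" "multi_index_order ?\<gamma>' = Suc (length bs)"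
      using multi_index_order_count(2)[OF bs True] multi_index_order_count(2)[of "bs @ [b]" ?\<gamma>', OF bs' True']
      by (simp_all del: fun_upd_apply)
    have "wderiv \<Omega> b (weak_partial \<Omega> \<gamma> f) (weak_partial \<Omega> ?\<gamma>' f)"
      unfolding wderiv_def
    proof
      fix \<phi> assume \<phi>: "\<phi> \<in> test_functions \<Omega>"
      have "(-1) ^ length bs * lint \<Omega> (weak_partial \<Omega> \<gamma> f) (partial_deriv b \<phi>)
          = lint \<Omega> f (iter_partial bs (partial_deriv b \<phi>))"
        using has_weak_partialD[OF w(2)[OF True] test_functions_partial_deriv[OF \<phi> b] bs] ord by simp
      also have "\<dots> = lint \<Omega> f (iter_partial (bs @ [b]) \<phi>)"
        by (simp add: iter_partial_snoc)
      also have "\<dots> = (-1) ^ Suc (length bs) * lint \<Omega> (weak_partial \<Omega> ?\<gamma>' f) \<phi>"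
        using has_weak_partialD[OF w(2)[OF True'] \<phi> bs'] unfolding ord .
      finally have "(-1) ^ length bs * lint \<Omega> (weak_partial \<Omega> \<gamma> f) (partial_deriv b \<phi>)
          = (-1) ^ length bs * - lint \<Omega> (weak_partial \<Omega> ?\<gamma>' f) \<phi>"
        by simp
      then show "lint \<Omega> (weak_partial \<Omega> \<gamma> f) (partial_deriv b \<phi>) = - lint \<Omega> (weak_partial \<Omega> ?\<gamma>' f) \<phi>"
        unfolding mult_cancel_left by simp
    qed
    then show ?thesis using True True' unfolding wparts_def by presburger
  next
    case False
    then have False': "\<not> (\<forall>c. c \<notin> Basis \<longrightarrow> (\<gamma>(b := Suc (\<gamma> b))) c = 0)" using b by auto
    show ?thesis unfolding wparts_def if_not_P[OF False] if_not_P[OF False'] by (rule wderiv_zero)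
  qed
  ultimately show ?thesis unfolding wfam_def using w(1) by (auto simp: wparts_def)
qed

lemma wfam_cong_AE:
  assumes "wfam \<Omega> f G" "AE x in lborel_on \<Omega>. f x = g x"
  shows "wfam \<Omega> g G"
proof -
  have "AE x in lborel_on \<Omega>. G (\<lambda>_. 0) x = g x" using wfamD(2)[OF assms(1)] assms(2) by eventually_elim simp
  then show ?thesis using assms(1) by (simp add: wfam_def)
qed

lemma wfam_diff:
  assumes o: "open \<Omega>" and G: "wfam \<Omega> f G" and G': "wfam \<Omega> f' G'"
  shows "wfam \<Omega> (\<lambda>x. f x - f' x) (\<lambda>\<gamma> x. G \<gamma> x - G' \<gamma> x)"
proof -
  have "AE x in lborel_on \<Omega>. G (\<lambda>_. 0) x - G' (\<lambda>_. 0) x = f x - f' x"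
    using wfamD(2)[OF G] wfamD(2)[OF G'] by eventually_elim simp
  moreover have "wderiv \<Omega> b (\<lambda>x. G \<gamma> x - G' \<gamma> x) (\<lambda>x. G (\<gamma>(b := Suc (\<gamma> b))) x - G' (\<gamma>(b := Suc (\<gamma> b))) x)" if b: "b \<in> Basis" for b \<gamma>
    using wderiv_add[OF o b wfamD(1)[OF G] wfamD(1)[OF G]
      sqint_cmult[OF wfamD(1)[OF G'], of "-1"] sqint_cmult[OF wfamD(1)[OF G'], of "-1"]
      wfamD(3)[OF G b] wderiv_cmult[OF wfamD(3)[OF G' b], of "-1"]] by simp
  ultimately show ?thesis unfolding wfam_def using sqint_diff[OF wfamD(1)[OF G] wfamD(1)[OF G']] by blast
qed

lemma wfam_zero: "wfam \<Omega> (\<lambda>x. 0) (\<lambda>\<gamma> x. 0)"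
  by (simp add: wfam_def wderiv_zero)

subsection \<open>Weak derivatives of kernel operators\<close>

text \<open>A basis vector of the product space is (e, 0) or (0, e); here and below the test y = 0
  tells the two kinds apart.\<close>

definition lift_index :: "('a \<Rightarrow> nat) \<Rightarrow> 'a \<times> 'b::zero \<Rightarrow> nat"
  where "lift_index \<gamma> = (\<lambda>(x, y). if y = 0 then \<gamma> x else 0)"

definition left_index :: "('a \<times> 'b::zero \<Rightarrow> nat) \<Rightarrow> 'a \<times> 'b \<Rightarrow> nat"
  where "left_index \<gamma> = (\<lambda>(x, y). if y = 0 then \<gamma> (x, y) else 0)"

definition right_index :: "('a \<times> 'b::zero \<Rightarrow> nat) \<Rightarrow> 'a \<times> 'b \<Rightarrow> nat"
  where "right_index \<gamma> = (\<lambda>(x, y). if y = 0 then 0 else \<gamma> (x, y))"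

lemma index_zero [simp]:
  "lift_index (\<lambda>_. 0) = (\<lambda>_. 0)" "left_index (\<lambda>_. 0) = (\<lambda>_. 0)" "right_index (\<lambda>_. 0) = (\<lambda>_. 0)"
  by (auto simp: lift_index_def left_index_def right_index_def)

lemma lift_index_multi:
  fixes \<gamma> :: "'a::euclidean_space \<Rightarrow> nat"
  assumes "\<gamma> \<in> multi_indices m"
  shows "(lift_index \<gamma> :: 'a \<times> 'b::euclidean_space \<Rightarrow> nat) \<in> multi_indices m"
proof -
  have "multi_index_order (lift_index \<gamma> :: 'a \<times> 'b \<Rightarrow> nat) = multi_index_order \<gamma>"
    unfolding multi_index_order_def Basis_prod_def
    by (subst sum.union_disjoint) (auto simp: sum.reindex inj_on_def lift_index_def intro!: sum.neutral)
  moreover have "lift_index \<gamma> b = 0" if "b \<notin> Basis" for b :: "'a \<times> 'b"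
    using that multi_indicesD(1)[OF assms] by (auto simp: lift_index_def Basis_prod_def split: prod.splits)
  ultimately show ?thesis using multi_indicesD(2)[OF assms] by (simp add: multi_indices_def)
qed

lemma split_index_multi:
  fixes \<gamma> :: "'a::euclidean_space \<times> 'b::euclidean_space \<Rightarrow> nat"
  assumes "\<gamma> \<in> multi_indices m"
  shows "left_index \<gamma> \<in> multi_indices m" "right_index \<gamma> \<in> multi_indices m"
proof -
  have "multi_index_order (left_index \<gamma>) \<le> multi_index_order \<gamma>" "multi_index_order (right_index \<gamma>) \<le> multi_index_order \<gamma>"
    unfolding multi_index_order_def by (auto intro!: sum_mono simp: left_index_def right_index_def)
  then show "left_index \<gamma> \<in> multi_indices m" "right_index \<gamma> \<in> multi_indices m"
    using assms by (auto simp: multi_indices_def left_index_def right_index_def)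
qed

text \<open>Derivatives in x never reach f, so that square-integrability of f suffices.\<close>

lemma wfam_kapp:
  fixes X :: "'a::euclidean_space set" and Y :: "'b::euclidean_space set"
  assumes o: "open X" "open Y" and G: "wfam (X \<times> Y) k G" and f: "sqint (lborel_on Y) f"
    and k: "k \<in> borel_measurable (lborel_on (X \<times> Y))"
  shows "wfam X (kapp (lborel_on Y) k f) (\<lambda>\<gamma>. kapp (lborel_on Y) (G (lift_index \<gamma>)) f)"
proof -
  let ?Y = "lborel_on Y"
  interpret P: pair_sigma_finite "lborel_on X" ?Y using o by (rule pair_lborel_on)
  note s = wfamD(1)[OF G]
  note s' = s[unfolded lborel_on_Times[OF o]]
  have "sqint (lborel_on X) (kapp ?Y (G (lift_index \<gamma>)) f)" for \<gamma> :: "'a \<Rightarrow> nat"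
    by (rule P.sqint_kapp[OF s' f])
  moreover have "AE x in lborel_on X. kapp ?Y (G (lift_index (\<lambda>_. 0))) f x = kapp ?Y k f x"
    using wfamD(2)[OF G] k sqint_measurable[OF s] sqint_measurable[OF f]
    unfolding lborel_on_Times[OF o] index_zero by (intro P.kapp_cong_AE) auto
  moreover have "wderiv X b (kapp ?Y (G (lift_index \<gamma>)) f) (kapp ?Y (G (lift_index (\<gamma>(b := Suc (\<gamma> b))))) f)"
    if b: "b \<in> Basis" for b \<gamma>
  proof -
    have eq: "lift_index (\<gamma>(b := Suc (\<gamma> b))) = (lift_index \<gamma>)((b, 0 :: 'b) := Suc (lift_index \<gamma> (b, 0)))"
      by (auto simp: lift_index_def)
    have "(b, 0 :: 'b) \<in> Basis" using b by (simp add: Basis_prod_def)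
    from wfamD(3)[OF G this, of "lift_index \<gamma>", folded eq] show ?thesis
      by (rule wderiv_kapp[OF o b s s _ f])
  qed
  ultimately show ?thesis unfolding wfam_def by blast
qed

text \<open>Each index splits in exactly one way, into its first-variable part for k and its
  second-variable part for h.\<close>

lemma wfam_kcomp:
  fixes X Y Z :: "'a::euclidean_space set"
  assumes o: "open X" "open Y" "open Z" and G: "wfam (X \<times> Y) k G" and G': "wfam (Y \<times> Z) h G'"
    and k: "k \<in> borel_measurable (lborel_on (X \<times> Y))" and h: "h \<in> borel_measurable (lborel_on (Y \<times> Z))"
  shows "wfam (X \<times> Z) (kcomp (lborel_on Y) k h) (\<lambda>\<gamma>. kcomp (lborel_on Y) (G (left_index \<gamma>)) (G' (right_index \<gamma>)))"
proof -
  let ?X = "lborel_on X" and ?Y = "lborel_on Y" and ?Z = "lborel_on Z"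
  interpret T: triple_sigma_finite ?X ?Y ?Z using o by (rule triple_lborel_on)
  note s = wfamD(1)[OF G] and t = wfamD(1)[OF G']
  note eqs = lborel_on_Times[OF o(1,2)] lborel_on_Times[OF o(2,3)] lborel_on_Times[OF o(1,3)]
  note s' = s[unfolded eqs] and t' = t[unfolded eqs]
  have sq: "sqint (lborel_on (X \<times> Z)) (kcomp ?Y (G \<alpha>) (G' \<beta>))" for \<alpha> \<beta>
    unfolding eqs by (rule T.sqint_kcomp[OF s' t'])
  \<comment> \<open>The zero components of the families equal k and h up to null sets; the
    difference estimate shows that the compositions then agree up to a null set.\<close>
  moreover have "AE z in lborel_on (X \<times> Z). kcomp ?Y (G (left_index (\<lambda>_. 0))) (G' (right_index (\<lambda>_. 0))) z = kcomp ?Y k h z"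
  proof -
    have sk: "sqint (?X \<Otimes>\<^sub>M ?Y) k" and sh: "sqint (?Y \<Otimes>\<^sub>M ?Z) h"
      using sqint_cong_AE[OF wfamD(2)[OF G] s k] sqint_cong_AE[OF wfamD(2)[OF G'] t h] unfolding eqs by auto
    have "l2norm (?X \<Otimes>\<^sub>M ?Y) (\<lambda>z. G (\<lambda>_. 0) z - k z) = l2norm (?X \<Otimes>\<^sub>M ?Y) (\<lambda>z. 0)"
      "l2norm (?Y \<Otimes>\<^sub>M ?Z) (\<lambda>z. G' (\<lambda>_. 0) z - h z) = l2norm (?Y \<Otimes>\<^sub>M ?Z) (\<lambda>z. 0)"
      using wfamD(2)[OF G] wfamD(2)[OF G'] unfolding eqs
      by (intro l2norm_cong_AE sqint_measurable sqint_diff s' t' sk sh sqint_zero; force)+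
    then have "l2norm (?X \<Otimes>\<^sub>M ?Z) (\<lambda>z. kcomp ?Y (G (\<lambda>_. 0)) (G' (\<lambda>_. 0)) z - kcomp ?Y k h z) \<le> 0"
      using T.kcomp_diff_norm_le[OF s' sk t' sh, of "\<lambda>_. 0" "\<lambda>_. 0"] by simp
    then show ?thesis
      unfolding index_zero eqs
      by (intro l2norm_diff_eq_0_imp_AE T.sqint_kcomp s' t' sk sh)
  qed
  moreover have "wderiv (X \<times> Z) b (kcomp ?Y (G (left_index \<gamma>)) (G' (right_index \<gamma>)))
      (kcomp ?Y (G (left_index (\<gamma>(b := Suc (\<gamma> b))))) (G' (right_index (\<gamma>(b := Suc (\<gamma> b))))))" if b: "b \<in> Basis" for b \<gamma>
  proof -
    \<comment> \<open>\<open>e \<noteq> 0\<close> guarantees that (0, e) is seen by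
      \<open>right_index\<close> and not by \<open>left_index\<close>.\<close>
    consider e where "b = (e, 0)" "e \<in> Basis" | e where "b = (0, e)" "e \<in> Basis" "e \<noteq> 0"
      using b by (auto simp: Basis_prod_def)
    then show ?thesis
    proof cases
      case 1
      have i: "left_index (\<gamma>(b := Suc (\<gamma> b))) = (left_index \<gamma>)(b := Suc (left_index \<gamma> b))"
        "right_index (\<gamma>(b := Suc (\<gamma> b))) = right_index \<gamma>"
        using 1 by (auto simp: left_index_def right_index_def)
      show ?thesis unfolding i using wfamD(3)[OF G b] 1(1)
        by (auto intro!: wderiv_kcomp_left[OF o 1(2) s s _ t])
    next
      case 2
      have i: "right_index (\<gamma>(b := Suc (\<gamma> b))) = (right_index \<gamma>)(b := Suc (right_index \<gamma> b))"
        "left_index (\<gamma>(b := Suc (\<gamma> b))) = left_index \<gamma>"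
        using 2 by (auto simp: left_index_def right_index_def)
      show ?thesis unfolding i using wfamD(3)[OF G' b] 2(1)
        by (auto intro!: wderiv_kcomp_right[OF o 2(2) s t t])
    qed
  qed
  ultimately show ?thesis unfolding wfam_def by blast
qed

subsection \<open>Iterated kernels\<close>

definition chain :: "nat \<Rightarrow> 'a \<Rightarrow> 'a \<Rightarrow> (nat \<Rightarrow> 'a) \<Rightarrow> nat \<Rightarrow> 'a"
  where "chain n x y \<xi> = (\<lambda>i. if i = 0 then x else if i = n then y else \<xi> i)"

definition kprod :: "nat \<Rightarrow> ('a \<times> 'a \<Rightarrow> complex) \<Rightarrow> 'a \<times> 'a \<Rightarrow> (nat \<Rightarrow> 'a) \<Rightarrow> complex"
  where "kprod n k z \<xi> = (\<Prod>i<n. k (chain n (fst z) (snd z) \<xi> i, chain n (fst z) (snd z) \<xi> (Suc i)))"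

lemma iter_kernel_eq: "iter_kernel X n k z = (LINT \<xi>|Pi\<^sub>M {1..<n} (\<lambda>_. lborel_on X). kprod n k z \<xi>)"
  by (simp add: iter_kernel_def kprod_def chain_def Let_def case_prod_unfold)

lemma kprod_measurable:
  assumes k: "k \<in> borel_measurable (M \<Otimes>\<^sub>M M)"
  shows "(\<lambda>w. kprod n k (fst w) (snd w)) \<in> borel_measurable ((M \<Otimes>\<^sub>M M) \<Otimes>\<^sub>M Pi\<^sub>M {1..<n} (\<lambda>_. M))"
proof -
  let ?N = "(M \<Otimes>\<^sub>M M) \<Otimes>\<^sub>M Pi\<^sub>M {1..<n} (\<lambda>_. M)"
  have p: "(\<lambda>w. chain n (fst (fst w)) (snd (fst w)) (snd w) i) \<in> ?N \<rightarrow>\<^sub>M M" if i: "i \<le> n" for i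
  proof -
    consider "i = 0" | "i \<noteq> 0" "i = n" | "i \<noteq> 0" "i \<noteq> n" "i \<in> {1..<n}" using i by force
    then show ?thesis
    proof cases
      case 3
      have "(\<lambda>w. snd w i) \<in> ?N \<rightarrow>\<^sub>M M"
        using measurable_compose[OF measurable_snd measurable_component_singleton[OF 3(3)]] .
      then show ?thesis using 3 by (simp add: chain_def)
    qed (simp_all add: chain_def)
  qed
  show ?thesis
    unfolding kprod_def
    by (intro borel_measurable_prod measurable_compose[OF _ k] measurable_Pair p) auto
qed

lemma kprod_1: "kprod (Suc 0) k z \<xi> = k z"
  by (simp add: kprod_def chain_def)

text \<open>Splits off the last edge of the chain: the intermediate point of index n becomes the end
  point of the shorter chain.\<close>

lemma kprod_Suc:
  assumes "n \<ge> 1" "\<And>i. i \<in> {1..<n} \<Longrightarrow> \<xi>' i = \<xi> i"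
  shows "kprod (Suc n) k (x, y) \<xi>' = kprod n k (x, \<xi>' n) \<xi> * k (\<xi>' n, y)"
proof -
  have c: "chain (Suc n) x y \<xi>' i = chain n x (\<xi>' n) \<xi> i" if "i \<le> n" for i
    using assms that by (auto simp: chain_def)
  have "chain (Suc n) x y \<xi>' n = \<xi>' n" "chain (Suc n) x y \<xi>' (Suc n) = y"
    using assms by (auto simp: chain_def)
  then show ?thesis unfolding kprod_def by (simp add: c)
qed

context
  fixes X :: "'a::euclidean_space set"
  assumes openX: "open X"
begin

abbreviation (input) MM where "MM \<equiv> lborel_on X \<Otimes>\<^sub>M lborel_on X"

abbreviation (input) PM :: "nat \<Rightarrow> (nat \<Rightarrow> 'a) measure" where "PM n \<equiv> Pi\<^sub>M {1..<n} (\<lambda>_. lborel_on X)"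

interpretation A: sigma_finite_measure "lborel_on X"
  by (rule sigma_finite_lborel_on[OF openX])

interpretation T: triple_sigma_finite "lborel_on X" "lborel_on X" "lborel_on X" ..

interpretation F: product_sigma_finite "\<lambda>_. lborel_on X" ..

lemma iter_kernel_measurable:
  assumes "k \<in> borel_measurable MM"
  shows "iter_kernel X n k \<in> borel_measurable MM"
proof -
  interpret S: sigma_finite_measure "PM n" by (rule F.sigma_finite) simp
  have "iter_kernel X n k = (\<lambda>z. LINT \<xi>|PM n. kprod n k z \<xi>)"
    by (simp add: fun_eq_iff iter_kernel_eq)
  also have "\<dots> \<in> borel_measurable MM"
    using kprod_measurable[OF assms, of n] by (intro S.borel_measurable_lebesgue_integral) (simp add: case_prod_unfold)
  finally show ?thesis .
qed

lemma iter_kernel_1: "iter_kernel X (Suc 0) k = k"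
  unfolding iter_kernel_eq kprod_1 by (simp add: fun_eq_iff iter_kernel_eq kprod_1 PiM_empty lebesgue_integral_count_space_finite)

text \<open>The iterated kernel with absolute values inside. Where it is finite, the integrand of
  \<open>iter_kernel\<close> is integrable and Fubini applies.\<close>

definition nn_iter :: "nat \<Rightarrow> ('a \<times> 'a \<Rightarrow> complex) \<Rightarrow> 'a \<times> 'a \<Rightarrow> ennreal"
  where "nn_iter n k z = (\<integral>\<^sup>+\<xi>. ennreal (cmod (kprod n k z \<xi>)) \<partial>PM n)"

lemma nn_iter_measurable:
  assumes "k \<in> borel_measurable MM"
  shows "nn_iter n k \<in> borel_measurable MM"
proof -
  interpret S: sigma_finite_measure "PM n" by (rule F.sigma_finite) simp
  have "nn_iter n k = (\<lambda>z. \<integral>\<^sup>+\<xi>. ennreal (cmod (kprod n k z \<xi>)) \<partial>PM n)"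
    by (simp add: fun_eq_iff nn_iter_def)
  also have "\<dots> \<in> borel_measurable MM"
    using kprod_measurable[OF assms, of n] by (intro S.borel_measurable_nn_integral) (simp add: case_prod_unfold)
  finally show ?thesis .
qed

lemma kprod_section_measurable:
  assumes "k \<in> borel_measurable MM" "z \<in> space MM"
  shows "kprod n k z \<in> borel_measurable (PM n)"
  using measurable_Pair2[OF kprod_measurable[OF assms(1), of n] assms(2)] by simp

lemma nn_iter_Suc:
  assumes k: "k \<in> borel_measurable MM" and n: "n \<ge> 1"
    and z: "z \<in> space MM"
  shows "nn_iter (Suc n) k z = (\<integral>\<^sup>+\<eta>. nn_iter n k (fst z, \<eta>) * ennreal (cmod (k (\<eta>, snd z))) \<partial>lborel_on X)"
proof -
  have ins: "insert n {1..<n} = {1..<Suc n}" using n by auto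
  have x: "fst z \<in> space (lborel_on X)" using z by (auto simp: space_pair_measure)
  have m: "(\<lambda>\<xi>. ennreal (cmod (kprod (Suc n) k z \<xi>))) \<in> borel_measurable (Pi\<^sub>M (insert n {1..<n}) (\<lambda>_. lborel_on X))"
    unfolding ins using kprod_section_measurable[OF k z, of "Suc n"] by simp
  have "nn_iter (Suc n) k z = (\<integral>\<^sup>+\<eta>. (\<integral>\<^sup>+\<xi>. ennreal (cmod (kprod (Suc n) k z (\<xi>(n := \<eta>)))) \<partial>PM n) \<partial>lborel_on X)"
    unfolding nn_iter_def ins[symmetric] by (rule F.product_nn_integral_insert_rev[OF _ _ m]) auto
  also have "\<dots> = (\<integral>\<^sup>+\<eta>. nn_iter n k (fst z, \<eta>) * ennreal (cmod (k (\<eta>, snd z))) \<partial>lborel_on X)"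
  proof (rule nn_integral_cong)
    fix \<eta> assume \<eta>: "\<eta> \<in> space (lborel_on X)"
    have "kprod (Suc n) k z (\<xi>(n := \<eta>)) = kprod n k (fst z, \<eta>) \<xi> * k (\<eta>, snd z)" for \<xi>
      using kprod_Suc[OF n, of "\<xi>(n := \<eta>)" \<xi> k "fst z" "snd z"] by simp
    then show "(\<integral>\<^sup>+\<xi>. ennreal (cmod (kprod (Suc n) k z (\<xi>(n := \<eta>)))) \<partial>PM n)
        = nn_iter n k (fst z, \<eta>) * ennreal (cmod (k (\<eta>, snd z)))"
      using kprod_section_measurable[OF k, of "(fst z, \<eta>)" n] x \<eta> unfolding nn_iter_def
      by (simp add: norm_mult ennreal_mult space_pair_measure nn_integral_multc)
  qed
  finally show ?thesis .
qed

text \<open>Each step composes with |k|, which \<open>nn_kcomp_le\<close> controls. As a consequence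
  \<open>nn_iter\<close> is finite almost everywhere.\<close>

lemma nn_iter_finite:
  assumes k: "sqint MM k" and "n \<ge> 1"
  shows "(\<integral>\<^sup>+z. (nn_iter n k z)\<^sup>2 \<partial>MM) < \<infinity>"
  using assms(2)
proof (induction n rule: dec_induct)
  case base
  have "nn_iter 1 k z = ennreal (cmod (k z))" for z
    by (simp add: nn_iter_def kprod_1 PiM_empty nn_integral_count_space_finite)
  then show ?case using nn_eq_l2norm[OF k] by (simp add: ennreal_power)
next
  case (step n)
  note km = sqint_measurable[OF k]
  have "(\<integral>\<^sup>+z. (nn_iter (Suc n) k z)\<^sup>2 \<partial>MM)
    = (\<integral>\<^sup>+z. (\<integral>\<^sup>+\<eta>. nn_iter n k (fst z, \<eta>) * ennreal (cmod (k (\<eta>, snd z))) \<partial>lborel_on X)\<^sup>2 \<partial>MM)"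
    using nn_iter_Suc[OF km step.hyps(1)] by (intro nn_integral_cong) simp
  also have "\<dots> \<le> (\<integral>\<^sup>+z. (nn_iter n k z)\<^sup>2 \<partial>MM)
      * (\<integral>\<^sup>+z. (ennreal (cmod (k z)))\<^sup>2 \<partial>MM)"
    by (rule T.nn_kcomp_le[OF nn_iter_measurable[OF km]]) (use km in simp)
  also have "\<dots> < \<infinity>"
    using step.IH nn_eq_l2norm[OF k] by (simp add: ennreal_power ennreal_mult_less_top)
  finally show ?case .
qed

text \<open>Fubini in the last intermediate variable, at the points where \<open>nn_iter\<close> is
  finite. Elsewhere the two sides may be unrelated default values.\<close>

lemma iter_kernel_Suc:
  assumes k: "sqint MM k" and n: "n \<ge> 1"
  shows "AE z in MM. iter_kernel X (Suc n) k z = kcomp (lborel_on X) (iter_kernel X n k) k z"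
proof -
  note km [measurable] = sqint_measurable[OF k]
  note im [measurable] = iter_kernel_measurable[OF km, of n]
  have "AE z in MM. (nn_iter (Suc n) k z)\<^sup>2 \<noteq> \<infinity>"
    using nn_iter_finite[OF k, of "Suc n"] nn_iter_measurable[OF km, of "Suc n"]
    by (intro nn_integral_PInf_AE) auto
  with AE_space show ?thesis
  proof eventually_elim
    case (elim z)
    have fin: "nn_iter (Suc n) k z < \<infinity>" using elim(2) by (cases "nn_iter (Suc n) k z = \<infinity>") (auto simp: less_top)
    obtain x y where xy: "z = (x, y)" by (cases z)
    have sp: "x \<in> space (lborel_on X)" "y \<in> space (lborel_on X)" using elim(1) xy by (auto simp: space_pair_measure)
    \<comment> \<open>The set is written in this order so that coordinate n becomes the outer
      integration variable.\<close>
    have ins: "{n} \<union> {1..<n} = {1..<Suc n}" using n by auto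
    have int: "integrable (Pi\<^sub>M ({n} \<union> {1..<n}) (\<lambda>_. lborel_on X)) (kprod (Suc n) k z)"
      unfolding ins integrable_iff_bounded
      using fin kprod_section_measurable[OF km elim(1), of "Suc n"] by (simp add: nn_iter_def)
    have "iter_kernel X (Suc n) k z = (LINT \<xi>|Pi\<^sub>M ({n} \<union> {1..<n}) (\<lambda>_. lborel_on X). kprod (Suc n) k z \<xi>)"
      unfolding iter_kernel_eq ins ..
    also have "\<dots> = (LINT u|Pi\<^sub>M {n} (\<lambda>_. lborel_on X). LINT \<xi>|PM n. kprod (Suc n) k z (merge {n} {1..<n} (u, \<xi>)))"
      by (rule F.product_integral_fold[OF _ _ _ int]) auto
    also have "\<dots> = (LINT u|Pi\<^sub>M {n} (\<lambda>_. lborel_on X). iter_kernel X n k (x, u n) * k (u n, y))"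
    proof (rule Bochner_Integration.integral_cong[OF refl])
      fix u
      have "kprod (Suc n) k z (merge {n} {1..<n} (u, \<xi>)) = kprod n k (x, u n) \<xi> * k (u n, y)" for \<xi>
        using kprod_Suc[OF n, of "merge {n} {1..<n} (u, \<xi>)" \<xi> k x y] by (simp add: xy merge_def)
      then show "(LINT \<xi>|PM n. kprod (Suc n) k z (merge {n} {1..<n} (u, \<xi>))) = iter_kernel X n k (x, u n) * k (u n, y)"
        by (simp add: iter_kernel_eq)
    qed
    also have "\<dots> = (LINT \<eta>|lborel_on X. iter_kernel X n k (x, \<eta>) * k (\<eta>, y))"
      using sp by (intro F.product_integral_singleton[of "\<lambda>\<eta>. iter_kernel X n k (x, \<eta>) * k (\<eta>, y)"]) measurable
    finally show ?case by (simp add: kcomp_def xy)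
  qed
qed

end

text \<open>Index \<open>n\<close> of \<open>iter_parts\<close> belongs to the kernel iterated \<open>n + 1\<close> times.\<close>

primrec iter_parts :: "'a::euclidean_space set \<Rightarrow> ('a \<times> 'a) parts \<Rightarrow> nat \<Rightarrow> ('a \<times> 'a) parts" where
  "iter_parts X G 0 = G"
| "iter_parts X G (Suc n) = (\<lambda>\<gamma>. kcomp (lborel_on X) (iter_parts X G n (left_index \<gamma>)) (G (right_index \<gamma>)))"

abbreviation (input) sq2 :: "'a::euclidean_space set \<Rightarrow> ('a \<times> 'a \<Rightarrow> complex) \<Rightarrow> bool"
  where "sq2 X \<equiv> sqint (lborel_on (X \<times> X))"

abbreviation (input) n2 :: "'a::euclidean_space set \<Rightarrow> ('a \<times> 'a \<Rightarrow> complex) \<Rightarrow> real"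
  where "n2 X \<equiv> l2norm (lborel_on (X \<times> X))"

lemma iter_parts_wfam:
  assumes o: "open X" and G: "wfam (X \<times> X) h G" and h: "sq2 X h"
  shows "wfam (X \<times> X) (iter_kernel X (Suc n) h) (iter_parts X G n)"
proof (induction n)
  case 0
  then show ?case using G by (simp add: iter_kernel_1[OF o])
next
  case (Suc n)
  note h' = h[unfolded lborel_on_Times[OF o o]]
  note m = iter_kernel_measurable[OF o sqint_measurable[OF h'], folded lborel_on_Times[OF o o]]
  have "AE z in lborel_on (X \<times> X). kcomp (lborel_on X) (iter_kernel X (Suc n) h) h z = iter_kernel X (Suc (Suc n)) h z"
    using iter_kernel_Suc[OF o h', of "Suc n"] unfolding lborel_on_Times[OF o o] by (simp add: eq_commute)
  then show ?case
    using wfam_cong_AE[OF wfam_kcomp[OF o o o Suc G m sqint_measurable[OF h]]] by simp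
qed

lemma iter_parts_sqint:
  assumes "open X" "wfam (X \<times> X) h G" "sq2 X h"
  shows "sq2 X (iter_parts X G n \<gamma>)"
  by (rule wfamD(1)[OF iter_parts_wfam[OF assms]])

text \<open>Any index set closed under splitting will do. It is taken as
  \<open>multi_indices m\<close> for Sobolev norms, and as the finite orbit of a single index for
  convergence of the series.\<close>

lemma iter_parts_bound:
  assumes o: "open X" and G: "wfam (X \<times> X) h G" and h: "sq2 X h"
    and I: "\<And>\<gamma>. \<gamma> \<in> I \<Longrightarrow> left_index \<gamma> \<in> I \<and> right_index \<gamma> \<in> I"
    and B: "\<And>\<gamma>. \<gamma> \<in> I \<Longrightarrow> n2 X (G \<gamma>) \<le> B" and "\<gamma> \<in> I"
  shows "n2 X (iter_parts X G n \<gamma>) \<le> B ^ Suc n"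
  using assms(6)
proof (induction n arbitrary: \<gamma>)
  case 0
  then show ?case by (simp add: B)
next
  case (Suc n)
  interpret T: triple_sigma_finite "lborel_on X" "lborel_on X" "lborel_on X" using o o o by (rule triple_lborel_on)
  have "n2 X (iter_parts X G (Suc n) \<gamma>)
     \<le> n2 X (iter_parts X G n (left_index \<gamma>)) * n2 X (G (right_index \<gamma>))"
    using T.l2norm_kcomp[OF iter_parts_sqint[OF o G h, unfolded lborel_on_Times[OF o o]] wfamD(1)[OF G, unfolded lborel_on_Times[OF o o]]]
    unfolding lborel_on_Times[OF o o] by simp
  also have "\<dots> \<le> B ^ Suc n * B"
    using I[OF Suc.prems] order_trans[OF l2norm_nonneg B[OF Suc.prems]]
    by (intro mult_mono Suc.IH B) auto
  finally show ?case by (simp add: mult.commute)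
qed

text \<open>Telescoping over the n + 1 factors; in the induction step the last factor contributes
  B^(n+1) \<delta> and the others (n+1) B^n \<delta> times B.\<close>

lemma iter_parts_diff_bound:
  assumes o: "open X" and G: "wfam (X \<times> X) h G" and h: "sq2 X h"
    and G': "wfam (X \<times> X) h' G'" and h': "sq2 X h'"
    and I: "\<And>\<gamma>. \<gamma> \<in> I \<Longrightarrow> left_index \<gamma> \<in> I \<and> right_index \<gamma> \<in> I"
    and B: "\<And>\<gamma>. \<gamma> \<in> I \<Longrightarrow> n2 X (G \<gamma>) \<le> B" "\<And>\<gamma>. \<gamma> \<in> I \<Longrightarrow> n2 X (G' \<gamma>) \<le> B"
    and \<delta>: "\<And>\<gamma>. \<gamma> \<in> I \<Longrightarrow> n2 X (\<lambda>z. G \<gamma> z - G' \<gamma> z) \<le> \<delta>" and "\<gamma> \<in> I"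
  shows "n2 X (\<lambda>z. iter_parts X G n \<gamma> z - iter_parts X G' n \<gamma> z) \<le> real (Suc n) * B ^ n * \<delta>"
  using assms(10)
proof (induction n arbitrary: \<gamma>)
  case 0
  then show ?case by (simp add: \<delta>)
next
  case (Suc n)
  interpret T: triple_sigma_finite "lborel_on X" "lborel_on X" "lborel_on X" using o o o by (rule triple_lborel_on)
  let ?N = "n2 X"
  have B0: "0 \<le> B" and \<delta>0: "0 \<le> \<delta>"
    using order_trans[OF l2norm_nonneg B(1)[OF Suc.prems]] order_trans[OF l2norm_nonneg \<delta>[OF Suc.prems]] by auto
  have "?N (\<lambda>z. iter_parts X G (Suc n) \<gamma> z - iter_parts X G' (Suc n) \<gamma> z)
     \<le> ?N (\<lambda>z. iter_parts X G n (left_index \<gamma>) z - iter_parts X G' n (left_index \<gamma>) z) * ?N (G (right_index \<gamma>))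
       + ?N (iter_parts X G' n (left_index \<gamma>)) * ?N (\<lambda>z. G (right_index \<gamma>) z - G' (right_index \<gamma>) z)"
    using T.kcomp_diff_norm_le[OF iter_parts_sqint[OF o G h, unfolded lborel_on_Times[OF o o]]
        iter_parts_sqint[OF o G' h', unfolded lborel_on_Times[OF o o]]
        wfamD(1)[OF G, unfolded lborel_on_Times[OF o o]] wfamD(1)[OF G', unfolded lborel_on_Times[OF o o]]]
    unfolding lborel_on_Times[OF o o] by simp
  also have "\<dots> \<le> (real (Suc n) * B ^ n * \<delta>) * B + B ^ Suc n * \<delta>"
    using I[OF Suc.prems] B0 \<delta>0
    by (intro add_mono mult_mono Suc.IH B \<delta> iter_parts_bound[OF o G' h' I B(2)]) auto
  also have "\<dots> = real (Suc (Suc n)) * B ^ Suc n * \<delta>" by (simp add: algebra_simps)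
  finally show ?case .
qed

subsection \<open>The exponential series\<close>

lemma exp_partial_sum_le:
  assumes "0 \<le> (B::real)"
  shows "(\<Sum>n<N. B ^ n / fact n) \<le> exp B" "(\<Sum>n<N. B ^ Suc n / fact (Suc n)) \<le> exp B"
proof -
  have sums: "(\<lambda>n. B ^ n / fact n) sums exp B"
    using exp_converges[of B] by (simp add: scaleR_conv_of_real divide_inverse mult.commute)
  have le: "(\<Sum>n\<in>A. B ^ n / fact n) \<le> exp B" if "finite A" for A
    using sum_le_suminf[OF sums_summable[OF sums] that] sums_unique[OF sums] assms by simp
  show "(\<Sum>n<N. B ^ n / fact n) \<le> exp B" by (rule le) simp
  have "(\<Sum>n<N. B ^ Suc n / fact (Suc n)) = (\<Sum>n\<in>Suc ` {..<N}. B ^ n / fact n)"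
    by (subst sum.reindex) auto
  then show "(\<Sum>n<N. B ^ Suc n / fact (Suc n)) \<le> exp B" using le[of "Suc ` {..<N}"] by simp
qed

lemma summable_exp_Suc: "summable (\<lambda>n. (B::real) ^ Suc n / fact (Suc n))"
proof -
  have "summable (\<lambda>n. B ^ n / fact n)"
    using summable_exp[of B] by (simp add: divide_inverse mult.commute)
  then show ?thesis using summable_Suc_iff[of "\<lambda>n. B ^ n / fact n"] by blast
qed

abbreviation (input) exp_term :: "'a::euclidean_space set \<Rightarrow> ('a \<times> 'a) parts
    \<Rightarrow> ('a \<times> 'a \<Rightarrow> nat) \<Rightarrow> nat \<Rightarrow> 'a \<times> 'a \<Rightarrow> complex"
  where "exp_term X G \<gamma> n \<equiv> \<lambda>z. iter_parts X G n \<gamma> z / fact (Suc n)"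

lemma iter_parts_series:
  assumes o: "open X" and G: "wfam (X \<times> X) h G" and h: "sq2 X h"
  shows "\<exists>s. sq2 X s \<and>
    (\<lambda>N. n2 X (\<lambda>z. (\<Sum>n<N. exp_term X G \<gamma> n z) - s z)) \<longlonglongrightarrow> 0"
proof (rule Riesz_Fischer_series)
  show "sq2 X (exp_term X G \<gamma> n)" for n
    by (intro sqint_divide iter_parts_sqint[OF o G h])
  let ?N = "n2 X"
  \<comment> \<open>The orbit of \<gamma> under splitting: splitting twice yields the same part or
    0. It exists for every \<gamma>, also for those not supported on the basis.\<close>
  define I where "I = {\<gamma>, left_index \<gamma>, right_index \<gamma>, \<lambda>_. 0}"
  define B where "B = (\<Sum>\<gamma>\<in>I. ?N (G \<gamma>))"
  have I: "left_index \<alpha> \<in> I \<and> right_index \<alpha> \<in> I" if "\<alpha> \<in> I" for \<alpha>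
  proof -
    have "left_index (left_index \<gamma>) = left_index \<gamma>" "right_index (left_index \<gamma>) = (\<lambda>_. 0)"
      "left_index (right_index \<gamma>) = (\<lambda>_. 0)" "right_index (right_index \<gamma>) = right_index \<gamma>"
      by (auto simp: left_index_def right_index_def)
    then show ?thesis using that unfolding I_def by auto
  qed
  have B: "?N (G \<alpha>) \<le> B" if "\<alpha> \<in> I" for \<alpha>
    unfolding B_def by (rule member_le_sum) (use that in \<open>auto simp: I_def\<close>)
  have "?N (iter_parts X G n \<gamma>) \<le> B ^ Suc n" for n
    by (rule iter_parts_bound[OF o G h I B]) (auto simp: I_def)
  then show "summable (\<lambda>n. ?N (exp_term X G \<gamma> n))"
    by (intro summable_comparison_test'[OF summable_exp_Suc[of B], of 0])
       (simp add: l2norm_divide divide_right_mono norm_fact del: fact_Suc power_Suc)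
qed

text \<open>The limits are chosen independently for each \<gamma>; that they form a family follows
  afterwards from closedness of weak derivatives.\<close>

definition exp_parts :: "'a::euclidean_space set \<Rightarrow> ('a \<times> 'a) parts \<Rightarrow> ('a \<times> 'a) parts"
  where "exp_parts X G \<gamma> = (SOME s. sq2 X s \<and>
    (\<lambda>N. n2 X (\<lambda>z. (\<Sum>n<N. exp_term X G \<gamma> n z) - s z)) \<longlonglongrightarrow> 0)"

lemma
  assumes "open X" "wfam (X \<times> X) h G" "sq2 X h"
  shows exp_parts_sqint: "sq2 X (exp_parts X G \<gamma>)"
    and exp_parts_limit: "(\<lambda>N. n2 X (\<lambda>z. (\<Sum>n<N. exp_term X G \<gamma> n z) - exp_parts X G \<gamma> z)) \<longlonglongrightarrow> 0"
  using someI_ex[OF iter_parts_series[OF assms]] unfolding exp_parts_def by auto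

lemma L2_sums_iff:
  "L2_sums \<Omega> f s \<longleftrightarrow> (\<forall>n. sqint (lborel_on \<Omega>) (f (Suc n))) \<and> sqint (lborel_on \<Omega>) s \<and>
     (\<lambda>N. l2norm (lborel_on \<Omega>) (\<lambda>x. (\<Sum>n<N. f (Suc n) x) - s x)) \<longlonglongrightarrow> 0"
proof -
  have "(\<Sum>n=1..N. f n x) = (\<Sum>n<N. f (Suc n) x)" for N x
    using sum.shift_bounds_cl_Suc_ivl[of "\<lambda>n. f n x" 0 "N - 1"]
    by (cases N) (simp_all add: lessThan_Suc_atMost atMost_atLeast0)
  moreover have "(\<forall>n\<ge>1. sqint (lborel_on \<Omega>) (f n)) \<longleftrightarrow> (\<forall>n. sqint (lborel_on \<Omega>) (f (Suc n)))"
    by (metis One_nat_def Suc_le_D le_add1 plus_1_eq_Suc)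
  ultimately show ?thesis unfolding L2_sums_def L2_space_iff L2_norm_on_eq by simp
qed

lemma iter_kernel_sqint:
  assumes o: "open X" and G: "wfam (X \<times> X) h G" and h: "sq2 X h"
  shows "sq2 X (iter_kernel X (Suc n) h)"
proof -
  note wf = iter_parts_wfam[OF o G h]
  have "iter_kernel X (Suc n) h \<in> borel_measurable (lborel_on (X \<times> X))"
    using iter_kernel_measurable[OF o sqint_measurable[OF h[unfolded lborel_on_Times[OF o o]]]]
    unfolding lborel_on_Times[OF o o] .
  then show ?thesis by (rule sqint_cong_AE[OF wfamD(2)[OF wf] wfamD(1)[OF wf]])
qed

lemma exp_parts_L2_sums:
  assumes o: "open X" and G: "wfam (X \<times> X) h G" and h: "sq2 X h"
  shows "L2_sums (X \<times> X) (\<lambda>n z. iter_kernel X n h z / fact n) (exp_parts X G (\<lambda>_. 0))"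
proof -
  let ?M = "lborel_on (X \<times> X)"
  \<comment> \<open>Countably many terms share one null set.\<close>
  have "AE z in ?M. \<forall>n. iter_parts X G n (\<lambda>_. 0) z = iter_kernel X (Suc n) h z"
    unfolding AE_all_countable using wfamD(2)[OF iter_parts_wfam[OF o G h]] by blast
  then have AE: "AE z in ?M. (\<Sum>n<N. exp_term X G (\<lambda>_. 0) n z) - exp_parts X G (\<lambda>_. 0) z
      = (\<Sum>n<N. iter_kernel X (Suc n) h z / fact (Suc n)) - exp_parts X G (\<lambda>_. 0) z" for N
    by eventually_elim simp
  have "l2norm ?M (\<lambda>z. (\<Sum>n<N. exp_term X G (\<lambda>_. 0) n z) - exp_parts X G (\<lambda>_. 0) z)
      = l2norm ?M (\<lambda>z. (\<Sum>n<N. iter_kernel X (Suc n) h z / fact (Suc n)) - exp_parts X G (\<lambda>_. 0) z)" for N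
    by (rule l2norm_cong_AE[OF AE]; intro sqint_measurable sqint_diff sqint_sum sqint_divide
        iter_parts_sqint[OF o G h] iter_kernel_sqint[OF o G h] exp_parts_sqint[OF o G h])
  then show ?thesis
    unfolding L2_sums_iff
    using exp_parts_limit[OF o G h, of "\<lambda>_. 0"] exp_parts_sqint[OF o G h]
      sqint_divide[OF iter_kernel_sqint[OF o G h]] by simp
qed

text \<open>S is any sum of the series, not a particular one: L2 limits agree almost everywhere, and
  \<open>wfam\<close> ignores null sets.\<close>

lemma exp_parts_wfam:
  assumes o: "open X" and G: "wfam (X \<times> X) h G" and h: "sq2 X h"
    and S: "L2_sums (X \<times> X) (\<lambda>n z. iter_kernel X n h z / fact n) S"
  shows "wfam (X \<times> X) S (exp_parts X G)"
proof -
  let ?M = "lborel_on (X \<times> X)"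
  have o': "open (X \<times> X)" using o by (intro open_Times)
  have "AE z in ?M. exp_parts X G (\<lambda>_. 0) z = S z"
    using S exp_parts_L2_sums[OF o G h] unfolding L2_sums_iff
    by (intro l2_limit_unique[where f = "\<lambda>N z. \<Sum>n<N. iter_kernel X (Suc n) h z / fact (Suc n)"] sqint_sum) auto
  moreover have "wderiv (X \<times> X) b (exp_parts X G \<gamma>) (exp_parts X G (\<gamma>(b := Suc (\<gamma> b))))" if b: "b \<in> Basis" for b \<gamma>
  proof (rule wderiv_limit[OF o' b _ _ _ _ _ exp_parts_limit[OF o G h] exp_parts_limit[OF o G h]])
    fix N
    have "wderiv (X \<times> X) b (exp_term X G \<gamma> n) (exp_term X G (\<gamma>(b := Suc (\<gamma> b))) n)" for n
      using wderiv_cmult[OF wfamD(3)[OF iter_parts_wfam[OF o G h] b, of n \<gamma>], of "1 / fact (Suc n)"] by simp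
    then show "wderiv (X \<times> X) b (\<lambda>z. \<Sum>n<N. exp_term X G \<gamma> n z) (\<lambda>z. \<Sum>n<N. exp_term X G (\<gamma>(b := Suc (\<gamma> b))) n z)"
      by (intro wderiv_sum o' b sqint_divide iter_parts_sqint[OF o G h])
  qed (intro sqint_sum sqint_divide iter_parts_sqint[OF o G h] exp_parts_sqint[OF o G h])+
  ultimately show ?thesis unfolding wfam_def using exp_parts_sqint[OF o G h] by blast
qed

lemma exp_parts_bound:
  assumes o: "open X" and G: "wfam (X \<times> X) h G" and h: "sq2 X h"
    and I: "\<And>\<gamma>. \<gamma> \<in> I \<Longrightarrow> left_index \<gamma> \<in> I \<and> right_index \<gamma> \<in> I"
    and B: "\<And>\<gamma>. \<gamma> \<in> I \<Longrightarrow> n2 X (G \<gamma>) \<le> B" and \<gamma>: "\<gamma> \<in> I"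
  shows "n2 X (exp_parts X G \<gamma>) \<le> exp B"
proof (rule l2_limit_norm_le[OF _ exp_parts_sqint[OF o G h] exp_parts_limit[OF o G h]])
  fix N
  let ?N = "n2 X"
  have B0: "0 \<le> B" using order_trans[OF l2norm_nonneg B[OF \<gamma>]] .
  show "sq2 X (\<lambda>z. \<Sum>n<N. exp_term X G \<gamma> n z)"
    by (intro sqint_sum sqint_divide iter_parts_sqint[OF o G h])
  have "?N (\<lambda>z. \<Sum>n<N. exp_term X G \<gamma> n z) \<le> (\<Sum>n<N. ?N (exp_term X G \<gamma> n))"
    by (intro l2norm_sum_le sqint_divide iter_parts_sqint[OF o G h])
  also have "\<dots> \<le> (\<Sum>n<N. B ^ Suc n / fact (Suc n))"
    using iter_parts_bound[OF o G h I B \<gamma>]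
    by (intro sum_mono) (simp add: l2norm_divide divide_right_mono norm_fact del: fact_Suc power_Suc)
  also have "\<dots> \<le> exp B" by (rule exp_partial_sum_le(2)[OF B0])
  finally show "?N (\<lambda>z. \<Sum>n<N. exp_term X G \<gamma> n z) \<le> exp B" .
qed

lemma exp_parts_diff_bound:
  assumes o: "open X" and G: "wfam (X \<times> X) h G" and h: "sq2 X h"
    and G': "wfam (X \<times> X) h' G'" and h': "sq2 X h'"
    and I: "\<And>\<gamma>. \<gamma> \<in> I \<Longrightarrow> left_index \<gamma> \<in> I \<and> right_index \<gamma> \<in> I"
    and B: "\<And>\<gamma>. \<gamma> \<in> I \<Longrightarrow> n2 X (G \<gamma>) \<le> B" "\<And>\<gamma>. \<gamma> \<in> I \<Longrightarrow> n2 X (G' \<gamma>) \<le> B"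
    and \<delta>: "\<And>\<gamma>. \<gamma> \<in> I \<Longrightarrow> n2 X (\<lambda>z. G \<gamma> z - G' \<gamma> z) \<le> \<delta>" and \<gamma>: "\<gamma> \<in> I"
  shows "n2 X (\<lambda>z. exp_parts X G \<gamma> z - exp_parts X G' \<gamma> z) \<le> exp B * \<delta>"
proof (rule l2_limit_norm_le)
  let ?N = "n2 X"
  let ?s = "\<lambda>G N z. \<Sum>n<N. exp_term X G \<gamma> n z"
  let ?f = "\<lambda>N z. ?s G N z - ?s G' N z"
  have B0: "0 \<le> B" and \<delta>0: "0 \<le> \<delta>"
    using order_trans[OF l2norm_nonneg B(1)[OF \<gamma>]] order_trans[OF l2norm_nonneg \<delta>[OF \<gamma>]] .
  note sq = iter_parts_sqint[OF o G h] iter_parts_sqint[OF o G' h'] exp_parts_sqint[OF o G h] exp_parts_sqint[OF o G' h']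
  show "sq2 X (?f N)" for N
    by (intro sqint_diff sqint_sum sqint_divide sq)
  show "sq2 X (\<lambda>z. exp_parts X G \<gamma> z - exp_parts X G' \<gamma> z)"
    by (intro sqint_diff sq)
  show "(\<lambda>N. ?N (\<lambda>z. ?f N z - (exp_parts X G \<gamma> z - exp_parts X G' \<gamma> z))) \<longlonglongrightarrow> 0"
  proof (rule tendsto_sandwich[OF _ _ tendsto_const])
    show "(\<lambda>N. ?N (\<lambda>z. ?s G N z - exp_parts X G \<gamma> z) + ?N (\<lambda>z. ?s G' N z - exp_parts X G' \<gamma> z)) \<longlonglongrightarrow> 0"
      using tendsto_add[OF exp_parts_limit[OF o G h, of \<gamma>] exp_parts_limit[OF o G' h', of \<gamma>]] by simp
    have "?N (\<lambda>z. ?f N z - (exp_parts X G \<gamma> z - exp_parts X G' \<gamma> z))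
        \<le> ?N (\<lambda>z. ?s G N z - exp_parts X G \<gamma> z) + ?N (\<lambda>z. exp_parts X G' \<gamma> z - ?s G' N z)" for N
    proof -
      have eq: "(\<lambda>z. ?f N z - (exp_parts X G \<gamma> z - exp_parts X G' \<gamma> z))
          = (\<lambda>z. (?s G N z - exp_parts X G \<gamma> z) + (exp_parts X G' \<gamma> z - ?s G' N z))" by (simp add: fun_eq_iff)
      show ?thesis unfolding eq by (intro l2norm_triangle sqint_diff sqint_sum sqint_divide sq)
    qed
    then show "\<forall>\<^sub>F N in sequentially. ?N (\<lambda>z. ?f N z - (exp_parts X G \<gamma> z - exp_parts X G' \<gamma> z))
        \<le> ?N (\<lambda>z. ?s G N z - exp_parts X G \<gamma> z) + ?N (\<lambda>z. ?s G' N z - exp_parts X G' \<gamma> z)"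
      unfolding l2norm_minus_commute[of _ "exp_parts X G' \<gamma>"] by (intro always_eventually allI)
  qed simp
  fix N
  have eq: "?f N = (\<lambda>z. \<Sum>n<N. (iter_parts X G n \<gamma> z - iter_parts X G' n \<gamma> z) / fact (Suc n))"
    by (simp add: fun_eq_iff sum_subtractf diff_divide_distrib)
  have "?N (?f N) \<le> (\<Sum>n<N. ?N (\<lambda>z. (iter_parts X G n \<gamma> z - iter_parts X G' n \<gamma> z) / fact (Suc n)))"
    unfolding eq by (intro l2norm_sum_le sqint_divide sqint_diff sq)
  also have "\<dots> \<le> (\<Sum>n<N. B ^ n / fact n * \<delta>)"
  proof (rule sum_mono)
    fix n
    have "?N (\<lambda>z. (iter_parts X G n \<gamma> z - iter_parts X G' n \<gamma> z) / fact (Suc n))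
        \<le> (real (Suc n) * B ^ n * \<delta>) / fact (Suc n)"
      using iter_parts_diff_bound[OF o G h G' h' I B \<delta> \<gamma>, of n]
      by (simp add: l2norm_divide divide_right_mono norm_fact del: fact_Suc of_nat_Suc)
    \<comment> \<open>The factor n + 1 from telescoping cancels against (n+1)!, which leaves the
      exponential series itself.\<close>
    also have "\<dots> = B ^ n / fact n * \<delta>" by (simp add: fact_Suc field_simps del: of_nat_Suc)
    finally show "?N (\<lambda>z. (iter_parts X G n \<gamma> z - iter_parts X G' n \<gamma> z) / fact (Suc n)) \<le> B ^ n / fact n * \<delta>" .
  qed
  also have "\<dots> \<le> exp B * \<delta>"
    unfolding sum_distrib_right[symmetric] using exp_partial_sum_le(1)[OF B0] \<delta>0 by (rule mult_right_mono)
  finally show "?N (?f N) \<le> exp B * \<delta>" .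
qed

subsection \<open>Growth as \<open>\<epsilon> \<rightarrow> 0\<close>\<close>

definition modr :: "(real \<Rightarrow> real) \<Rightarrow> bool"
  where "modr f \<longleftrightarrow> (\<exists>n::nat. f \<in> O[at_right 0](\<lambda>\<epsilon>. 1 / \<epsilon> ^ n))"

definition neglr :: "(real \<Rightarrow> real) \<Rightarrow> bool"
  where "neglr f \<longleftrightarrow> (\<forall>n::nat. f \<in> O[at_right 0](\<lambda>\<epsilon>. \<epsilon> ^ n))"

lemma eventually_unit: "\<forall>\<^sub>F \<epsilon> in at_right (0::real). \<epsilon> \<in> {0<..1}"
  unfolding eventually_at_right_field by (intro exI[of _ 1]) auto

lemma bigo_mono_unit:
  fixes f g :: "real \<Rightarrow> real"
  assumes "\<And>\<epsilon>. \<epsilon> \<in> {0<..1} \<Longrightarrow> 0 \<le> f \<epsilon> \<and> f \<epsilon> \<le> g \<epsilon>"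
  shows "f \<in> O[at_right 0](g)"
proof (rule bigoI[of _ 1])
  show "\<forall>\<^sub>F \<epsilon> in at_right 0. norm (f \<epsilon>) \<le> 1 * norm (g \<epsilon>)"
    using eventually_unit by eventually_elim (use assms in force)
qed

lemma modr_mono:
  assumes "modr g" "\<And>\<epsilon>. 0 \<le> f \<epsilon>" "\<And>\<epsilon>. \<epsilon> \<in> {0<..1} \<Longrightarrow> f \<epsilon> \<le> g \<epsilon>"
  shows "modr f"
proof -
  have "f \<in> O[at_right 0](g)" by (rule bigo_mono_unit) (use assms(2,3) in blast)
  then show ?thesis using assms(1) landau_o.big_trans unfolding modr_def by blast
qed

lemma neglr_mono:
  assumes "neglr g" "\<And>\<epsilon>. 0 \<le> f \<epsilon>" "\<And>\<epsilon>. \<epsilon> \<in> {0<..1} \<Longrightarrow> f \<epsilon> \<le> g \<epsilon>"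
  shows "neglr f"
proof -
  have "f \<in> O[at_right 0](g)" by (rule bigo_mono_unit) (use assms(2,3) in blast)
  then show ?thesis using assms(1) landau_o.big_trans unfolding neglr_def by blast
qed

lemma modr_mult:
  assumes "modr f" "modr g"
  shows "modr (\<lambda>\<epsilon>. f \<epsilon> * g \<epsilon>)"
proof -
  obtain p q where "f \<in> O[at_right 0](\<lambda>\<epsilon>. 1 / \<epsilon> ^ p)" "g \<in> O[at_right 0](\<lambda>\<epsilon>. 1 / \<epsilon> ^ q)"
    using assms by (auto simp: modr_def)
  then have "(\<lambda>\<epsilon>. f \<epsilon> * g \<epsilon>) \<in> O[at_right 0](\<lambda>\<epsilon>. 1 / \<epsilon> ^ p * (1 / \<epsilon> ^ q))"
    by (rule landau_o.big.mult)
  then show ?thesis unfolding modr_def by (intro exI[of _ "p + q"]) (simp add: power_add)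
qed

lemma modr_const: "modr (\<lambda>_. c)"
  unfolding modr_def by (intro exI[of _ 0]) simp

lemma modr_power: "modr f \<Longrightarrow> modr (\<lambda>\<epsilon>. f \<epsilon> ^ n)"
  by (induction n) (auto intro: modr_const modr_mult)

lemma neglr_mult:
  assumes "modr f" "neglr g"
  shows "neglr (\<lambda>\<epsilon>. f \<epsilon> * g \<epsilon>)"
  unfolding neglr_def
proof
  fix n
  obtain p where p: "f \<in> O[at_right 0](\<lambda>\<epsilon>. 1 / \<epsilon> ^ p)" using assms by (auto simp: modr_def)
  \<comment> \<open>The additional order p compensates the pole of f.\<close>
  have "g \<in> O[at_right 0](\<lambda>\<epsilon>. \<epsilon> ^ (n + p))" using assms(2) unfolding neglr_def by blast
  with p have "(\<lambda>\<epsilon>. f \<epsilon> * g \<epsilon>) \<in> O[at_right 0](\<lambda>\<epsilon>. 1 / \<epsilon> ^ p * \<epsilon> ^ (n + p))"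
    by (rule landau_o.big.mult)
  also have "(\<lambda>\<epsilon>::real. 1 / \<epsilon> ^ p * \<epsilon> ^ (n + p)) \<in> O[at_right 0](\<lambda>\<epsilon>. \<epsilon> ^ n)"
    by (rule bigo_mono_unit) (auto simp: power_add)
  finally show "(\<lambda>\<epsilon>. f \<epsilon> * g \<epsilon>) \<in> O[at_right 0](\<lambda>\<epsilon>. \<epsilon> ^ n)" .
qed

lemma neglr_add: "neglr f \<Longrightarrow> neglr g \<Longrightarrow> neglr (\<lambda>\<epsilon>. f \<epsilon> + g \<epsilon>)"
  unfolding neglr_def by (auto intro: sum_in_bigo)

text \<open>e^(C |ln \<epsilon>|) equals \<epsilon>^(-C) on (0,1]; this is what ties logarithmic
  growth to moderateness of the exponential.\<close>

lemma modr_exp_log: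
  assumes "f \<in> O[at_right 0](\<lambda>\<epsilon>. \<bar>ln \<epsilon>\<bar>)"
  shows "modr (\<lambda>\<epsilon>. exp (f \<epsilon>))"
proof -
  obtain C where C: "C > 0" "\<forall>\<^sub>F \<epsilon> in at_right 0. norm (f \<epsilon>) \<le> C * norm \<bar>ln \<epsilon>\<bar>"
    using assms by (rule landau_o.bigE)
  \<comment> \<open>Moderateness asks for a natural exponent, so C is rounded up.\<close>
  obtain n :: nat where n: "C \<le> real n" using real_arch_simple by blast
  have "\<forall>\<^sub>F \<epsilon> in at_right 0. norm (exp (f \<epsilon>)) \<le> 1 * norm (1 / \<epsilon> ^ n)"
    using C(2) eventually_unit
  proof eventually_elim
    case (elim \<epsilon>)
    then have e: "0 < \<epsilon>" "\<epsilon> \<le> 1" by auto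
    then have l: "\<bar>ln \<epsilon>\<bar> = - ln \<epsilon>" by simp
    have "f \<epsilon> \<le> C * \<bar>ln \<epsilon>\<bar>" using elim(1) by simp
    also have "\<dots> \<le> real n * \<bar>ln \<epsilon>\<bar>" using n by (intro mult_right_mono) auto
    also have "\<dots> = - ln (\<epsilon> ^ n)" using e l by (simp add: ln_realpow)
    finally have "exp (f \<epsilon>) \<le> exp (- ln (\<epsilon> ^ n))" by simp
    also have "\<dots> = 1 / \<epsilon> ^ n" using e by (simp add: exp_minus inverse_eq_divide)
    finally show ?case using e by simp
  qed
  then show ?thesis unfolding modr_def by (intro exI[of _ n] bigoI)
qed

lemma modr_log:
  assumes "f \<in> O[at_right 0](\<lambda>\<epsilon>. \<bar>ln \<epsilon>\<bar>)" "\<And>\<epsilon>. 0 \<le> f \<epsilon>"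
  shows "modr f"
proof (rule modr_mono[OF modr_exp_log[OF assms(1)] assms(2)])
  fix \<epsilon> :: real
  show "f \<epsilon> \<le> exp (f \<epsilon>)" using exp_ge_add_one_self[of "f \<epsilon>"] by linarith
qed

subsection \<open>Nets\<close>

lemma moderate_iff: "u \<in> moderate_nets \<Omega> \<longleftrightarrow> u \<in> Sobolev_nets \<Omega> \<and> (\<forall>m. modr (\<lambda>\<epsilon>. Sobolev_norm \<Omega> m (u \<epsilon>)))"
  by (simp add: moderate_nets_def modr_def)

lemma negligible_iff: "u \<in> negligible_nets \<Omega> \<longleftrightarrow> u \<in> Sobolev_nets \<Omega> \<and> (\<forall>m. neglr (\<lambda>\<epsilon>. Sobolev_norm \<Omega> m (u \<epsilon>)))"
  by (simp add: negligible_nets_def neglr_def)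

lemma log_nets_moderate: "u \<in> log_nets \<Omega> \<Longrightarrow> u \<in> moderate_nets \<Omega>"
  unfolding moderate_iff log_nets_def by (auto intro: modr_log Sobolev_norm_nonneg)

lemma Sobolev_netsD: "u \<in> Sobolev_nets \<Omega> \<Longrightarrow> \<epsilon> \<in> {0<..1} \<Longrightarrow> u \<epsilon> \<in> Sobolev_inf \<Omega>"
  by (simp add: Sobolev_nets_def)

lemma Sobolev_inf_measurable: "f \<in> Sobolev_inf \<Omega> \<Longrightarrow> f \<in> borel_measurable (lborel_on \<Omega>)"
  by (rule sqint_measurable[OF Sobolev_inf_sqint])

lemma wparts_le_Sobolev_norm:
  assumes "open \<Omega>" "f \<in> Sobolev_inf \<Omega>" "\<alpha> \<in> multi_indices m"
  shows "l2norm (lborel_on \<Omega>) (wparts \<Omega> f \<alpha>) \<le> Sobolev_norm \<Omega> m f"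
  by (rule l2norm_le_Sobolev_norm[OF assms(1) Sobolev_inf_wfam[OF assms(1,2)] Sobolev_inf_measurable[OF assms(2)] assms(3)])

lemma l2norm_le_Sobolev_norm_self:
  assumes "open \<Omega>" "f \<in> Sobolev_inf \<Omega>"
  shows "l2norm (lborel_on \<Omega>) f \<le> Sobolev_norm \<Omega> m f"
proof -
  note w = Sobolev_inf_wfam[OF assms]
  have "l2norm (lborel_on \<Omega>) (wparts \<Omega> f (\<lambda>_. 0)) = l2norm (lborel_on \<Omega>) f"
    by (rule l2norm_cong_AE[OF wfamD(2)[OF w] sqint_measurable[OF wfamD(1)[OF w]] Sobolev_inf_measurable[OF assms(2)]])
  then show ?thesis using wparts_le_Sobolev_norm[OF assms, of "\<lambda>_. 0" m] by simp
qed

lemma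
  assumes o: "open \<Omega>" and f: "f \<in> Sobolev_inf \<Omega>" and g: "g \<in> Sobolev_inf \<Omega>"
  shows Sobolev_inf_diff: "(\<lambda>x. f x - g x) \<in> Sobolev_inf \<Omega>"
    and wparts_diff_le: "\<alpha> \<in> multi_indices m \<Longrightarrow>
       l2norm (lborel_on \<Omega>) (\<lambda>x. wparts \<Omega> f \<alpha> x - wparts \<Omega> g \<alpha> x) \<le> Sobolev_norm \<Omega> m (\<lambda>x. f x - g x)"
    and Sobolev_norm_diff_le: "Sobolev_norm \<Omega> m (\<lambda>x. f x - g x) \<le> Sobolev_norm \<Omega> m f + Sobolev_norm \<Omega> m g"
proof -
  note wf = Sobolev_inf_wfam[OF o f] and wg = Sobolev_inf_wfam[OF o g]
  note w = wfam_diff[OF o wf wg]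
  have m: "(\<lambda>x. f x - g x) \<in> borel_measurable (lborel_on \<Omega>)"
    using Sobolev_inf_measurable[OF f] Sobolev_inf_measurable[OF g] by simp
  show "(\<lambda>x. f x - g x) \<in> Sobolev_inf \<Omega>" by (rule wfam_Sobolev_inf[OF o w m])
  show "\<alpha> \<in> multi_indices m \<Longrightarrow>
       l2norm (lborel_on \<Omega>) (\<lambda>x. wparts \<Omega> f \<alpha> x - wparts \<Omega> g \<alpha> x) \<le> Sobolev_norm \<Omega> m (\<lambda>x. f x - g x)"
    by (rule l2norm_le_Sobolev_norm[OF o w m])
  have "l2norm (lborel_on \<Omega>) (\<lambda>x. wparts \<Omega> f \<alpha> x - wparts \<Omega> g \<alpha> x)
      \<le> l2norm (lborel_on \<Omega>) (wparts \<Omega> f \<alpha>) + l2norm (lborel_on \<Omega>) (wparts \<Omega> g \<alpha>)" for \<alpha>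
    using l2norm_triangle[OF wfamD(1)[OF wf, of \<alpha>] sqint_cmult[OF wfamD(1)[OF wg, of \<alpha>], of "-1"]]
    unfolding l2norm_cmult by simp
  then show "Sobolev_norm \<Omega> m (\<lambda>x. f x - g x) \<le> Sobolev_norm \<Omega> m f + Sobolev_norm \<Omega> m g"
    unfolding Sobolev_norm_wfam[OF o w m] Sobolev_norm_wfam[OF o wf Sobolev_inf_measurable[OF f]]
      Sobolev_norm_wfam[OF o wg Sobolev_inf_measurable[OF g]] sum.distrib[symmetric]
    by (intro sum_mono)
qed

lemma negligible_diff:
  assumes o: "open \<Omega>" and u: "u \<in> negligible_nets \<Omega>" and v: "v \<in> negligible_nets \<Omega>"
  shows "(\<lambda>\<epsilon> x. u \<epsilon> x - v \<epsilon> x) \<in> negligible_nets \<Omega>"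
  unfolding negligible_iff
proof (intro conjI allI)
  have s: "u \<in> Sobolev_nets \<Omega>" "v \<in> Sobolev_nets \<Omega>" using u v by (auto simp: negligible_iff)
  show "(\<lambda>\<epsilon> x. u \<epsilon> x - v \<epsilon> x) \<in> Sobolev_nets \<Omega>"
    unfolding Sobolev_nets_def using Sobolev_inf_diff[OF o Sobolev_netsD[OF s(1)] Sobolev_netsD[OF s(2)]] by blast
  fix m
  show "neglr (\<lambda>\<epsilon>. Sobolev_norm \<Omega> m (\<lambda>x. u \<epsilon> x - v \<epsilon> x))"
  proof (rule neglr_mono[OF _ Sobolev_norm_nonneg])
    show "neglr (\<lambda>\<epsilon>. Sobolev_norm \<Omega> m (u \<epsilon>) + Sobolev_norm \<Omega> m (v \<epsilon>))"
      using u v by (intro neglr_add) (auto simp: negligible_iff)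
  qed (auto intro: Sobolev_norm_diff_le[OF o Sobolev_netsD[OF s(1)] Sobolev_netsD[OF s(2)]])
qed

text \<open>Turns identities that hold almost everywhere for each \<epsilon> into identities between
  classes; the zero family serves as the family of derivatives.\<close>

lemma negligible_AE_zero:
  assumes o: "open \<Omega>" and m: "\<And>\<epsilon>. \<epsilon> \<in> {0<..1} \<Longrightarrow> u \<epsilon> \<in> borel_measurable (lborel_on \<Omega>)"
    and z: "\<And>\<epsilon>. \<epsilon> \<in> {0<..1} \<Longrightarrow> AE x in lborel_on \<Omega>. u \<epsilon> x = 0"
  shows "u \<in> negligible_nets \<Omega>"
  unfolding negligible_iff
proof (intro conjI allI)
  have w: "wfam \<Omega> (u \<epsilon>) (\<lambda>\<gamma> x. 0)" if "\<epsilon> \<in> {0<..1}" for \<epsilon>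
  proof (rule wfam_cong_AE[OF wfam_zero])
    show "AE x in lborel_on \<Omega>. 0 = u \<epsilon> x" using z[OF that] by eventually_elim simp
  qed
  show "u \<in> Sobolev_nets \<Omega>"
    unfolding Sobolev_nets_def using wfam_Sobolev_inf[OF o w m] by blast
  fix k
  show "neglr (\<lambda>\<epsilon>. Sobolev_norm \<Omega> k (u \<epsilon>))"
  proof (rule neglr_mono[OF _ Sobolev_norm_nonneg])
    show "neglr (\<lambda>_. 0)" by (simp add: neglr_def)
    show "Sobolev_norm \<Omega> k (u \<epsilon>) \<le> 0" if "\<epsilon> \<in> {0<..1}" for \<epsilon>
      using Sobolev_norm_wfam[OF o w m] that by simp
  qed
qed

section \<open>Equivalence classes of nets\<close>

lemma Cl_eq:
  assumes o: "open \<Omega>" and u: "u \<in> moderate_nets \<Omega>" and v: "v \<in> moderate_nets \<Omega>"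
    and d: "(\<lambda>\<epsilon> x. u \<epsilon> x - v \<epsilon> x) \<in> negligible_nets \<Omega>"
  shows "Cl \<Omega> u = Cl \<Omega> v"
proof -
  have sub: "Cl \<Omega> u \<subseteq> Cl \<Omega> v" if "v \<in> moderate_nets \<Omega>" "(\<lambda>\<epsilon> x. u \<epsilon> x - v \<epsilon> x) \<in> negligible_nets \<Omega>" for u v
  proof
    fix w assume "w \<in> Cl \<Omega> u"
    then have w: "w \<in> moderate_nets \<Omega>" "(\<lambda>\<epsilon> x. u \<epsilon> x - w \<epsilon> x) \<in> negligible_nets \<Omega>"
      by (auto simp: Cl_def net_rel_def)
    have "(\<lambda>\<epsilon> x. v \<epsilon> x - w \<epsilon> x) \<in> negligible_nets \<Omega>"
      using negligible_diff[OF o w(2) that(2)] by simp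
    then show "w \<in> Cl \<Omega> v" using w that by (simp add: Cl_def net_rel_def)
  qed
  have "(\<lambda>\<epsilon> x. 0 :: complex) \<in> negligible_nets \<Omega>" by (rule negligible_AE_zero[OF o]) auto
  from negligible_diff[OF o this d] have "(\<lambda>\<epsilon> x. v \<epsilon> x - u \<epsilon> x) \<in> negligible_nets \<Omega>" by simp
  then show ?thesis using sub u v d by blast
qed

lemma self_in_Cl:
  assumes "open \<Omega>" "u \<in> moderate_nets \<Omega>"
  shows "u \<in> Cl \<Omega> u"
  using assms negligible_AE_zero[OF assms(1), of "\<lambda>\<epsilon> x. 0"] by (simp add: Cl_def net_rel_def)

lemma Cl_in_G_L2: "u \<in> moderate_nets \<Omega> \<Longrightarrow> Cl \<Omega> u \<in> G_L2 \<Omega>"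
  unfolding Cl_def G_L2_def by (rule quotientI)

text \<open>What well-definedness of the operators uses of an equivalence class. It covers elements
  of \<open>G_L2\<close> and of \<open>G_L2_ln\<close> alike.\<close>

definition net_class :: "'a::euclidean_space set \<Rightarrow> 'a net set \<Rightarrow> bool"
  where "net_class \<Omega> F \<longleftrightarrow> F \<noteq> {} \<and> F \<subseteq> moderate_nets \<Omega> \<and>
     (\<forall>u\<in>F. \<forall>v\<in>F. (\<lambda>\<epsilon> x. u \<epsilon> x - v \<epsilon> x) \<in> negligible_nets \<Omega>)"

lemma net_class_quotient:
  assumes o: "open \<Omega>" and F: "F \<in> A // net_rel \<Omega> A" and A: "A \<subseteq> moderate_nets \<Omega>"
  shows "net_class \<Omega> F \<and> F \<subseteq> A"
proof -
  obtain w where w: "w \<in> A" "F = net_rel \<Omega> A `` {w}" using F by (rule quotientE)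
  have mem: "u \<in> F \<longleftrightarrow> u \<in> A \<and> (\<lambda>\<epsilon> x. w \<epsilon> x - u \<epsilon> x) \<in> negligible_nets \<Omega>" for u
    unfolding w(2) using w(1) by (simp add: net_rel_def)
  have "w \<in> F" unfolding mem using w(1) negligible_AE_zero[OF o, of "\<lambda>\<epsilon> x. 0"] by simp
  moreover have "(\<lambda>\<epsilon> x. u \<epsilon> x - v \<epsilon> x) \<in> negligible_nets \<Omega>" if "u \<in> F" "v \<in> F" for u v
    using negligible_diff[OF o, of "\<lambda>\<epsilon> x. w \<epsilon> x - v \<epsilon> x" "\<lambda>\<epsilon> x. w \<epsilon> x - u \<epsilon> x"] that mem by simp
  moreover have "F \<subseteq> A" using mem by blast
  ultimately show ?thesis unfolding net_class_def using A by blast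
qed

lemma net_class_G_L2: "open \<Omega> \<Longrightarrow> F \<in> G_L2 \<Omega> \<Longrightarrow> net_class \<Omega> F"
  using net_class_quotient[of \<Omega> F "moderate_nets \<Omega>"] by (simp add: G_L2_def)

subsection \<open>Generalized integral operators and the exponential\<close>

context
  fixes X :: "'a::euclidean_space set"
  assumes openX: "open X"
begin

abbreviation (input) XX where "XX \<equiv> X \<times> X"

abbreviation (input) K :: "('a \<times> 'a \<Rightarrow> complex) \<Rightarrow> ('a \<Rightarrow> complex) \<Rightarrow> 'a \<Rightarrow> complex"
  where "K \<equiv> kapp (lborel_on X)"

lemma openXX: "open XX"
  by (intro open_Times openX)

lemmas lborel_on_XX = lborel_on_Times[OF openX openX]

interpretation A: sigma_finite_measure "lborel_on X"
  by (rule sigma_finite_lborel_on[OF openX])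

interpretation P: pair_sigma_finite "lborel_on X" "lborel_on X" ..

interpretation T: triple_sigma_finite "lborel_on X" "lborel_on X" "lborel_on X" ..

lemma
  assumes h: "h \<in> Sobolev_inf XX" and f: "f \<in> Sobolev_inf X"
  shows kapp_Sobolev_inf: "K h f \<in> Sobolev_inf X"
    and kapp_wfam: "wfam X (K h f) (\<lambda>\<gamma>. K (wparts XX h (lift_index \<gamma>)) f)"
    and kapp_Sobolev_measurable: "K h f \<in> borel_measurable (lborel_on X)"
proof -
  show w: "wfam X (K h f) (\<lambda>\<gamma>. K (wparts XX h (lift_index \<gamma>)) f)"
    by (rule wfam_kapp[OF openX openX Sobolev_inf_wfam[OF openXX h] Sobolev_inf_sqint[OF f] Sobolev_inf_measurable[OF h]])
  show m: "K h f \<in> borel_measurable (lborel_on X)"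
    using Sobolev_inf_measurable[OF h] Sobolev_inf_measurable[OF f]
    unfolding lborel_on_XX by (rule P.kapp_measurable)
  show "K h f \<in> Sobolev_inf X" by (rule wfam_Sobolev_inf[OF openX w m])
qed

text \<open>The derivatives fall on the kernels alone; f and f - f' enter through their L2 norms,
  which their Sobolev norms dominate.\<close>

lemma kapp_diff_Sobolev_norm:
  assumes h: "h \<in> Sobolev_inf XX" "h' \<in> Sobolev_inf XX" and f: "f \<in> Sobolev_inf X" "f' \<in> Sobolev_inf X"
  shows "Sobolev_norm X m (\<lambda>x. K h f x - K h' f' x)
    \<le> num_indices X m * (Sobolev_norm XX m (\<lambda>z. h z - h' z) * Sobolev_norm X m f
         + Sobolev_norm XX m h' * Sobolev_norm X m (\<lambda>x. f x - f' x))" (is "_ \<le> _ * ?C")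
proof (rule Sobolev_norm_le[OF openX wfam_diff[OF openX kapp_wfam[OF h(1) f(1)] kapp_wfam[OF h(2) f(2)]]])
  show "(\<lambda>x. K h f x - K h' f' x) \<in> borel_measurable (lborel_on X)"
    using kapp_Sobolev_measurable[OF h(1) f(1)] kapp_Sobolev_measurable[OF h(2) f(2)] by simp
  fix \<alpha> :: "'a \<Rightarrow> nat" assume \<alpha>: "\<alpha> \<in> multi_indices m"
  let ?N = "l2norm (lborel_on XX)" and ?w = "wparts XX"
  note mi = lift_index_multi[OF \<alpha>, where 'b = 'a]
  note sq = wfamD(1)[OF Sobolev_inf_wfam[OF openXX h(1)]] wfamD(1)[OF Sobolev_inf_wfam[OF openXX h(2)]]
  let ?D = "\<lambda>x. K (?w h (lift_index \<alpha>)) f x - K (?w h' (lift_index \<alpha>)) f' x"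
  have "l2norm (lborel_on X) ?D \<le> ?N (\<lambda>z. ?w h (lift_index \<alpha>) z - ?w h' (lift_index \<alpha>) z) * l2norm (lborel_on X) f
       + ?N (?w h' (lift_index \<alpha>)) * l2norm (lborel_on X) (\<lambda>y. f y - f' y)"
    using P.kapp_diff_norm_le[OF sq[unfolded lborel_on_XX] Sobolev_inf_sqint[OF f(1)] Sobolev_inf_sqint[OF f(2)]]
    unfolding lborel_on_XX .
  also have "\<dots> \<le> ?C"
    by (intro add_mono mult_mono wparts_diff_le[OF openXX h mi] wparts_le_Sobolev_norm[OF openXX h(2) mi]
        l2norm_le_Sobolev_norm_self openX f Sobolev_inf_diff Sobolev_norm_nonneg l2norm_nonneg)
  finally show "l2norm (lborel_on X) ?D \<le> ?C" .
qed

text \<open>The difference estimate with h' and f' equal to 0.\<close>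

lemma kapp_Sobolev_norm:
  assumes h: "h \<in> Sobolev_inf XX" and f: "f \<in> Sobolev_inf X"
  shows "Sobolev_norm X m (K h f) \<le> num_indices X m * (Sobolev_norm XX m h * Sobolev_norm X m f)"
proof -
  have z: "(\<lambda>z. 0) \<in> Sobolev_inf XX" "(\<lambda>x. 0) \<in> Sobolev_inf X" "Sobolev_norm XX m (\<lambda>z. 0) = 0"
    using wfam_Sobolev_inf[OF openXX wfam_zero] wfam_Sobolev_inf[OF openX wfam_zero] Sobolev_norm_wfam[OF openXX wfam_zero]
    by auto
  show ?thesis using kapp_diff_Sobolev_norm[OF h z(1) f z(2), of m] z(3) by (simp add: kapp_def)
qed

lemma kapp_moderate:
  assumes h: "h \<in> moderate_nets XX" and f: "f \<in> moderate_nets X"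
  shows "(\<lambda>\<epsilon>. K (h \<epsilon>) (f \<epsilon>)) \<in> moderate_nets X"
  unfolding moderate_iff
proof (intro conjI allI)
  have s: "h \<in> Sobolev_nets XX" "f \<in> Sobolev_nets X" using h f by (auto simp: moderate_iff)
  show "(\<lambda>\<epsilon>. K (h \<epsilon>) (f \<epsilon>)) \<in> Sobolev_nets X"
    unfolding Sobolev_nets_def using kapp_Sobolev_inf Sobolev_netsD[OF s(1)] Sobolev_netsD[OF s(2)] by blast
  fix m
  show "modr (\<lambda>\<epsilon>. Sobolev_norm X m (K (h \<epsilon>) (f \<epsilon>)))"
  proof (rule modr_mono[OF _ Sobolev_norm_nonneg])
    show "modr (\<lambda>\<epsilon>. num_indices X m * (Sobolev_norm XX m (h \<epsilon>) * Sobolev_norm X m (f \<epsilon>)))"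
      using h f by (intro modr_mult modr_const) (auto simp: moderate_iff)
  qed (auto intro: kapp_Sobolev_norm[OF Sobolev_netsD[OF s(1)] Sobolev_netsD[OF s(2)]])
qed

lemma kapp_diff_negligible:
  assumes h: "h \<in> moderate_nets XX" "h' \<in> moderate_nets XX" and f: "f \<in> moderate_nets X" "f' \<in> moderate_nets X"
    and d: "(\<lambda>\<epsilon> z. h \<epsilon> z - h' \<epsilon> z) \<in> negligible_nets XX" "(\<lambda>\<epsilon> x. f \<epsilon> x - f' \<epsilon> x) \<in> negligible_nets X"
  shows "(\<lambda>\<epsilon> x. K (h \<epsilon>) (f \<epsilon>) x - K (h' \<epsilon>) (f' \<epsilon>) x) \<in> negligible_nets X"
  unfolding negligible_iff
proof (intro conjI allI)
  have s: "h \<in> Sobolev_nets XX" "f \<in> Sobolev_nets X" "h' \<in> Sobolev_nets XX" "f' \<in> Sobolev_nets X"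
    using h f by (auto simp: moderate_iff)
  show "(\<lambda>\<epsilon> x. K (h \<epsilon>) (f \<epsilon>) x - K (h' \<epsilon>) (f' \<epsilon>) x) \<in> Sobolev_nets X"
    unfolding Sobolev_nets_def
    using Sobolev_inf_diff[OF openX kapp_Sobolev_inf[OF Sobolev_netsD[OF s(1)] Sobolev_netsD[OF s(2)]]
      kapp_Sobolev_inf[OF Sobolev_netsD[OF s(3)] Sobolev_netsD[OF s(4)]]] by blast
  fix m
  let ?R = "\<lambda>\<epsilon>. num_indices X m * (Sobolev_norm X m (f \<epsilon>) * Sobolev_norm XX m (\<lambda>z. h \<epsilon> z - h' \<epsilon> z)
         + Sobolev_norm XX m (h' \<epsilon>) * Sobolev_norm X m (\<lambda>x. f \<epsilon> x - f' \<epsilon> x))"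
  show "neglr (\<lambda>\<epsilon>. Sobolev_norm X m (\<lambda>x. K (h \<epsilon>) (f \<epsilon>) x - K (h' \<epsilon>) (f' \<epsilon>) x))"
  proof (rule neglr_mono[OF _ Sobolev_norm_nonneg])
    show "neglr ?R"
      using h f d by (intro neglr_mult[OF modr_const] neglr_add neglr_mult) (auto simp: moderate_iff negligible_iff)
    show "Sobolev_norm X m (\<lambda>x. K (h \<epsilon>) (f \<epsilon>) x - K (h' \<epsilon>) (f' \<epsilon>) x)
        \<le> ?R \<epsilon>" if e: "\<epsilon> \<in> {0<..1}" for \<epsilon>
      using kapp_diff_Sobolev_norm[OF Sobolev_netsD[OF s(1) e] Sobolev_netsD[OF s(3) e] Sobolev_netsD[OF s(2) e] Sobolev_netsD[OF s(4) e], of m]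
      by (simp add: mult.commute)
  qed
qed

text \<open>Resolves the \<open>THE\<close>: the class does not change with the representatives, and
  one pair of representatives pins it down.\<close>

lemma gen_int_op_eq:
  assumes H: "net_class XX H" and F: "net_class X F" and h: "h \<in> H" and f: "f \<in> F"
  shows "gen_int_op X H F = Cl X (\<lambda>\<epsilon>. K (h \<epsilon>) (f \<epsilon>))"
proof -
  have eq: "(\<lambda>\<epsilon> x. LINT y|lborel_on X. h \<epsilon> (x, y) * f \<epsilon> y) = (\<lambda>\<epsilon>. K (h \<epsilon>) (f \<epsilon>))" for h f
    by (simp add: kapp_def fun_eq_iff)
  have "Cl X (\<lambda>\<epsilon>. K (h \<epsilon>) (f \<epsilon>)) = Cl X (\<lambda>\<epsilon>. K (h' \<epsilon>) (f' \<epsilon>))"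
    if "h' \<in> H" "f' \<in> F" for h' f'
    using H F h f that unfolding net_class_def
    by (intro Cl_eq openX kapp_moderate kapp_diff_negligible) blast+
  then show ?thesis
    unfolding gen_int_op_def eq using h f by (intro the_equality) blast+
qed

section \<open>Powers of the operator and their kernels\<close>

lemma iter_kernel_Sobolev_measurable:
  assumes "h \<in> Sobolev_inf XX"
  shows "iter_kernel X n h \<in> borel_measurable (lborel_on XX)"
  using iter_kernel_measurable[OF openX Sobolev_inf_measurable[OF assms, unfolded lborel_on_XX]]
  unfolding lborel_on_XX .

text \<open>For fixed n the bound is a power of a moderate quantity. Logarithmic growth enters with
  the full series.\<close>

lemma iter_kernel_moderate:
  assumes h: "h \<in> moderate_nets XX"
  shows "(\<lambda>\<epsilon>. iter_kernel X (Suc n) (h \<epsilon>)) \<in> moderate_nets XX"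
  unfolding moderate_iff
proof (intro conjI allI)
  have s: "h \<epsilon> \<in> Sobolev_inf XX" if "\<epsilon> \<in> {0<..1}" for \<epsilon>
    using h that by (auto simp: moderate_iff intro: Sobolev_netsD)
  note w = iter_parts_wfam[OF openX Sobolev_inf_wfam[OF openXX s] Sobolev_inf_sqint[OF s]]
  show "(\<lambda>\<epsilon>. iter_kernel X (Suc n) (h \<epsilon>)) \<in> Sobolev_nets XX"
    unfolding Sobolev_nets_def using wfam_Sobolev_inf[OF openXX w iter_kernel_Sobolev_measurable[OF s]] by blast
  fix m
  show "modr (\<lambda>\<epsilon>. Sobolev_norm XX m (iter_kernel X (Suc n) (h \<epsilon>)))"
  proof (rule modr_mono[OF _ Sobolev_norm_nonneg])
    show "modr (\<lambda>\<epsilon>. num_indices XX m * Sobolev_norm XX m (h \<epsilon>) ^ Suc n)"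
      using h by (intro modr_mult modr_const modr_power) (auto simp: moderate_iff)
    fix \<epsilon> :: real assume e: "\<epsilon> \<in> {0<..1}"
    show "Sobolev_norm XX m (iter_kernel X (Suc n) (h \<epsilon>)) \<le> num_indices XX m * Sobolev_norm XX m (h \<epsilon>) ^ Suc n"
      by (rule Sobolev_norm_le[OF openXX w[OF e e] iter_kernel_Sobolev_measurable[OF s[OF e]]],
          rule iter_parts_bound[OF openX Sobolev_inf_wfam[OF openXX s[OF e]] Sobolev_inf_sqint[OF s[OF e]],
            where I = "multi_indices m"])
         (auto intro: split_index_multi wparts_le_Sobolev_norm[OF openXX s[OF e]])
  qed
qed

text \<open>The operator is applied once to F and the induction hypothesis to the resulting class.
  Associativity of kernels and the recursion for \<open>iter_kernel\<close>, both valid almost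
  everywhere, then identify the two nets modulo negligible ones.\<close>

lemma gen_int_op_power:
  assumes H: "net_class XX H" and h: "h \<in> H" and F: "F \<in> G_L2 X" and f: "f \<in> F"
  shows "(gen_int_op X H ^^ Suc n) F = Cl X (\<lambda>\<epsilon>. K (iter_kernel X (Suc n) (h \<epsilon>)) (f \<epsilon>))"
  using F f
proof (induction n arbitrary: F f)
  case 0
  then show ?case using gen_int_op_eq[OF H net_class_G_L2[OF openX] h] by (simp add: iter_kernel_1[OF openX])
next
  case (Suc n)
  have hm: "h \<in> moderate_nets XX" using H h by (auto simp: net_class_def)
  have fm: "f \<in> moderate_nets X" using net_class_G_L2[OF openX Suc.prems(1)] Suc.prems(2) by (auto simp: net_class_def)
  let ?g = "\<lambda>\<epsilon>. K (h \<epsilon>) (f \<epsilon>)" and ?L = "\<lambda>n \<epsilon>. iter_kernel X (Suc n) (h \<epsilon>)"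
  have gm: "?g \<in> moderate_nets X" by (rule kapp_moderate[OF hm fm])
  have hs: "h \<epsilon> \<in> Sobolev_inf XX" and fs: "f \<epsilon> \<in> Sobolev_inf X" if "\<epsilon> \<in> {0<..1}" for \<epsilon>
    using hm fm that by (auto simp: moderate_iff intro: Sobolev_netsD)
  \<comment> \<open>The innermost application is split off, matching \<open>iter_kernel_Suc\<close>,
    which attaches the new factor on the right.\<close>
  have "(gen_int_op X H ^^ Suc (Suc n)) F = (gen_int_op X H ^^ Suc n) (gen_int_op X H F)"
    by (subst funpow_Suc_right) simp
  also have "\<dots> = (gen_int_op X H ^^ Suc n) (Cl X ?g)"
    using gen_int_op_eq[OF H net_class_G_L2[OF openX Suc.prems(1)] h Suc.prems(2)] by simp
  also have "\<dots> = Cl X (\<lambda>\<epsilon>. K (?L n \<epsilon>) (?g \<epsilon>))"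
    by (rule Suc.IH[OF Cl_in_G_L2[OF gm] self_in_Cl[OF openX gm]])
  also have "\<dots> = Cl X (\<lambda>\<epsilon>. K (?L (Suc n) \<epsilon>) (f \<epsilon>))"
  proof (rule Cl_eq[OF openX])
    show m1: "(\<lambda>\<epsilon>. K (?L n \<epsilon>) (?g \<epsilon>)) \<in> moderate_nets X"
      by (intro kapp_moderate iter_kernel_moderate hm gm)
    show m2: "(\<lambda>\<epsilon>. K (?L (Suc n) \<epsilon>) (f \<epsilon>)) \<in> moderate_nets X"
      by (intro kapp_moderate iter_kernel_moderate hm fm)
    show "(\<lambda>\<epsilon> x. K (?L n \<epsilon>) (?g \<epsilon>) x
        - K (?L (Suc n) \<epsilon>) (f \<epsilon>) x) \<in> negligible_nets X"
    proof (rule negligible_AE_zero[OF openX])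
      fix \<epsilon> :: real assume e: "\<epsilon> \<in> {0<..1}"
      have "K (?L n \<epsilon>) (?g \<epsilon>) \<in> borel_measurable (lborel_on X)"
        "K (?L (Suc n) \<epsilon>) (f \<epsilon>) \<in> borel_measurable (lborel_on X)"
        using m1 m2 e by (auto simp: moderate_iff intro!: Sobolev_inf_measurable dest: Sobolev_netsD)
      then show "(\<lambda>x. K (?L n \<epsilon>) (?g \<epsilon>) x
        - K (?L (Suc n) \<epsilon>) (f \<epsilon>) x) \<in> borel_measurable (lborel_on X)"
        by simp
      note h' = Sobolev_inf_sqint[OF hs[OF e], unfolded lborel_on_XX]
        and L = iter_kernel_sqint[OF openX Sobolev_inf_wfam[OF openXX hs[OF e]] Sobolev_inf_sqint[OF hs[OF e]], unfolded lborel_on_XX]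
        and f' = Sobolev_inf_sqint[OF fs[OF e]]
      have "AE x in lborel_on X. K (?L n \<epsilon>) (?g \<epsilon>) x
          = K (kcomp (lborel_on X) (?L n \<epsilon>) (h \<epsilon>)) (f \<epsilon>) x"
        by (rule T.kapp_kapp[OF L h' f'])
      moreover have "AE x in lborel_on X. K (?L (Suc n) \<epsilon>) (f \<epsilon>) x
          = K (kcomp (lborel_on X) (?L n \<epsilon>) (h \<epsilon>)) (f \<epsilon>) x"
        by (rule P.kapp_cong_AE[OF iter_kernel_Suc[OF openX h']])
           (use L h' f' T.sqint_kcomp[OF L h'] in \<open>auto intro: sqint_measurable\<close>)
      ultimately show "AE x in lborel_on X. K (?L n \<epsilon>) (?g \<epsilon>) x
        - K (?L (Suc n) \<epsilon>) (f \<epsilon>) x = 0"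
        by eventually_elim simp
    qed
  qed
  finally show ?case .
qed

lemma iter_kernel_is_kernel:
  assumes H: "net_class XX H" and h: "h \<in> H"
  shows "is_kernel_of X (Cl XX (\<lambda>\<epsilon>. iter_kernel X (Suc n) (h \<epsilon>))) (gen_int_op X H ^^ Suc n)"
  unfolding is_kernel_of_def
proof (intro conjI ballI)
  have m: "(\<lambda>\<epsilon>. iter_kernel X (Suc n) (h \<epsilon>)) \<in> moderate_nets XX"
    using H h by (intro iter_kernel_moderate) (auto simp: net_class_def)
  show C: "Cl XX (\<lambda>\<epsilon>. iter_kernel X (Suc n) (h \<epsilon>)) \<in> G_L2 XX" by (rule Cl_in_G_L2[OF m])
  fix F assume F: "F \<in> G_L2 X"
  note cF = net_class_G_L2[OF openX F]
  then obtain f where f: "f \<in> F" by (auto simp: net_class_def)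
  show "(gen_int_op X H ^^ Suc n) F = gen_int_op X (Cl XX (\<lambda>\<epsilon>. iter_kernel X (Suc n) (h \<epsilon>))) F"
    unfolding gen_int_op_power[OF H h F f]
    by (rule gen_int_op_eq[OF net_class_G_L2[OF openXX C] cF self_in_Cl[OF openXX m] f, symmetric])
qed

section \<open>The sum of the exponential series and its class\<close>

lemma exp_series_sumD:
  assumes "h \<in> Sobolev_nets XX" "exp_series_sum X h S" "\<epsilon> \<in> {0<..1}"
  shows "wfam XX (S \<epsilon>) (exp_parts X (wparts XX (h \<epsilon>)))" "S \<epsilon> \<in> borel_measurable (lborel_on XX)"
    "S \<epsilon> \<in> Sobolev_inf XX"
proof -
  have s: "h \<epsilon> \<in> Sobolev_inf XX" using assms by (auto intro: Sobolev_netsD)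
  have S: "L2_sums XX (\<lambda>n z. iter_kernel X n (h \<epsilon>) z / fact n) (S \<epsilon>)"
    using assms unfolding exp_series_sum_def by blast
  show w: "wfam XX (S \<epsilon>) (exp_parts X (wparts XX (h \<epsilon>)))"
    by (rule exp_parts_wfam[OF openX Sobolev_inf_wfam[OF openXX s] Sobolev_inf_sqint[OF s] S])
  show m: "S \<epsilon> \<in> borel_measurable (lborel_on XX)"
    using S unfolding L2_sums_iff by (auto intro: sqint_measurable)
  show "S \<epsilon> \<in> Sobolev_inf XX" by (rule wfam_Sobolev_inf[OF openXX w m])
qed

lemma exp_series_moderate:
  assumes h: "h \<in> log_nets XX" and S: "exp_series_sum X h S"
  shows "S \<in> moderate_nets XX"
  unfolding moderate_iff
proof (intro conjI allI)
  have hs: "h \<in> Sobolev_nets XX" using h by (simp add: log_nets_def)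
  note D = exp_series_sumD[OF hs S]
  show "S \<in> Sobolev_nets XX" unfolding Sobolev_nets_def using D(3) by blast
  fix m
  show "modr (\<lambda>\<epsilon>. Sobolev_norm XX m (S \<epsilon>))"
  proof (rule modr_mono[OF _ Sobolev_norm_nonneg])
    show "modr (\<lambda>\<epsilon>. num_indices XX m * exp (Sobolev_norm XX m (h \<epsilon>)))"
      using h by (intro modr_mult modr_const modr_exp_log) (auto simp: log_nets_def)
    fix \<epsilon> :: real assume e: "\<epsilon> \<in> {0<..1}"
    note s = Sobolev_netsD[OF hs e]
    show "Sobolev_norm XX m (S \<epsilon>) \<le> num_indices XX m * exp (Sobolev_norm XX m (h \<epsilon>))"
      by (rule Sobolev_norm_le[OF openXX D(1,2)[OF e]],
          rule exp_parts_bound[OF openX Sobolev_inf_wfam[OF openXX s] Sobolev_inf_sqint[OF s], where I = "multi_indices m"])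
         (auto intro: split_index_multi wparts_le_Sobolev_norm[OF openXX s])
  qed
qed

text \<open>The exponential factor is moderate and the difference of the representatives negligible;
  the product of the two is negligible.\<close>

lemma exp_series_diff_negligible:
  assumes h: "h \<in> log_nets XX" and S: "exp_series_sum X h S"
    and h': "h' \<in> log_nets XX" and S': "exp_series_sum X h' S'"
    and d: "(\<lambda>\<epsilon> z. h \<epsilon> z - h' \<epsilon> z) \<in> negligible_nets XX"
  shows "(\<lambda>\<epsilon> z. S \<epsilon> z - S' \<epsilon> z) \<in> negligible_nets XX"
  unfolding negligible_iff
proof (intro conjI allI)
  have hs: "h \<in> Sobolev_nets XX" "h' \<in> Sobolev_nets XX" using h h' by (simp_all add: log_nets_def)
  note D = exp_series_sumD[OF hs(1) S] and D' = exp_series_sumD[OF hs(2) S']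
  show "(\<lambda>\<epsilon> z. S \<epsilon> z - S' \<epsilon> z) \<in> Sobolev_nets XX"
    unfolding Sobolev_nets_def using Sobolev_inf_diff[OF openXX D(3) D'(3)] by blast
  fix m
  let ?N = "Sobolev_norm XX m"
  show "neglr (\<lambda>\<epsilon>. ?N (\<lambda>z. S \<epsilon> z - S' \<epsilon> z))"
  proof (rule neglr_mono[OF _ Sobolev_norm_nonneg])
    \<comment> \<open>The sum of the two Sobolev norms is a common bound B for both representatives
      and is still logarithmic.\<close>
    show "neglr (\<lambda>\<epsilon>. num_indices XX m * (exp (?N (h \<epsilon>) + ?N (h' \<epsilon>)) * ?N (\<lambda>z. h \<epsilon> z - h' \<epsilon> z)))"
      using h h' d by (intro neglr_mult modr_const modr_exp_log sum_in_bigo) (auto simp: log_nets_def negligible_iff)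
    fix \<epsilon> :: real assume e: "\<epsilon> \<in> {0<..1}"
    note s = Sobolev_netsD[OF hs(1) e] and s' = Sobolev_netsD[OF hs(2) e]
    note w = Sobolev_inf_wfam[OF openXX s] and w' = Sobolev_inf_wfam[OF openXX s']
    have m: "(\<lambda>z. S \<epsilon> z - S' \<epsilon> z) \<in> borel_measurable (lborel_on XX)"
      using D(2)[OF e] D'(2)[OF e] by simp
    have b: "l2norm (lborel_on XX) (wparts XX (h \<epsilon>) \<gamma>) \<le> ?N (h \<epsilon>) + ?N (h' \<epsilon>)"
      "l2norm (lborel_on XX) (wparts XX (h' \<epsilon>) \<gamma>) \<le> ?N (h \<epsilon>) + ?N (h' \<epsilon>)" if "\<gamma> \<in> multi_indices m" for \<gamma>
      using wparts_le_Sobolev_norm[OF openXX s that] wparts_le_Sobolev_norm[OF openXX s' that]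
        Sobolev_norm_nonneg[of XX m "h \<epsilon>"] Sobolev_norm_nonneg[of XX m "h' \<epsilon>"] by linarith+
    show "?N (\<lambda>z. S \<epsilon> z - S' \<epsilon> z) \<le> num_indices XX m * (exp (?N (h \<epsilon>) + ?N (h' \<epsilon>)) * ?N (\<lambda>z. h \<epsilon> z - h' \<epsilon> z))"
      by (rule Sobolev_norm_le[OF openXX wfam_diff[OF openXX D(1)[OF e] D'(1)[OF e]] m],
          rule exp_parts_diff_bound[OF openX w Sobolev_inf_sqint[OF s] w' Sobolev_inf_sqint[OF s'], where I = "multi_indices m"])
         (auto intro: split_index_multi b wparts_diff_le[OF openXX s s'])
  qed
qed

text \<open>Every representative and every sum of its series yield the same class, which resolves
  the \<open>THE\<close>. The case h' = h disposes of the null set on which S is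
  undetermined.\<close>

lemma exp_kernel_eq:
  assumes H: "net_class XX H" "H \<subseteq> log_nets XX" and h: "h \<in> H" and S: "exp_series_sum X h S"
  shows "exp_kernel X H = Cl XX S"
  unfolding exp_kernel_def
proof (rule the_equality)
  show "\<forall>h'\<in>H. \<forall>S'. exp_series_sum X h' S' \<longrightarrow> Cl XX S = Cl XX S'"
  proof (intro ballI allI impI)
    fix h' S' assume h': "h' \<in> H" and S': "exp_series_sum X h' S'"
    have l: "h \<in> log_nets XX" "h' \<in> log_nets XX" using H h h' by auto
    show "Cl XX S = Cl XX S'"
      using H(1) h h' unfolding net_class_def
      by (intro Cl_eq[OF openXX exp_series_moderate[OF l(1) S] exp_series_moderate[OF l(2) S']]
          exp_series_diff_negligible[OF l(1) S l(2) S']) blast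
  qed
qed (use h S in blast)

end

theorem mainTheorem7:
  fixes X :: "(real ^ 'd) set"
    and H :: "((real ^ 'd) \<times> (real ^ 'd)) net set"
  assumes "open X"
    and "H \<in> G_L2_ln (X \<times> X)"
  shows "\<forall>h\<in>H.
    (\<forall>n\<ge>1. is_kernel_of X (Cl (X \<times> X) (\<lambda>\<epsilon>. iter_kernel X n (h \<epsilon>))) (gen_int_op X H ^^ n)) \<and>
    (\<forall>\<epsilon>\<in>{0<..1}. \<exists>s. L2_sums (X \<times> X) (\<lambda>n z. iter_kernel X n (h \<epsilon>) z / fact n) s) \<and>
    (\<forall>S. exp_series_sum X h S \<longrightarrow>
        S \<in> moderate_nets (X \<times> X) \<and>
        (\<forall>F\<in>G_L2 X. gen_exp X H F = G_add X (gen_int_op X (Cl (X \<times> X) S) F) F))"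
proof
  fix h assume h: "h \<in> H"
  have o: "open (X \<times> X)" using assms(1) by (intro open_Times)
  have H: "net_class (X \<times> X) H" "H \<subseteq> log_nets (X \<times> X)"
    using net_class_quotient[OF o assms(2)[unfolded G_L2_ln_def]] log_nets_moderate by auto
  have log: "h \<in> log_nets (X \<times> X)" using H(2) h by blast
  \<comment> \<open>\<open>iter_kernel_is_kernel\<close> counts from 0, hence the shift to n -
    1.\<close>
  have "is_kernel_of X (Cl (X \<times> X) (\<lambda>\<epsilon>. iter_kernel X n (h \<epsilon>))) (gen_int_op X H ^^ n)" if "n \<ge> 1" for n
    using iter_kernel_is_kernel[OF assms(1) H(1) h, of "n - 1"] that by simp
  \<comment> \<open>The witness is \<open>exp_parts\<close> at the zero multi-index.\<close>
  moreover have "\<exists>s. L2_sums (X \<times> X) (\<lambda>n z. iter_kernel X n (h \<epsilon>) z / fact n) s" if "\<epsilon> \<in> {0<..1}" for \<epsilon>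
  proof -
    have "h \<epsilon> \<in> Sobolev_inf (X \<times> X)" using log that by (auto simp: log_nets_def intro: Sobolev_netsD)
    then show ?thesis
      using exp_parts_L2_sums[OF assms(1) Sobolev_inf_wfam[OF o] Sobolev_inf_sqint] by blast
  qed
  moreover have "S \<in> moderate_nets (X \<times> X)" if "exp_series_sum X h S" for S
    by (rule exp_series_moderate[OF assms(1) log that])
  moreover have "gen_exp X H F = G_add X (gen_int_op X (Cl (X \<times> X) S) F) F" if "exp_series_sum X h S" for S F
    unfolding gen_exp_def exp_kernel_eq[OF assms(1) H h that] ..
  ultimately show "(\<forall>n\<ge>1. is_kernel_of X (Cl (X \<times> X) (\<lambda>\<epsilon>. iter_kernel X n (h \<epsilon>))) (gen_int_op X H ^^ n)) \<and>
    (\<forall>\<epsilon>\<in>{0<..1}. \<exists>s. L2_sums (X \<times> X) (\<lambda>n z. iter_kernel X n (h \<epsilon>) z / fact n) s) \<and>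
    (\<forall>S. exp_series_sum X h S \<longrightarrow>
        S \<in> moderate_nets (X \<times> X) \<and>
        (\<forall>F\<in>G_L2 X. gen_exp X H F = G_add X (gen_int_op X (Cl (X \<times> X) S) F) F))"
    by blast
qed

end
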